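(* Let $M$ be a loopless paving matroid of rank $k\ge1$ on a ground set of size $n$. For $h\ge k$ let $\lambda_h$ be the number of stressed hyperplanes of $M$ of size $h$. Then \[\underline{H}_M(x)=\underline{H}_{U_{k,n}}(x)-\sum_{h\ge k}\lambda_h\bigl(\underline{H}_{U_{k,h+1}}(x)-\underline{H}_{U_{k-1,h}\oplus U_{1,1}}(x)\bigr),\] \[H_M(x)=H_{U_{k,n}}(x)-\sum_{h\ge k}\lambda_h\bigl(H_{U_{k,h+1}}(x)-H_{U_{k-1,h}\oplus U_{1,1}}(x)\bigr).\]
   Context: $U_{a,b}$ is the uniform matroid of rank $a$ on $b$ elements (bases: all $a$-subsets); $\oplus$ is direct sum. A matroid of rank $k$ is paving if every circuit has size at least $k$. A hyperplane is a flat of rank $\mathrm{rk}(M)-1$; a subset $A$ is stressed if both the restriction $M|_A$ and the contraction $M/A$ are uniform matroids; a stressed hyperplane is a hyperplane that is stressed. For a loopless matroid $M$ on $E$ with lattice of flats $\mathcal{L}(M)$: $\underline{\mathrm{CH}}(M)=\mathbb{Q}[x_F: F\in\mathcal{L}(M)\setminus\{\varnothing,E\}]/(I+J)$, $I$ generated by $x_{F_1}x_{F_2}$ for incomparable $F_1,F_2$, $J$ by $\sum_{F\ni i}x_F-\sum_{F\ni j}x_F$ for $i,j\in E$; $\mathrm{CH}(M)=\mathbb{Q}[x_F,y_i: F\in\mathcal{L}(M)\setminus\{E\},\, i\in E]/(I'+J')$, $I'$ generated by $y_i-\sum_{F\not\ni i}x_F$, $J'$ by $x_{F_1}x_{F_2}$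 for incomparable $F_1,F_2$ and $y_ix_F$ for $i\notin F$. Variables of degree $1$; $\underline{H}_M$ and $H_M$ are the Hilbert series $\sum_j\dim_{\mathbb{Q}}(\cdot)^jx^j$. *)

theory Defs
  imports Main "HOL-Library.Multiset" "HOL-Library.Function_Algebras"
    "HOL-Computational_Algebra.Formal_Power_Series"
begin

definition matroid :: "'a set \<Rightarrow> ('a set \<Rightarrow> bool) \<Rightarrow> bool" where
  "matroid E indep \<longleftrightarrow> finite E \<and> indep {} \<and>
     (\<forall>X. indep X \<longrightarrow> X \<subseteq> E) \<and>
     (\<forall>X Y. indep Y \<and> X \<subseteq> Y \<longrightarrow> indep X) \<and>
     (\<forall>X Y. indep X \<and> indep Y \<and> card X < card Y \<longrightarrow> (\<exists>y\<in>Y - X. indep (insert y X)))"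

definition rank :: "('a set \<Rightarrow> bool) \<Rightarrow> 'a set \<Rightarrow> nat" where
  "rank indep A = Max {card X | X. X \<subseteq> A \<and> indep X}"

definition loopless :: "'a set \<Rightarrow> ('a set \<Rightarrow> bool) \<Rightarrow> bool" where
  "loopless E indep \<longleftrightarrow> (\<forall>e\<in>E. indep {e})"

definition circuit :: "'a set \<Rightarrow> ('a set \<Rightarrow> bool) \<Rightarrow> 'a set \<Rightarrow> bool" where
  "circuit E indep C \<longleftrightarrow> C \<subseteq> E \<and> \<not> indep C \<and> (\<forall>D. D \<subset> C \<longrightarrow> indep D)"

definition paving :: "'a set \<Rightarrow> ('a set \<Rightarrow> bool) \<Rightarrow> bool" where
  "paving E indep \<longleftrightarrow> (\<forall>C. circuit E indep C \<longrightarrow> card C \<ge> rank indep E)"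

definition flat :: "'a set \<Rightarrow> ('a set \<Rightarrow> bool) \<Rightarrow> 'a set \<Rightarrow> bool" where
  "flat E indep F \<longleftrightarrow> F \<subseteq> E \<and> (\<forall>x\<in>E - F. rank indep (insert x F) > rank indep F)"

definition hyperplane :: "'a set \<Rightarrow> ('a set \<Rightarrow> bool) \<Rightarrow> 'a set \<Rightarrow> bool" where
  "hyperplane E indep H \<longleftrightarrow> flat E indep H \<and> rank indep H + 1 = rank indep E"

definition uniform :: "'a set \<Rightarrow> ('a set \<Rightarrow> bool) \<Rightarrow> bool" where
  "uniform E indep \<longleftrightarrow> (\<forall>X. X \<subseteq> E \<and> card X \<le> rank indep E \<longrightarrow> indep X)"

definition restr_indep :: "('a set \<Rightarrow> bool) \<Rightarrow> 'a set \<Rightarrow> 'a set \<Rightarrow> bool" where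
  "restr_indep indep A X \<longleftrightarrow> X \<subseteq> A \<and> indep X"

definition contr_indep :: "'a set \<Rightarrow> ('a set \<Rightarrow> bool) \<Rightarrow> 'a set \<Rightarrow> 'a set \<Rightarrow> bool" where
  "contr_indep E indep A X \<longleftrightarrow> X \<subseteq> E - A \<and> rank indep (X \<union> A) = card X + rank indep A"

definition stressed :: "'a set \<Rightarrow> ('a set \<Rightarrow> bool) \<Rightarrow> 'a set \<Rightarrow> bool" where
  "stressed E indep A \<longleftrightarrow> A \<subseteq> E \<and> uniform A (restr_indep indep A) \<and>
     uniform (E - A) (contr_indep E indep A)"

definition stressed_hyperplane :: "'a set \<Rightarrow> ('a set \<Rightarrow> bool) \<Rightarrow> 'a set \<Rightarrow> bool" where
  "stressed_hyperplane E indep H \<longleftrightarrow> hyperplane E indep H \<and> stressed E indep H"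

definition U_ground :: "nat \<Rightarrow> nat set" where "U_ground b = {0..<b}"
definition U_indep :: "nat \<Rightarrow> nat \<Rightarrow> nat set \<Rightarrow> bool" where
  "U_indep a b X \<longleftrightarrow> X \<subseteq> {0..<b} \<and> card X \<le> a"

text \<open>U_{a,b} \<oplus> U_{1,1} on ground set {0..<b+1}, the extra element being b\<close>
definition Usum_ground :: "nat \<Rightarrow> nat set" where "Usum_ground b = {0..<b+1}"
definition Usum_indep :: "nat \<Rightarrow> nat \<Rightarrow> nat set \<Rightarrow> bool" where
  "Usum_indep a b X \<longleftrightarrow> X \<subseteq> {0..<b+1} \<and> card (X \<inter> {0..<b}) \<le> a"

text \<open>Polynomials in variables of type 'v: coefficient functions on monomials (multisets).\<close>
type_synonym 'v qpoly = "'v multiset \<Rightarrow> rat"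

definition qscale :: "rat \<Rightarrow> 'v qpoly \<Rightarrow> 'v qpoly" where
  "qscale c p = (\<lambda>m. c * p m)"

definition monoms :: "'v set \<Rightarrow> nat \<Rightarrow> 'v multiset set" where
  "monoms V j = {m. set_mset m \<subseteq> V \<and> size m = j}"

definition homog :: "nat \<Rightarrow> 'v qpoly \<Rightarrow> bool" where
  "homog d p \<longleftrightarrow> (\<forall>m. p m \<noteq> 0 \<longrightarrow> size m = d)"

definition mono_mult :: "'v multiset \<Rightarrow> 'v qpoly \<Rightarrow> 'v qpoly" where
  "mono_mult m g = (\<lambda>m'. if m \<subseteq># m' then g (m' - m) else 0)"

text \<open>degree-j part of the ideal generated by a set G of homogeneous polynomials in Q[V]\<close>
definition ideal_part :: "'v set \<Rightarrow> 'v qpoly set \<Rightarrow> nat \<Rightarrow> 'v qpoly set" where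
  "ideal_part V G j = module.span qscale
     {mono_mult m g | m g d. g \<in> G \<and> homog d g \<and> set_mset m \<subseteq> V \<and> size m + d = j}"

definition quot_dim :: "'v set \<Rightarrow> 'v qpoly set \<Rightarrow> nat \<Rightarrow> nat" where
  "quot_dim V G j = card (monoms V j) - vector_space.dim qscale (ideal_part V G j)"

definition hilbert :: "'v set \<Rightarrow> 'v qpoly set \<Rightarrow> int fps" where
  "hilbert V G = Abs_fps (\<lambda>j. int (quot_dim V G j))"

definition monomial_poly :: "'v multiset \<Rightarrow> 'v qpoly" where
  "monomial_poly m0 = (\<lambda>m. if m = m0 then 1 else 0)"

definition lin_poly :: "'v set \<Rightarrow> ('v \<Rightarrow> rat) \<Rightarrow> 'v qpoly" where
  "lin_poly V c = (\<lambda>m. if size m = 1 \<and> set_mset m \<subseteq> V then c (the_elem (set_mset m)) else 0)"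

definition red_vars :: "'a set \<Rightarrow> ('a set \<Rightarrow> bool) \<Rightarrow> 'a set set" where
  "red_vars E indep = {F. flat E indep F \<and> F \<noteq> {} \<and> F \<noteq> E}"

definition red_gens :: "'a set \<Rightarrow> ('a set \<Rightarrow> bool) \<Rightarrow> 'a set qpoly set" where
  "red_gens E indep =
     {monomial_poly {#F1, F2#} | F1 F2. F1 \<in> red_vars E indep \<and> F2 \<in> red_vars E indep
        \<and> \<not> F1 \<subseteq> F2 \<and> \<not> F2 \<subseteq> F1}
   \<union> {lin_poly (red_vars E indep) (\<lambda>F. (if i \<in> F then 1 else 0) - (if j \<in> F then 1 else 0))
        | i j. i \<in> E \<and> j \<in> E}"

definition red_H :: "'a set \<Rightarrow> ('a set \<Rightarrow> bool) \<Rightarrow> int fps" where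
  "red_H E indep = hilbert (red_vars E indep) (red_gens E indep)"

text \<open>augmented: variables Inl F (x_F, F a proper flat) and Inr i (y_i, i \<in> E)\<close>
definition aug_vars :: "'a set \<Rightarrow> ('a set \<Rightarrow> bool) \<Rightarrow> ('a set + 'a) set" where
  "aug_vars E indep = Inl ` {F. flat E indep F \<and> F \<noteq> E} \<union> Inr ` E"

definition aug_gens :: "'a set \<Rightarrow> ('a set \<Rightarrow> bool) \<Rightarrow> ('a set + 'a) qpoly set" where
  "aug_gens E indep =
     {lin_poly (aug_vars E indep)
        (\<lambda>v. case v of Inr i' \<Rightarrow> (if i' = i then 1 else 0)
                     | Inl F \<Rightarrow> (if i \<notin> F then -1 else 0)) | i. i \<in> E}
   \<union> {monomial_poly {#Inl F1, Inl F2#} | F1 F2. flat E indep F1 \<and> F1 \<noteq> E \<and> flat E indep F2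
        \<and> F2 \<noteq> E \<and> \<not> F1 \<subseteq> F2 \<and> \<not> F2 \<subseteq> F1}
   \<union> {monomial_poly {#Inr i, Inl F#} | i F. i \<in> E \<and> flat E indep F \<and> F \<noteq> E \<and> i \<notin> F}"

definition aug_H :: "'a set \<Rightarrow> ('a set \<Rightarrow> bool) \<Rightarrow> int fps" where
  "aug_H E indep = hilbert (aug_vars E indep) (aug_gens E indep)"

end

(*
The Chow ring is built up by adjoining the flats one at a time from the top of the lattice,
as in the iterated blow-up construction of the wonderful compactification.  Write
A for the quotient built so far, x for the variable of the new flat F, z for the sum of the
variables of the larger flats and J for the ideal of A with A / J the ring of the contraction M / F.
The new ring is A[x] / (x J, (x + z)^d), with d the rank of F (plus one in the augmented case), and
submodularity of the rank gives z^d J = 0.  Hence division by the monic polynomial (x + z)^d works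
and the new ring is A plus copies of A / J in the x-degrees 1, ..., d - 1.  With
[m] = t + t^2 + ... + t^m this gives
  H(M) = 1 + sum over nonempty flats F of [rk F - 1] H(M / F)   (reduced Hilbert series),
and the augmented series has [rk F] in place of [rk F - 1].

In a paving matroid of rank k the proper flats are the subsets with at most k - 2 elements and the
hyperplanes, so the recursion unwinds to H(M) = A(n, k) + sum over hyperplanes of f_k(size).  Every
(k - 1)-subset lies in exactly one hyperplane, hence replacing a hyperplane of size h >= k by its
(k - 1)-subsets changes H(M) by f_k(h) - C(h, k - 1) f_k(k - 1), which is read off from
U_{k-1,h} + U_{1,1}: apart from hyperplanes of size k - 1 it has a single one, of size h.
*)

theory Submission
  imports Defs "HOL-Library.Poly_Mapping" "HOL-Computational_Algebra.Polynomial"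
begin

section \<open>Ideals and polynomial rings\<close>

text \<open>The linear relations do not adapt to rings that contain only some of the flats. They are
  traded for a variable of \<open>E\<close> and for power relations: writing \<open>y F\<close> for
  the sum of the variables of all flats containing F, the reduced ring has
  \<open>y F ^ rk F = 0\<close> and \<open>Var F * y G ^ (rk G - rk F) = 0\<close> for F < G,
  besides the products of incomparable flats. In the augmented ring \<open>x_{}\<close> becomes
  minus the sum of the other variables and \<open>y_i\<close> becomes \<open>- Y i\<close>, so that
  \<open>y_i x_{} = 0\<close> turns into \<open>Y i ^ 2 = 0\<close> where the reduced ring has
  \<open>Y i = 0\<close>; this is the extra one in d. The condition z^d J = 0 is decisive: since x J
  = 0, multiplying (x + z)^d by a in J gives z^d a, and if this were not already zero the new
  variable would impose new relations on A. The Hilbert series are defined through spans of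
  coefficient functions in each degree, so the rings are carried along as finite monomial bases and
  meet the definition only through mutually inverse substitutions. The polynomials f_k are never
  evaluated.\<close>

locale ring_hom_1 =
  fixes h :: "'a::comm_ring_1 \<Rightarrow> 'b::comm_ring_1"
  assumes hom_add: "h (a + b) = h a + h b"
    and hom_mult: "h (a * b) = h a * h b"
    and hom_one: "h 1 = 1"
begin

lemma hom_zero: "h 0 = 0"
  using hom_add[of 0 0] by simp

lemma hom_uminus: "h (- a) = - h a"
  using hom_add[of "- a" a] by (simp add: hom_zero eq_neg_iff_add_eq_0)

lemma hom_diff: "h (a - b) = h a - h b"
  using hom_add[of a "- b"] by (simp add: hom_uminus)

lemma hom_sum: "h (\<Sum>i\<in>S. f i) = (\<Sum>i\<in>S. h (f i))"
  by (induction S rule: infinite_finite_induct) (auto simp: hom_zero hom_add)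

lemma hom_power: "h (a ^ n) = h a ^ n"
  by (induction n) (auto simp: hom_one hom_mult)

end

definition ideal :: "'a::comm_ring_1 set \<Rightarrow> bool" where
  "ideal I \<longleftrightarrow> 0 \<in> I \<and> (\<forall>a\<in>I. \<forall>b\<in>I. a + b \<in> I) \<and> (\<forall>r. \<forall>a\<in>I. r * a \<in> I)"

lemma idealI:
  assumes "0 \<in> I" "\<And>a b. a \<in> I \<Longrightarrow> b \<in> I \<Longrightarrow> a + b \<in> I" "\<And>r a. a \<in> I \<Longrightarrow> r * a \<in> I"
  shows "ideal I"
  using assms by (auto simp: ideal_def)

lemma ideal_zero: "ideal I \<Longrightarrow> 0 \<in> I"
  by (simp add: ideal_def)

lemma ideal_add: "ideal I \<Longrightarrow> a \<in> I \<Longrightarrow> b \<in> I \<Longrightarrow> a + b \<in> I"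
  by (simp add: ideal_def)

lemma ideal_mult: "ideal I \<Longrightarrow> a \<in> I \<Longrightarrow> r * a \<in> I"
  by (simp add: ideal_def)

lemma ideal_mult_right: "ideal I \<Longrightarrow> a \<in> I \<Longrightarrow> a * r \<in> I"
  by (metis ideal_mult mult.commute)

lemma ideal_uminus: "ideal I \<Longrightarrow> a \<in> I \<Longrightarrow> - a \<in> I"
  using ideal_mult[of I a "- 1"] by simp

lemma ideal_diff: "ideal I \<Longrightarrow> a \<in> I \<Longrightarrow> b \<in> I \<Longrightarrow> a - b \<in> I"
  using ideal_add[of I a "- b"] ideal_uminus by auto

lemma ideal_sum: "ideal I \<Longrightarrow> (\<And>i. i \<in> S \<Longrightarrow> f i \<in> I) \<Longrightarrow> (\<Sum>i\<in>S. f i) \<in> I"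
  by (induction S rule: infinite_finite_induct) (auto simp: ideal_zero ideal_add)

lemma ideal_cong: "ideal I \<Longrightarrow> a - b \<in> I \<Longrightarrow> a \<in> I \<longleftrightarrow> b \<in> I"
  by (metis add_diff_cancel_left' diff_add_cancel ideal_add ideal_diff)

lemma ideal_cong_sym: "ideal I \<Longrightarrow> a - b \<in> I \<Longrightarrow> b - a \<in> I"
  by (metis ideal_uminus minus_diff_eq)

lemma ideal_cong_trans: "ideal I \<Longrightarrow> a - b \<in> I \<Longrightarrow> b - c \<in> I \<Longrightarrow> a - c \<in> I"
  by (metis ideal_add diff_add_cancel diff_diff_eq2 add_diff_eq)

lemma ideal_cong_mult:
  assumes "ideal I" "a - b \<in> I" "c - d \<in> I"
  shows "a * c - b * d \<in> I"
proof -
  have "a * c - b * d = c * (a - b) + b * (c - d)" by (simp add: algebra_simps)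
  then show ?thesis using assms by (metis ideal_add ideal_mult)
qed

lemma ideal_power_ge:
  assumes "ideal I" "a ^ m * b \<in> I" "m \<le> n"
  shows "a ^ n * b \<in> I"
proof -
  have "a ^ n * b = a ^ (n - m) * (a ^ m * b)"
    using assms(3) by (simp add: mult.assoc[symmetric] power_add[symmetric])
  then show ?thesis using assms by (simp add: ideal_mult)
qed

lemma ideal_vimage:
  assumes "ring_hom_1 h" "ideal I"
  shows "ideal {a. h a \<in> I}"
proof -
  interpret ring_hom_1 h by fact
  show ?thesis
    using assms(2) by (intro idealI) (auto simp: hom_zero hom_add hom_mult ideal_zero ideal_add ideal_mult)
qed

inductive_set ideal_gen :: "'a::comm_ring_1 set \<Rightarrow> 'a set" for S where
  zero: "0 \<in> ideal_gen S"
| base: "s \<in> S \<Longrightarrow> s \<in> ideal_gen S"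
| add: "a \<in> ideal_gen S \<Longrightarrow> b \<in> ideal_gen S \<Longrightarrow> a + b \<in> ideal_gen S"
| mult: "a \<in> ideal_gen S \<Longrightarrow> r * a \<in> ideal_gen S"

lemma ideal_ideal_gen: "ideal (ideal_gen S)"
  by (intro idealI) (auto intro: ideal_gen.intros)

lemma ideal_gen_least:
  assumes "ideal I" "S \<subseteq> I"
  shows "ideal_gen S \<subseteq> I"
proof
  fix a assume "a \<in> ideal_gen S"
  then show "a \<in> I"
    by induction (use assms in \<open>auto simp: ideal_zero ideal_add ideal_mult\<close>)
qed

text \<open>The preimage of \<open>I\<close> is an ideal, so a homomorphism is controlled on
  generators alone; \<open>univ\<close>, \<open>subst\<close> and evaluation at a rational point are
  all handled this way.\<close>

lemma ideal_gen_hom: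
  assumes "ring_hom_1 h" "ideal I" "\<And>s. s \<in> S \<Longrightarrow> h s \<in> I" "a \<in> ideal_gen S"
  shows "h a \<in> I"
  using ideal_gen_least[OF ideal_vimage[OF assms(1,2)], of S] assms(3,4) by auto

section \<open>Multivariate polynomials and their evaluation homomorphisms\<close>

type_synonym 'v mpoly = "'v multiset \<Rightarrow>\<^sub>0 rat"

abbreviation lookup :: "'v mpoly \<Rightarrow> 'v multiset \<Rightarrow> rat" where
  "lookup \<equiv> Poly_Mapping.lookup"

abbreviation keys :: "'v mpoly \<Rightarrow> 'v multiset set" where
  "keys \<equiv> Poly_Mapping.keys"

abbreviation single :: "'v multiset \<Rightarrow> rat \<Rightarrow> 'v mpoly" where
  "single \<equiv> Poly_Mapping.single"

definition Var :: "'v \<Rightarrow> 'v mpoly" where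
  "Var v = single {#v#} 1"

definition Cst :: "rat \<Rightarrow> 'v mpoly" where
  "Cst c = single 0 c"

lemma ring_hom_Cst: "ring_hom_1 Cst"
  by unfold_locales (auto simp: Cst_def single_add mult_single)

lemma Var_mult_single: "Var v * single m c = single (add_mset v m) c"
  by (simp add: Var_def mult_single)

lemma Cst_mult_single: "Cst a * single m c = single m (a * c)"
  by (simp add: Cst_def mult_single)

lemma Var_power_mult_single: "Var v ^ e * single m c = single (m + replicate_mset e v) c"
proof (induction e arbitrary: m)
  case 0
  then show ?case by simp
next
  case (Suc e)
  have "Var v ^ Suc e * single m c = Var v * (Var v ^ e * single m c)"
    by (simp add: mult.assoc)
  then show ?case using Suc by (simp add: Var_mult_single)
qed

lemma single_zero_eq_Cst: "single {#} c = Cst c"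
  by (simp add: Cst_def)

lemma single_eq: "single m c = Cst c * (\<Prod>v\<in>#m. Var v)"
proof (induction m)
  case empty
  then show ?case by (simp add: Cst_def)
next
  case (add v m)
  then show ?case
    by (simp add: Var_mult_single[symmetric] mult.left_commute)
qed

lemma mpoly_single_induct [case_names zero add]:
  fixes p :: "'v mpoly"
  assumes "P 0" "\<And>p m c. P p \<Longrightarrow> P (p + single m c)"
  shows "P p"
proof (induction p rule: update_induct)
  case const
  then show ?case using assms(1) by (metis zero_poly_mapping_def)
next
  case (update f a b)
  have "Poly_Mapping.update a b f = f + single a b"
    using update(1) by (intro poly_mapping_eqI)
      (auto simp: lookup_update lookup_add lookup_single in_keys_iff)
  then show ?case using assms(2)[OF update(3)] by simp
qed

lemma mpoly_induct [case_names const var add mult]: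
  fixes p :: "'v mpoly"
  assumes const: "\<And>c. P (Cst c)" and var: "\<And>v. P (Var v)"
    and add: "\<And>p q. P p \<Longrightarrow> P q \<Longrightarrow> P (p + q)" and mult: "\<And>p q. P p \<Longrightarrow> P q \<Longrightarrow> P (p * q)"
  shows "P p"
proof (induction p rule: mpoly_single_induct)
  case zero
  have "0 = Cst 0" by (simp add: Cst_def)
  then show ?case using const by metis
next
  case (add p m c)
  have "P (single m c)"
  proof (induction m)
    case empty
    then show ?case using const by (simp add: Cst_def)
  next
    case (add v m)
    then show ?case by (simp add: Var_mult_single[symmetric] mult var)
  qed
  then show ?case using assms(3) add by blast
qed

lemma mpoly_expand: "p = (\<Sum>m\<in>keys p. single m (lookup p m))"
  by (rule poly_mapping_eqI) (simp add: lookup_sum lookup_single when_def in_keys_iff)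

lemma lookup_single_mult:
  "lookup (single m c * p) k = (if m \<subseteq># k then c * lookup p (k - m) else 0)"
proof (induction p rule: mpoly_single_induct)
  case zero
  then show ?case by simp
next
  case (add p a b)
  have "m + a = k \<longleftrightarrow> m \<subseteq># k \<and> a = k - m"
    by (metis add_diff_cancel_left' mset_subset_eq_add_left subset_mset.add_diff_inverse)
  then show ?case
    using add by (auto simp: distrib_left lookup_add mult_single lookup_single when_def)
qed

lemma lookup_Cst_mult: "lookup (Cst c * p) k = c * lookup p k"
  by (simp add: Cst_def lookup_single_mult)

text \<open>The coefficient map \<open>\<iota>\<close> is left open so that one evaluation serves
  for substitution of polynomials, for \<open>univ\<close> with values in univariate polynomials,
  and for evaluation at a rational point.\<close>

definition peval :: "(rat \<Rightarrow> 'b::comm_ring_1) \<Rightarrow> ('v \<Rightarrow> 'b) \<Rightarrow> 'v mpoly \<Rightarrow> 'b" where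
  "peval \<iota> \<sigma> p = (\<Sum>m\<in>keys p. \<iota> (lookup p m) * (\<Prod>v\<in>#m. \<sigma> v))"

context
  fixes \<iota> :: "rat \<Rightarrow> 'b::comm_ring_1" and \<sigma> :: "'v \<Rightarrow> 'b"
  assumes \<iota>: "ring_hom_1 \<iota>"
begin

interpretation \<iota>: ring_hom_1 \<iota> by (rule \<iota>)

lemma peval_superset:
  assumes "finite A" "keys p \<subseteq> A"
  shows "peval \<iota> \<sigma> p = (\<Sum>m\<in>A. \<iota> (lookup p m) * (\<Prod>v\<in>#m. \<sigma> v))"
  unfolding peval_def using assms
  by (intro sum.mono_neutral_left) (auto simp: in_keys_iff \<iota>.hom_zero)

lemma peval_add: "peval \<iota> \<sigma> (p + q) = peval \<iota> \<sigma> p + peval \<iota> \<sigma> q"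
proof -
  have "keys (p + q) \<subseteq> keys p \<union> keys q" by (rule Poly_Mapping.keys_add)
  then show ?thesis
    by (simp add: peval_superset[of "keys p \<union> keys q"] lookup_add \<iota>.hom_add distrib_right
        sum.distrib)
qed

lemma peval_single: "peval \<iota> \<sigma> (single m c) = \<iota> c * (\<Prod>v\<in>#m. \<sigma> v)"
  by (simp add: peval_superset[of "{m}"])

lemma peval_zero: "peval \<iota> \<sigma> 0 = 0"
  by (simp add: peval_def)

lemma peval_single_mult:
  "peval \<iota> \<sigma> (p * single m c) = peval \<iota> \<sigma> p * peval \<iota> \<sigma> (single m c)"
  by (induction p rule: mpoly_single_induct)
    (simp_all add: peval_zero peval_add ring_distribs mult_single peval_single \<iota>.hom_mult mult_ac)

lemma peval_mult: "peval \<iota> \<sigma> (p * q) = peval \<iota> \<sigma> p * peval \<iota> \<sigma> q"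
  by (induction q rule: mpoly_single_induct)
    (simp_all add: peval_zero peval_add distrib_left peval_single_mult)

lemma ring_hom_peval: "ring_hom_1 (peval \<iota> \<sigma>)"
proof
  have "peval \<iota> \<sigma> (single 0 1) = 1" by (simp only: peval_single) (simp add: \<iota>.hom_one)
  then show "peval \<iota> \<sigma> 1 = 1" by simp
qed (auto simp: peval_add peval_mult)

lemma peval_Var: "peval \<iota> \<sigma> (Var v) = \<sigma> v"
  by (simp add: Var_def peval_single \<iota>.hom_one)

lemma peval_Cst: "peval \<iota> \<sigma> (Cst c) = \<iota> c"
  by (simp add: Cst_def peval_single)

end

abbreviation subst :: "('v \<Rightarrow> 'w mpoly) \<Rightarrow> 'v mpoly \<Rightarrow> 'w mpoly" where
  "subst \<equiv> peval Cst"

lemmas ring_hom_subst = ring_hom_peval[OF ring_hom_Cst]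
lemmas subst_Var = peval_Var[OF ring_hom_Cst]
lemmas subst_Cst = peval_Cst[OF ring_hom_Cst]
lemmas subst_add = ring_hom_1.hom_add[OF ring_hom_subst]
lemmas subst_mult = ring_hom_1.hom_mult[OF ring_hom_subst]
lemmas subst_diff = ring_hom_1.hom_diff[OF ring_hom_subst]
lemmas subst_uminus = ring_hom_1.hom_uminus[OF ring_hom_subst]
lemmas subst_sum = ring_hom_1.hom_sum[OF ring_hom_subst]
lemmas subst_power = ring_hom_1.hom_power[OF ring_hom_subst]

lemma subst_keys_id:
  assumes "\<And>m v. m \<in> keys q \<Longrightarrow> v \<in># m \<Longrightarrow> \<sigma> v = Var v"
  shows "subst \<sigma> q = q"
proof -
  have "subst \<sigma> q = (\<Sum>m\<in>keys q. single m (lookup q m))"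
    unfolding peval_def
  proof (intro sum.cong refl)
    fix m assume "m \<in> keys q"
    then have "image_mset \<sigma> m = image_mset Var m"
      by (intro image_mset_cong assms)
    then show "Cst (lookup q m) * (\<Prod>v\<in>#m. \<sigma> v) = single m (lookup q m)"
      by (simp add: single_eq)
  qed
  then show ?thesis using mpoly_expand[of q] by simp
qed

section \<open>Monomial bases of quotient rings\<close>

text \<open>The monomials in \<open>B\<close> represent a basis of the quotient by \<open>I\<close>.
  Since the quotient is that of the polynomial ring in all variables of the type, variables not in
  use have to be members of \<open>I\<close>.\<close>

definition basis_mod :: "'v mpoly set \<Rightarrow> 'v multiset set \<Rightarrow> bool" where
  "basis_mod I B \<longleftrightarrow> finite B \<and> (\<forall>p. \<exists>q. keys q \<subseteq> B \<and> p - q \<in> I)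
     \<and> (\<forall>q. keys q \<subseteq> B \<and> q \<in> I \<longrightarrow> q = 0)"

lemma basis_modE:
  assumes "basis_mod I B"
  obtains q where "keys q \<subseteq> B" "p - q \<in> I"
  using assms by (metis basis_mod_def)

lemma basis_mod_indep: "basis_mod I B \<Longrightarrow> keys q \<subseteq> B \<Longrightarrow> q \<in> I \<Longrightarrow> q = 0"
  by (simp add: basis_mod_def)

text \<open>The coefficients stay in the same polynomial type, merely without occurrences of
  \<open>x\<close>, so no separate ring in the remaining variables is needed.\<close>

definition univ :: "'v \<Rightarrow> 'v mpoly \<Rightarrow> 'v mpoly poly" where
  "univ x = peval (\<lambda>c. [:Cst c:]) (\<lambda>v. if v = x then [:0, 1:] else [:Var v:])"

lemma ring_hom_pCons_Cst: "ring_hom_1 (\<lambda>c. [:Cst c:])"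
  by unfold_locales (simp_all add: ring_hom_1.hom_add[OF ring_hom_Cst]
      ring_hom_1.hom_mult[OF ring_hom_Cst] ring_hom_1.hom_one[OF ring_hom_Cst] one_pCons)

lemmas ring_hom_univ = ring_hom_peval[OF ring_hom_pCons_Cst, of "\<lambda>v. if v = x then [:0, 1:] else [:Var v:]" for x,
    folded univ_def]

lemma univ_Var: "univ x (Var v) = (if v = x then [:0, 1:] else [:Var v:])"
  by (simp add: univ_def peval_Var[OF ring_hom_pCons_Cst])

lemma univ_single:
  "univ x (single m c) = monom (single (filter_mset (\<lambda>v. v \<noteq> x) m) c) (count m x)"
proof (induction m)
  case empty
  then show ?case
    by (simp add: univ_def peval_Cst[OF ring_hom_pCons_Cst] single_zero_eq_Cst monom_0)
next
  case (add v m)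
  have "univ x (single (add_mset v m) c) = univ x (Var v) * univ x (single m c)"
    by (simp add: Var_mult_single[symmetric] ring_hom_1.hom_mult[OF ring_hom_univ])
  also have "\<dots> = monom (single (filter_mset (\<lambda>v. v \<noteq> x) (add_mset v m)) c) (count (add_mset v m) x)"
    using add by (simp add: univ_Var monom_Suc smult_monom Var_mult_single[symmetric])
  finally show ?case .
qed

lemma lookup_coeff_univ:
  "lookup (coeff (univ x q) e) m = (if x \<in># m then 0 else lookup q (m + replicate_mset e x))"
proof (induction q rule: mpoly_single_induct)
  case zero
  then show ?case by (simp add: ring_hom_1.hom_zero[OF ring_hom_univ])
next
  case (add q a c)
  have "a = m + replicate_mset e x \<longleftrightarrow> filter_mset (\<lambda>v. v \<noteq> x) a = m \<and> count a x = e"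
    if "x \<notin># m"
  proof
    assume "a = m + replicate_mset e x"
    moreover have "filter_mset (\<lambda>v. v \<noteq> x) m = m"
      using that by (auto simp: filter_mset_eq_conv)
    moreover have "filter_mset (\<lambda>v. v \<noteq> x) (replicate_mset e x) = {#}"
      by simp
    ultimately show "filter_mset (\<lambda>v. v \<noteq> x) a = m \<and> count a x = e"
      using that by (simp add: not_in_iff)
  next
    assume "filter_mset (\<lambda>v. v \<noteq> x) a = m \<and> count a x = e"
    then show "a = m + replicate_mset e x"
      by (intro multiset_eqI) auto
  qed
  moreover have "x \<notin># filter_mset (\<lambda>v. v \<noteq> x) a" by simp
  ultimately show ?case
    using add
    by (auto simp: ring_hom_1.hom_add[OF ring_hom_univ] univ_single lookup_add lookup_single when_def)
qed

lemma univ_free: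
  assumes "\<And>m. m \<in> keys q \<Longrightarrow> x \<notin># m"
  shows "univ x q = [:q:]"
proof (intro poly_eqI poly_mapping_eqI)
  fix e m
  show "lookup (coeff (univ x q) e) m = lookup (coeff [:q:] e) m"
    using assms[of m] assms[of "m + replicate_mset e x"]
    by (cases e) (auto simp: lookup_coeff_univ in_keys_iff)
qed

text \<open>Uniqueness of remainders on division by the monic \<open>f\<close>, where constant
  coefficients are read modulo \<open>I'\<close> and all others modulo \<open>J\<close>. The last
  condition on \<open>f\<close> ensures that multiples of \<open>f\<close> by elements of
  \<open>J\<close> count as zero.\<close>

lemma poly_reduce_monic:
  fixes p f g :: "'a::comm_ring_1 poly"
  assumes I': "ideal I'" and J: "ideal J" and "I' \<subseteq> J"
    and f: "degree f = d" "coeff f d = 1" "\<And>a. a \<in> J \<Longrightarrow> coeff f 0 * a \<in> I'"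
    and p: "\<And>e. e \<ge> d \<Longrightarrow> coeff p e = 0"
    and g: "coeff (p - f * g) 0 \<in> I'" "\<And>e. coeff (p - f * g) e \<in> J"
  shows "coeff p 0 \<in> I' \<and> (\<forall>e. coeff p e \<in> J)"
proof -
  have "coeff p 0 \<in> I' \<and> (\<forall>e. coeff p e \<in> J)"
    if "\<And>i. i \<ge> n \<Longrightarrow> coeff g i = 0" "coeff (p - f * g) 0 \<in> I'" "\<And>e. coeff (p - f * g) e \<in> J" for n g
    using that
  proof (induction n arbitrary: g)
    case 0
    then have "g = 0" by (intro poly_eqI) auto
    then show ?case using 0 by simp
  next
    case (Suc n)
    define c where "c = coeff g n"
    define g' where "g' = g - monom c n"
    have g': "coeff g' i = 0" if "i \<ge> n" for i
      using that Suc.prems(1)[of i] by (cases "i = n") (auto simp: g'_def c_def)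
    have g_eq: "g = monom c n + g'" by (simp add: g'_def)
    have "coeff (f * g') (d + n) = 0"
    proof (cases "n = 0")
      case True
      then have "g' = 0" using g' by (intro poly_eqI) auto
      then show ?thesis by simp
    next
      case False
      have "degree g' \<le> n - 1" using g' False by (intro degree_le) auto
      then show ?thesis using f(1) False degree_mult_le[of f g']
        by (intro coeff_eq_0) linarith
    qed
    \<comment> \<open>The top coefficient \<open>c\<close> of \<open>g\<close> stands alone in
      degree \<open>d + n\<close>, where \<open>p\<close> has no term, and so lies in
      \<open>J\<close>. Dropping it changes \<open>p - f * g\<close> only by terms that count as
      zero.\<close>
    then have "coeff (p - f * g) (d + n) = - c"
      using p[of "d + n"] f(2)
      by (simp add: g_eq distrib_left mult.commute[of f "monom c n"] coeff_monom_mult)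
    then have c: "c \<in> J" using Suc.prems(3)[of "d + n"] ideal_uminus[OF J] by (metis minus_minus)
    have diff: "coeff (p - f * g') e = coeff (p - f * g) e + (if n \<le> e then c * coeff f (e - n) else 0)" for e
      by (simp add: g_eq distrib_left mult.commute[of f "monom c n"] coeff_monom_mult)
    show ?case
    proof (rule Suc.IH[of g'])
      show "coeff g' i = 0" if "i \<ge> n" for i by (rule g'[OF that])
      show "coeff (p - f * g') 0 \<in> I'"
        unfolding diff using Suc.prems(2) f(3)[OF c] I'
        by (auto intro!: ideal_add simp: mult.commute ideal_zero)
      show "coeff (p - f * g') e \<in> J" for e
        unfolding diff using Suc.prems(3)[of e] c J
        by (auto intro!: ideal_add ideal_mult_right simp: ideal_zero)
    qed
  qed
  then show ?thesis using g[of] coeff_eq_0[of g] by (metis Suc_le_eq)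
qed

text \<open>Power 0 of \<open>x\<close> is covered by \<open>B'\<close>. Positive powers take their
  cofactors from \<open>B''\<close> because \<open>x\<close> is annihilated by \<open>J\<close>, and
  they stop before \<open>d\<close> because \<open>x ^ d\<close> is reducible.\<close>

definition extend_basis :: "'v \<Rightarrow> nat \<Rightarrow> 'v multiset set \<Rightarrow> 'v multiset set \<Rightarrow> 'v multiset set" where
  "extend_basis x d B' B'' = B' \<union> (\<lambda>(b, e). b + replicate_mset e x) ` (B'' \<times> {1..<d})"

text \<open>One blow-up step, with \<open>I\<close> the ideal after \<open>x\<close> has been
  adjoined. The assumption \<open>univ_I\<close> bounds \<open>I\<close> from above and the last
  three bound it from below. The substitution \<open>\<sigma>\<close> clears \<open>x\<close>,
  because in the application \<open>I'\<close> contains \<open>x\<close> as a variable not yet in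
  use.\<close>

lemma basis_mod_extend:
  fixes x :: 'v and I I' J :: "'v mpoly set" and z :: "'v mpoly"
  defines "\<sigma> \<equiv> subst (\<lambda>v. if v = x then 0 else Var v)"
  assumes I: "ideal I" and I': "ideal I'" and J: "ideal J"
    and B': "basis_mod I' B'" and B'': "basis_mod J B''"
    and free: "\<And>b. b \<in> B' \<union> B'' \<Longrightarrow> x \<notin># b"
    and d: "d \<ge> 1" and z: "\<sigma> z = z"
    and sub: "I' \<subseteq> J" and zJ: "\<And>a. a \<in> J \<Longrightarrow> z ^ d * a \<in> I'"
    and univ_I: "\<And>p. p \<in> I \<Longrightarrow> \<exists>g. coeff (univ x p - [:z, 1:] ^ d * g) 0 \<in> I'
                    \<and> (\<forall>e. coeff (univ x p - [:z, 1:] ^ d * g) e \<in> J)"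
    and \<sigma>I': "\<And>p. p \<in> I' \<Longrightarrow> \<sigma> p \<in> I"
    and \<sigma>J: "\<And>p. p \<in> J \<Longrightarrow> Var x * \<sigma> p \<in> I"
    and xz: "(Var x + z) ^ d \<in> I"
  shows "basis_mod I (extend_basis x d B' B'')"
proof -
  let ?B = "extend_basis x d B' B''"
  have fin: "finite ?B"
    using B' B'' by (simp add: extend_basis_def basis_mod_def)
  define N where "N = {p. \<exists>q. keys q \<subseteq> ?B \<and> p - q \<in> I}"
  have N_I: "p \<in> N" if "p \<in> I" for p
    unfolding N_def using that by (intro CollectI exI[of _ 0]) auto
  have N_add: "p + q \<in> N" if "p \<in> N" "q \<in> N" for p q
  proof -
    obtain p' q' where "keys p' \<subseteq> ?B" "p - p' \<in> I" "keys q' \<subseteq> ?B" "q - q' \<in> I"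
      using \<open>p \<in> N\<close> \<open>q \<in> N\<close> by (auto simp: N_def)
    moreover have "keys (p' + q') \<subseteq> keys p' \<union> keys q'" by (rule Poly_Mapping.keys_add)
    moreover have "p + q - (p' + q') = (p - p') + (q - q')" by simp
    ultimately have "keys (p' + q') \<subseteq> ?B" "p + q - (p' + q') \<in> I"
      using ideal_add[OF I] by (blast, metis)
    then show ?thesis unfolding N_def by blast
  qed
  have N_uminus: "- p \<in> N" if "p \<in> N" for p
  proof -
    obtain p' where "keys p' \<subseteq> ?B" "p - p' \<in> I" using \<open>p \<in> N\<close> by (auto simp: N_def)
    then have "keys (- p') \<subseteq> ?B" "- p - (- p') \<in> I"
      using ideal_cong_sym[OF I, of p p'] by (auto simp: in_keys_iff)
    then show ?thesis unfolding N_def by blast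
  qed
  have N_sum: "(\<Sum>i\<in>S. f i) \<in> N" if "\<And>i. i \<in> S \<Longrightarrow> f i \<in> N" for S :: "nat set" and f
    using that
    by (induction S rule: infinite_finite_induct) (auto simp: N_add intro: N_I ideal_zero[OF I])
  have \<sigma>_free: "\<sigma> q = q" if "\<And>m. m \<in> keys q \<Longrightarrow> x \<notin># m" for q
    unfolding \<sigma>_def using that by (intro subst_keys_id) auto
  \<comment> \<open>Strong induction on the exponent of \<open>x\<close>: exponent 0 is reduced
    modulo \<open>I'\<close>, exponents below \<open>d\<close> modulo \<open>J\<close>, and for the
    others the relation \<open>(x + z) ^ d\<close> is solved for \<open>x ^ d\<close>, which leaves
    lower powers of \<open>x\<close>.\<close>
  have power: "Var x ^ e * a \<in> N" if "\<sigma> a = a" for e a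
    using that
  proof (induction e arbitrary: a rule: less_induct)
    case (less e)
    consider "e = 0" | "1 \<le> e" "e < d" | "d \<le> e" by linarith
    then show ?case
    proof cases
      case 1
      obtain q where q: "keys q \<subseteq> B'" "a - q \<in> I'"
        using basis_modE[OF B'] by blast
      have "\<sigma> q = q" using q free by (intro \<sigma>_free) auto
      then have "a - q = \<sigma> (a - q)" using less.prems by (simp add: \<sigma>_def subst_diff)
      then have "a - q \<in> I" using \<sigma>I'[OF q(2)] by simp
      moreover have "keys q \<subseteq> ?B" using q by (auto simp: extend_basis_def)
      ultimately show ?thesis using 1 by (auto simp: N_def)
    next
      case 2
      obtain q where q: "keys q \<subseteq> B''" "a - q \<in> J"
        using basis_modE[OF B''] by blast
      have "\<sigma> q = q" using q free by (intro \<sigma>_free) auto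
      then have "a - q = \<sigma> (a - q)" using less.prems by (simp add: \<sigma>_def subst_diff)
      then have "Var x * (a - q) \<in> I" using \<sigma>J[OF q(2)] by simp
      then have "Var x ^ (e - 1) * (Var x * (a - q)) \<in> I" by (rule ideal_mult[OF I])
      moreover have "Var x ^ (e - 1) * (Var x * (a - q)) = Var x ^ e * a - Var x ^ e * q"
        using 2(1) by (cases e) (simp_all add: algebra_simps)
      ultimately have "Var x ^ e * a - Var x ^ e * q \<in> I" by simp
      moreover have "keys (Var x ^ e * q) \<subseteq> ?B"
      proof
        fix k assume "k \<in> keys (Var x ^ e * q)"
        then have "lookup (single (replicate_mset e x) 1 * q) k \<noteq> 0"
          using Var_power_mult_single[of x e 0 1] by (simp add: in_keys_iff)
        then have "replicate_mset e x \<subseteq># k" "k - replicate_mset e x \<in> keys q"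
          by (auto simp: lookup_single_mult in_keys_iff split: if_splits)
        then have "k = (k - replicate_mset e x) + replicate_mset e x" "k - replicate_mset e x \<in> B''"
          using q by auto
        then have "k \<in> (\<lambda>(b, e). b + replicate_mset e x) ` (B'' \<times> {1..<d})"
          using 2 by (intro image_eqI[of _ _ "(k - replicate_mset e x, e)"]) auto
        then show "k \<in> ?B" by (simp add: extend_basis_def)
      qed
      ultimately show ?thesis unfolding N_def by blast
    next
      case 3
      define r where "r = (\<Sum>l<d. of_nat (d choose l) * Var x ^ l * z ^ (d - l))"
      have "(Var x + z) ^ d = Var x ^ d + r"
        unfolding binomial_ring r_def lessThan_Suc_atMost[symmetric] sum.lessThan_Suc
        by (simp only: binomial_n_n of_nat_1 diff_self_eq_0 power_0 mult_1 mult_1_right add.commute)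
      then have "Var x ^ d = (Var x + z) ^ d - r" by simp
      moreover have "Var x ^ e * a = Var x ^ (e - d) * a * Var x ^ d"
        using 3 by (simp add: mult_ac power_add[symmetric])
      ultimately have eq: "Var x ^ e * a
          = (Var x ^ (e - d) * a) * (Var x + z) ^ d + - (Var x ^ (e - d) * a * r)"
        by (simp only: distrib_left mult_minus_right diff_conv_add_uminus)
      have "Var x ^ (e - d) * a * r
         = (\<Sum>l<d. Var x ^ (e - d + l) * (of_nat (d choose l) * z ^ (d - l) * a))"
        unfolding r_def sum_distrib_left by (intro sum.cong refl) (simp add: power_add mult_ac)
      also have "\<dots> \<in> N"
      proof (intro N_sum less.IH)
        fix l assume "l \<in> {..<d}"
        then show "e - d + l < e" using 3 by auto
        have "\<sigma> (of_nat n) = of_nat n" for n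
          unfolding \<sigma>_def by (induction n)
            (simp_all add: subst_add ring_hom_1.hom_one[OF ring_hom_subst] ring_hom_1.hom_zero[OF ring_hom_subst])
        then show "\<sigma> (of_nat (d choose l) * z ^ (d - l) * a) = of_nat (d choose l) * z ^ (d - l) * a"
          using z less.prems by (simp add: \<sigma>_def subst_mult subst_power)
      qed
      finally show ?thesis unfolding eq
        by (intro N_add[OF N_I[OF ideal_mult[OF I xz]] N_uminus])
    qed
  qed
  have spanning: "p \<in> N" for p
  proof (induction p rule: mpoly_single_induct)
    case zero
    then show ?case using ideal_zero[OF I] N_I by blast
  next
    case (add p m c)
    let ?m = "filter_mset (\<lambda>v. v \<noteq> x) m"
    have "m = ?m + replicate_mset (count m x) x" by (intro multiset_eqI) auto
    then have "single m c = Var x ^ count m x * single ?m c"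
      by (simp only: Var_power_mult_single)
    moreover have "\<sigma> (single ?m c) = single ?m c" by (rule \<sigma>_free) (auto split: if_splits)
    ultimately have "single m c \<in> N" using power by metis
    then show ?case using add N_add by blast
  qed
  \<comment> \<open>As a polynomial in \<open>x\<close>, \<open>q\<close> has degree below
    \<open>d\<close>. By \<open>poly_reduce_monic\<close> its constant coefficient is in
    \<open>I'\<close> and the others are in \<open>J\<close>, where independence of
    \<open>B'\<close> and \<open>B''\<close> makes them vanish.\<close>
  have "q = 0" if q: "keys q \<subseteq> ?B" "q \<in> I" for q
  proof -
    let ?f = "[:z, 1:] ^ d :: 'v mpoly poly"
    have deg: "degree ?f = d" and lead: "coeff ?f d = 1"
      using degree_linear_power[of z d] coeff_linear_power[of z d] by auto
    have f0: "coeff ?f 0 = z ^ d"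
      by (simp add: poly_0_coeff_0[symmetric])
    have coeff_big: "coeff (univ x q) e = 0" if "e \<ge> d" for e
    proof (rule poly_mapping_eqI)
      fix m
      have "m + replicate_mset e x \<notin> ?B" if "x \<notin># m"
      proof
        assume "m + replicate_mset e x \<in> ?B"
        then consider "m + replicate_mset e x \<in> B'"
          | b e' where "m + replicate_mset e x = b + replicate_mset e' x" "b \<in> B''" "e' < d"
          by (auto simp: extend_basis_def)
        then show False
        proof cases
          case 1
          then show False using free[of "m + replicate_mset e x"] d \<open>e \<ge> d\<close> by auto
        next
          case 2
          then have "x \<notin># b" using free by blast
          then have "e = e'"
            using arg_cong[OF 2(1), of "\<lambda>M. count M x"] that by (simp add: not_in_iff)
          then show False using 2 \<open>e \<ge> d\<close> by simp
        qed
      qed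
      then have "m + replicate_mset e x \<notin> keys q" if "x \<notin># m" using q that by blast
      then show "lookup (coeff (univ x q) e) m = lookup 0 m"
        by (auto simp: lookup_coeff_univ in_keys_iff)
    qed
    obtain g where g: "coeff (univ x q - ?f * g) 0 \<in> I'" "\<And>e. coeff (univ x q - ?f * g) e \<in> J"
      using univ_I[OF q(2)] by blast
    have "coeff (univ x q) 0 \<in> I' \<and> (\<forall>e. coeff (univ x q) e \<in> J)"
      by (rule poly_reduce_monic[OF I' J sub deg lead _ coeff_big g]) (simp_all add: f0 zJ)
    then have q0: "coeff (univ x q) 0 \<in> I'" and qe: "coeff (univ x q) e \<in> J" for e by auto
    have coeff0: "coeff (univ x q) e = 0" for e
    proof (cases "e = 0")
      case True
      have "keys (coeff (univ x q) 0) \<subseteq> B'"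
      proof
        fix m assume "m \<in> keys (coeff (univ x q) 0)"
        then have "x \<notin># m" "m \<in> ?B" using q(1)
          by (auto simp: in_keys_iff lookup_coeff_univ split: if_splits)
        then show "m \<in> B'" by (auto simp: extend_basis_def)
      qed
      then show ?thesis using basis_mod_indep[OF B'] q0 True by auto
    next
      case False
      have "keys (coeff (univ x q) e) \<subseteq> B''"
      proof
        fix m assume "m \<in> keys (coeff (univ x q) e)"
        then have m: "x \<notin># m" "m + replicate_mset e x \<in> ?B" using q(1)
          by (auto simp: in_keys_iff lookup_coeff_univ split: if_splits)
        have "m + replicate_mset e x \<notin> B'"
          using free[of "m + replicate_mset e x"] False by auto
        then obtain b e' where b: "m + replicate_mset e x = b + replicate_mset e' x" "b \<in> B''"
          using m(2) by (auto simp: extend_basis_def)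
        then have "x \<notin># b" using free by blast
        then have "e = e'"
          using arg_cong[OF b(1), of "\<lambda>M. count M x"] m(1) by (simp add: not_in_iff)
        then show "m \<in> B''" using b by simp
      qed
      then show ?thesis using basis_mod_indep[OF B''] qe by auto
    qed
    show "q = 0"
    proof (rule poly_mapping_eqI)
      fix m
      let ?m = "filter_mset (\<lambda>v. v \<noteq> x) m"
      have "?m + replicate_mset (count m x) x = m" by (intro multiset_eqI) auto
      then show "lookup q m = lookup 0 m"
        using lookup_coeff_univ[of x q "count m x" ?m] coeff0 by simp
    qed
  qed
  moreover have "\<exists>q. keys q \<subseteq> ?B \<and> p - q \<in> I" for p
    using spanning[of p] by (simp add: N_def)
  ultimately show ?thesis
    using fin unfolding basis_mod_def by blast
qed

section \<open>Chow rings of ranked lattices\<close>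

definition free_of :: "'v \<Rightarrow> 'v mpoly \<Rightarrow> bool" where
  "free_of x p \<longleftrightarrow> (\<forall>m\<in>keys p. x \<notin># m)"

lemma free_of_zero: "free_of x 0"
  and free_of_one: "free_of x 1"
  and free_of_Var: "x \<noteq> v \<Longrightarrow> free_of x (Var v)"
  by (auto simp: free_of_def Var_def)

lemma free_of_add: "free_of x p \<Longrightarrow> free_of x q \<Longrightarrow> free_of x (p + q)"
  using Poly_Mapping.keys_add[of p q] by (auto simp: free_of_def)

lemma free_of_mult: "free_of x p \<Longrightarrow> free_of x q \<Longrightarrow> free_of x (p * q)"
  using keys_mult[of p q] by (fastforce simp: free_of_def)

lemma free_of_power: "free_of x p \<Longrightarrow> free_of x (p ^ n)"
  by (induction n) (auto intro: free_of_mult free_of_one)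

lemma free_of_sum: "(\<And>i. i \<in> S \<Longrightarrow> free_of x (f i)) \<Longrightarrow> free_of x (\<Sum>i\<in>S. f i)"
  by (induction S rule: infinite_finite_induct) (auto intro: free_of_add free_of_zero)

lemma univ_free_of: "free_of x p \<Longrightarrow> univ x p = [:p:]"
  by (rule univ_free) (simp add: free_of_def)

lemma subst_free_of: "free_of x p \<Longrightarrow> subst (\<lambda>v. if v = x then 0 else Var v) p = p"
  by (rule subst_keys_id) (auto simp: free_of_def)

lemma ideal_colon: "ideal I \<Longrightarrow> ideal {a. x * a \<in> I}"
  by (intro idealI) (auto simp: ideal_zero ideal_add ideal_mult distrib_left mult.left_commute[of x])

text \<open>The ideal generated by \<open>f\<close> together with \<open>I'\<close> and
  \<open>x J\<close>, expressed by conditions on coefficients. Being an ideal, it can be compared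
  with the image of \<open>univ\<close> on generators.\<close>

lemma ideal_poly_monic_ext:
  assumes "ideal I'" "ideal J"
  shows "ideal {p :: 'a::comm_ring_1 poly. \<exists>g. coeff (p - f * g) 0 \<in> I' \<and> (\<forall>e. coeff (p - f * g) e \<in> J)}"
    (is "ideal ?K")
proof (intro idealI)
  show "0 \<in> ?K"
    using assms by (auto intro!: exI[of _ 0] simp: ideal_zero)
next
  fix p q assume "p \<in> ?K" "q \<in> ?K"
  then obtain g g' where g: "coeff (p - f * g) 0 \<in> I'" "\<And>e. coeff (p - f * g) e \<in> J"
    and g': "coeff (q - f * g') 0 \<in> I'" "\<And>e. coeff (q - f * g') e \<in> J"
    by blast
  have "p + q - f * (g + g') = (p - f * g) + (q - f * g')"
    by (simp add: algebra_simps)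
  then have "coeff (p + q - f * (g + g')) 0 \<in> I'" "coeff (p + q - f * (g + g')) e \<in> J" for e
    using g g' assms by (simp_all only: coeff_add ideal_add)
  then show "p + q \<in> ?K" by blast
next
  fix r p assume "p \<in> ?K"
  then obtain g where g: "coeff (p - f * g) 0 \<in> I'" "\<And>e. coeff (p - f * g) e \<in> J"
    by blast
  have eq: "r * p - f * (r * g) = r * (p - f * g)"
    by (simp add: algebra_simps)
  have "coeff (r * (p - f * g)) 0 \<in> I'"
    unfolding coeff_mult using g assms by (intro ideal_sum ideal_mult) auto
  moreover have "coeff (r * (p - f * g)) e \<in> J" for e
    unfolding coeff_mult using g assms by (intro ideal_sum ideal_mult) auto
  ultimately show "r * p \<in> ?K"
    unfolding eq[symmetric] by blast
qed

text \<open>Meant for \<open>y\<close> and \<open>y'\<close> that agree only after multiplication by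
  \<open>x\<close>: the factor \<open>x\<close> survives while the powers are exchanged one at a
  time.\<close>

lemma ideal_mult_power_cong:
  assumes "ideal I" "x * y - x * y' \<in> I"
  shows "x * y ^ n - x * y' ^ n \<in> I"
proof (induction n)
  case 0
  then show ?case using assms by (simp add: ideal_zero)
next
  case (Suc n)
  have "x * y ^ Suc n - x * y' ^ Suc n = y * (x * y ^ n - x * y' ^ n) + y' ^ n * (x * y - x * y')"
    by (simp add: algebra_simps)
  then show ?case using assms Suc by (simp only: ideal_add ideal_mult)
qed

definition mon_gf :: "'v multiset set \<Rightarrow> int fps" where
  "mon_gf B = (\<Sum>m\<in>B. fps_X ^ size m)"

text \<open>The bracket \<open>[m]\<close> of the overview. It vanishes at \<open>m = 0\<close>, so
  flats of rank one contribute nothing to the reduced series.\<close>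

definition xsum :: "nat \<Rightarrow> int fps" where
  "xsum m = (\<Sum>e\<in>{1..m}. fps_X ^ e)"

lemma mon_gf_extend_basis:
  assumes "finite B'" "finite B''" "\<And>b. b \<in> B' \<union> B'' \<Longrightarrow> x \<notin># b"
  shows "mon_gf (extend_basis x d B' B'') = mon_gf B' + xsum (d - 1) * mon_gf B''"
proof -
  let ?g = "\<lambda>(b, e). b + replicate_mset e x"
  let ?S = "B'' \<times> {1..<d}"
  have count: "count (?g (b, e)) x = e" if "b \<in> B''" for b e
    using assms(3)[of b] that by (simp add: not_in_iff)
  have inj: "inj_on ?g ?S"
  proof (rule inj_onI)
    fix s t assume st: "s \<in> ?S" "t \<in> ?S" "?g s = ?g t"
    obtain b e b' e' where [simp]: "s = (b, e)" "t = (b', e')" by (metis surj_pair)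
    have "count (?g s) x = e" "count (?g t) x = e'" using count[of b e] count[of b' e'] st(1,2) by auto
    then have "e = e'" using st(3) by metis
    then show "s = t" using st by simp
  qed
  have "B' \<inter> ?g ` ?S = {}"
    using assms(3) by fastforce
  then have "mon_gf (extend_basis x d B' B'') = mon_gf B' + mon_gf (?g ` ?S)"
    unfolding extend_basis_def mon_gf_def using assms by (intro sum.union_disjoint) auto
  also have "mon_gf (?g ` ?S) = (\<Sum>(b, e)\<in>?S. fps_X ^ size b * fps_X ^ e)"
    unfolding mon_gf_def sum.reindex[OF inj]
    by (intro sum.cong) (auto simp: power_add)
  also have "\<dots> = (\<Sum>b\<in>B''. \<Sum>e\<in>{1..<d}. fps_X ^ size b * fps_X ^ e)"
    by (simp add: sum.cartesian_product)
  also have "\<dots> = xsum (d - 1) * mon_gf B''"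
  proof -
    have "{1..<d} = {1..d - 1}" by auto
    then show ?thesis
      by (simp add: mon_gf_def xsum_def sum_product mult.commute
          sum_distrib_left sum.swap[of _ "{Suc 0..d - Suc 0}"])
  qed
  finally show ?thesis .
qed

text \<open>Submodularity is stated against every common lower bound rather than against a meet. It
  is applied with the bottom of an interval as lower bound, and no meet operation is
  required.\<close>

locale ranked_lattice =
  fixes L :: "'p::order set" and r :: "'p \<Rightarrow> nat"
  assumes finite_L: "finite L"
    and rank_strict: "F \<in> L \<Longrightarrow> G \<in> L \<Longrightarrow> F < G \<Longrightarrow> r F < r G"
    and join_ex: "F \<in> L \<Longrightarrow> G \<in> L \<Longrightarrow> \<exists>J\<in>L. F \<le> J \<and> G \<le> J \<and> (\<forall>K\<in>L. F \<le> K \<longrightarrow> G \<le> K \<longrightarrow> J \<le> K)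
        \<and> (\<forall>A\<in>L. A \<le> F \<longrightarrow> A \<le> G \<longrightarrow> r J + r A \<le> r F + r G)"
begin

definition above :: "'p \<Rightarrow> 'p set" where
  "above F = {K \<in> L. F < K}"

definition y :: "'p \<Rightarrow> 'p mpoly" where
  "y F = (\<Sum>K\<in>{K\<in>L. F \<le> K}. Var K)"

text \<open>For \<open>\<epsilon> = 0\<close> and \<open>P = above A\<close> these are the Groebner
  basis relations of Feichtner and Yuzvinsky for the lattice above \<open>A\<close>, together with
  the variables outside \<open>P\<close>, so that all these ideals live in one ring. The shift
  \<open>\<epsilon> = 1\<close> belongs to the augmented ring.\<close>

definition chow_gens :: "'p \<Rightarrow> nat \<Rightarrow> 'p set \<Rightarrow> 'p mpoly set" where
  "chow_gens A \<epsilon> P = Var ` (- P)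
     \<union> {Var F * Var G | F G. F \<in> P \<and> G \<in> P \<and> \<not> F \<le> G \<and> \<not> G \<le> F}
     \<union> {Var F * y G ^ (r G - r F) | F G. F \<in> P \<and> G \<in> P \<and> F < G}
     \<union> {y F ^ (r F - r A + \<epsilon>) | F. F \<in> P}"

definition chow_ideal :: "'p \<Rightarrow> nat \<Rightarrow> 'p set \<Rightarrow> 'p mpoly set" where
  "chow_ideal A \<epsilon> P = ideal_gen (chow_gens A \<epsilon> P)"

definition upset :: "'p \<Rightarrow> 'p set \<Rightarrow> bool" where
  "upset A P \<longleftrightarrow> A \<in> L \<and> P \<subseteq> above A \<and> (\<forall>F\<in>P. above F \<subseteq> P)"

lemma ideal_chow_ideal: "ideal (chow_ideal A \<epsilon> P)"
  by (simp add: chow_ideal_def ideal_ideal_gen)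

lemma chow_ideal_Var: "F \<notin> P \<Longrightarrow> Var F \<in> chow_ideal A \<epsilon> P"
  by (auto simp: chow_ideal_def chow_gens_def intro: ideal_gen.base)

lemma chow_ideal_incomparable:
  assumes "\<not> F \<le> G" "\<not> G \<le> F"
  shows "Var F * Var G \<in> chow_ideal A \<epsilon> P"
proof (cases "F \<in> P \<and> G \<in> P")
  case True
  then show ?thesis using assms
    unfolding chow_ideal_def chow_gens_def by (intro ideal_gen.base) blast
next
  case False
  then show ?thesis
    by (metis chow_ideal_Var ideal_chow_ideal ideal_mult mult.commute)
qed

lemma chow_ideal_Var_y:
  "F \<in> P \<Longrightarrow> G \<in> P \<Longrightarrow> F < G \<Longrightarrow> Var F * y G ^ (r G - r F) \<in> chow_ideal A \<epsilon> P"
  unfolding chow_ideal_def chow_gens_def by (intro ideal_gen.base) blast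

lemma chow_ideal_y: "F \<in> P \<Longrightarrow> y F ^ (r F - r A + \<epsilon>) \<in> chow_ideal A \<epsilon> P"
  unfolding chow_ideal_def chow_gens_def by (intro ideal_gen.base) blast

lemma upset_L: "upset A P \<Longrightarrow> P \<subseteq> L"
  by (auto simp: upset_def above_def)

lemma upset_above: "F \<in> L \<Longrightarrow> upset F (above F)"
  by (auto simp: upset_def above_def)

lemma finite_upset: "upset A P \<Longrightarrow> finite P"
  using upset_L finite_L finite_subset by blast

text \<open>Next to \<open>Var K\<close> only variables comparable with \<open>K\<close> survive. As
  \<open>M \<le> K\<close> would give \<open>F \<le> K\<close>, such an \<open>M\<close> is above
  \<open>K\<close> and \<open>F\<close>, hence above their join \<open>J\<close>.\<close>

lemma sum_Var_join:
  assumes I: "ideal I" and inc: "\<And>M. M \<in> S \<Longrightarrow> \<not> K \<le> M \<Longrightarrow> \<not> M \<le> K \<Longrightarrow> Var K * Var M \<in> I"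
    and S: "finite S" "{M \<in> L. J \<le> M} \<subseteq> S" "\<And>M. M \<in> S \<Longrightarrow> M \<in> L \<and> F \<le> M"
    and J: "\<And>M. M \<in> L \<Longrightarrow> F \<le> M \<Longrightarrow> K \<le> M \<Longrightarrow> J \<le> M" and "\<not> F \<le> K"
  shows "Var K * (\<Sum>M\<in>S. Var M) - Var K * y J \<in> I"
proof -
  have "(\<Sum>M\<in>S. Var M) = (\<Sum>M\<in>S - {M\<in>L. J \<le> M}. Var M) + y J"
    unfolding y_def by (rule sum.subset_diff) (use S in auto)
  then have "Var K * (\<Sum>M\<in>S. Var M) - Var K * y J = (\<Sum>M\<in>S - {M\<in>L. J \<le> M}. Var K * Var M)"
    by (simp add: distrib_left sum_distrib_left)
  also have "\<dots> \<in> I"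
  proof (intro ideal_sum I inc)
    fix M assume M: "M \<in> S - {M \<in> L. J \<le> M}"
    then show "M \<in> S" by simp
    show "\<not> M \<le> K" using M S(3) \<open>\<not> F \<le> K\<close> by (meson DiffD1 order_trans)
    show "\<not> K \<le> M" using M S(3) J by blast
  qed
  finally show ?thesis .
qed

text \<open>The sum may be replaced by \<open>y J\<close> for the join \<open>J\<close> of
  \<open>F\<close> and \<open>K\<close>, and submodularity against \<open>A'\<close> gives
  \<open>r J - r K \<le> r F - r A'\<close>. The element \<open>F\<close> may lie outside
  \<open>P\<close>, as it does when it is the one about to be adjoined.\<close>

lemma chow_ideal_Var_sum_power:
  assumes P: "upset A P" and K: "K \<in> P" and F: "F \<in> L" "\<not> F \<le> K" "\<not> K \<le> F"
    and S: "S = above F \<or> S = {M \<in> L. F \<le> M}"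
    and A': "A' \<in> L" "A' \<le> F" "A' \<le> K" "r F - r A' \<le> n"
  shows "Var K * (\<Sum>M\<in>S. Var M) ^ n \<in> chow_ideal A \<epsilon> P"
proof -
  have KL: "K \<in> L" using K upset_L[OF P] by blast
  obtain J where J: "J \<in> L" "F \<le> J" "K \<le> J" "\<And>M. M \<in> L \<Longrightarrow> F \<le> M \<Longrightarrow> K \<le> M \<Longrightarrow> J \<le> M"
    "\<And>A. A \<in> L \<Longrightarrow> A \<le> F \<Longrightarrow> A \<le> K \<Longrightarrow> r J + r A \<le> r F + r K"
    using join_ex[OF F(1) KL] by blast
  have "F < J" "K < J" using J F by auto
  have "J \<in> P" using P K \<open>K < J\<close> J(1) by (auto simp: upset_def above_def)
  have "Var K * (\<Sum>M\<in>S. Var M) - Var K * y J \<in> chow_ideal A \<epsilon> P"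
  proof (rule sum_Var_join[OF ideal_chow_ideal])
    show "{M \<in> L. J \<le> M} \<subseteq> S" using S \<open>F < J\<close> by (auto simp: above_def)
    show "finite S" using S finite_L by (auto simp: above_def)
  qed (use S J F in \<open>auto simp: above_def chow_ideal_incomparable\<close>)
  then have "Var K * (\<Sum>M\<in>S. Var M) ^ n - Var K * y J ^ n \<in> chow_ideal A \<epsilon> P"
    by (rule ideal_mult_power_cong[OF ideal_chow_ideal])
  moreover have "Var K * y J ^ n \<in> chow_ideal A \<epsilon> P"
  proof -
    have "r J - r K \<le> n" using J(5)[OF A'(1-3)] A'(4) by linarith
    moreover have "y J ^ (r J - r K) * Var K \<in> chow_ideal A \<epsilon> P"
      using chow_ideal_Var_y[OF K \<open>J \<in> P\<close> \<open>K < J\<close>] by (simp add: mult.commute)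
    ultimately show ?thesis
      using ideal_power_ge[OF ideal_chow_ideal] by (metis mult.commute)
  qed
  ultimately show ?thesis using ideal_cong[OF ideal_chow_ideal] by blast
qed

lemma basis_mod_empty: "basis_mod (chow_ideal A \<epsilon> {}) {{#}}"
proof -
  have "\<exists>c. p - Cst c \<in> chow_ideal A \<epsilon> {}" for p
  proof (induction p rule: mpoly_induct)
    case (const c)
    then show ?case using ideal_zero[OF ideal_chow_ideal] by (metis diff_self)
  next
    case (var v)
    then show ?case using chow_ideal_Var[of v "{}"]
      by (intro exI[of _ 0]) (simp add: Cst_def)
  next
    case (add p q)
    then obtain c d where "p - Cst c \<in> chow_ideal A \<epsilon> {}" "q - Cst d \<in> chow_ideal A \<epsilon> {}" by blast
    moreover have "p + q - Cst (c + d) = (p - Cst c) + (q - Cst d)"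
      by (simp add: ring_hom_1.hom_add[OF ring_hom_Cst])
    ultimately show ?case using ideal_add[OF ideal_chow_ideal] by metis
  next
    case (mult p q)
    then obtain c d where "p - Cst c \<in> chow_ideal A \<epsilon> {}" "q - Cst d \<in> chow_ideal A \<epsilon> {}" by blast
    then have "p * q - Cst c * Cst d \<in> chow_ideal A \<epsilon> {}"
      by (rule ideal_cong_mult[OF ideal_chow_ideal])
    then show ?case by (metis ring_hom_1.hom_mult[OF ring_hom_Cst])
  qed
  moreover have "keys (Cst c) \<subseteq> {{#}}" for c by (simp add: Cst_def)
  moreover have "q = 0" if q: "keys q \<subseteq> {{#}}" "q \<in> chow_ideal A \<epsilon> {}" for q
  proof -
    \<comment> \<open>Setting all variables to 0 kills the ideal and keeps constants, so no nonzero
      constant lies in it.\<close>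
    have hom: "ring_hom_1 (\<lambda>c::rat. c)" by unfold_locales auto
    let ?h = "peval (\<lambda>c::rat. c) (\<lambda>_::'p. 0)"
    have "?h q \<in> {0}"
      by (rule ideal_gen_hom[OF ring_hom_peval[OF hom] _ _ q(2)[unfolded chow_ideal_def]])
        (auto simp: ideal_def chow_gens_def peval_Var[OF hom])
    moreover have "q = Cst (lookup q {#})"
      by (rule poly_mapping_eqI) (use q(1) in \<open>auto simp: Cst_def lookup_single when_def in_keys_iff\<close>)
    ultimately show "q = 0"
      by (metis Cst_def peval_Cst[OF hom] single_zero singletonD)
  qed
  ultimately show ?thesis unfolding basis_mod_def by (metis finite.emptyI finite.insertI)
qed

section \<open>Adjoining a minimal element of an upset\<close>

context
  fixes A F :: 'p and P :: "'p set" and \<epsilon> :: nat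
  assumes P: "upset A P" and F: "F \<in> P" and F_min: "\<And>G. G \<in> P \<Longrightarrow> \<not> G < F"
begin

lemma upset_remove: "upset A (P - {F})"
proof -
  have "above G \<subseteq> P - {F}" if "G \<in> P" for G
    using P F F_min[OF that] that by (auto simp: upset_def above_def)
  then show ?thesis using P by (auto simp: upset_def)
qed

private lemma FL: "F \<in> L" and AL: "A \<in> L" and AF: "A < F" and above_F: "above F \<subseteq> P - {F}"
  using P F by (auto simp: upset_def above_def)

private lemma PL: "G \<in> P \<Longrightarrow> G \<in> L" and PA: "G \<in> P \<Longrightarrow> A < G"
  using P by (auto simp: upset_def above_def)

private lemma free_of_y: "G \<in> P - {F} \<Longrightarrow> free_of F (y G)"
  unfolding y_def using F_min[of G] by (intro free_of_sum free_of_Var) (auto dest: order.not_eq_order_implies_strict)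

text \<open>Modulo the right-hand ideal all variables not above \<open>F\<close> vanish, so
  \<open>y G\<close> becomes \<open>y M\<close> for the join \<open>M\<close> of \<open>F\<close>
  and \<open>G\<close>; submodularity against \<open>A\<close> shows that the exponent available for
  \<open>G\<close> is large enough for \<open>M\<close>.\<close>

lemma chow_ideal_sub: "chow_ideal A \<epsilon> (P - {F}) \<subseteq> chow_ideal F 0 (above F)"
  unfolding chow_ideal_def[of A]
proof (intro ideal_gen_least ideal_chow_ideal subsetI)
  let ?J = "chow_ideal F 0 (above F)"
  fix s assume "s \<in> chow_gens A \<epsilon> (P - {F})"
  then consider G where "G \<notin> P - {F}" "s = Var G"
    | G K where "\<not> G \<le> K" "\<not> K \<le> G" "s = Var G * Var K"
    | G K where "G \<in> P - {F}" "K \<in> P - {F}" "G < K" "s = Var G * y K ^ (r K - r G)"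
    | G where "G \<in> P - {F}" "s = y G ^ (r G - r A + \<epsilon>)"
    unfolding chow_gens_def by blast
  then show "s \<in> ?J"
  proof cases
    case 1
    then have "G \<notin> above F" using above_F by blast
    then show ?thesis using 1(2) by (simp add: chow_ideal_Var)
  next
    case 2
    then show ?thesis by (simp add: chow_ideal_incomparable)
  next
    case 3
    show ?thesis
    proof (cases "F < G")
      case True
      then have "G \<in> above F" "K \<in> above F" using 3 PL by (auto simp: above_def)
      then show ?thesis using 3 by (simp add: chow_ideal_Var_y)
    next
      case False
      then have "Var G \<in> ?J" by (intro chow_ideal_Var) (auto simp: above_def)
      then show ?thesis using 3 by (simp add: ideal_mult_right[OF ideal_chow_ideal])
    qed
  next
    case 4
    then have G: "G \<in> L" "A < G" "\<not> G \<le> F" using PL PA F_min by (auto simp: order.order_iff_strict)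
    obtain M where M: "M \<in> L" "F \<le> M" "G \<le> M" "\<And>K. K \<in> L \<Longrightarrow> F \<le> K \<Longrightarrow> G \<le> K \<Longrightarrow> M \<le> K"
      "r M + r A \<le> r F + r G"
      using join_ex[OF FL G(1)] AL AF G(2) by (metis less_imp_le)
    have "F < M" using M G(3) by (auto simp: order.order_iff_strict)
    then have Mab: "M \<in> above F" using M by (simp add: above_def)
    have "y G = (\<Sum>K\<in>{K\<in>L. G \<le> K} - {K\<in>L. M \<le> K}. Var K) + y M"
      unfolding y_def by (rule sum.subset_diff) (use M finite_L in auto)
    moreover have "(\<Sum>K\<in>{K\<in>L. G \<le> K} - {K\<in>L. M \<le> K}. Var K) \<in> ?J"
      using M(4) by (intro ideal_sum ideal_chow_ideal chow_ideal_Var) (auto simp: above_def)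
    ultimately have "1 * y G - 1 * y M \<in> ?J" by simp
    then have "1 * y G ^ (r G - r A + \<epsilon>) - 1 * y M ^ (r G - r A + \<epsilon>) \<in> ?J"
      by (rule ideal_mult_power_cong[OF ideal_chow_ideal])
    moreover have "y M ^ (r G - r A + \<epsilon>) * 1 \<in> ?J"
    proof (rule ideal_power_ge[OF ideal_chow_ideal])
      show "y M ^ (r M - r F + 0) * 1 \<in> ?J" using chow_ideal_y[OF Mab, of F 0] by simp
      show "r M - r F + 0 \<le> r G - r A + \<epsilon>" using M(5) by linarith
    qed
    ultimately show ?thesis
      using ideal_cong[OF ideal_chow_ideal] 4(2) by (metis mult_1 mult_1_right)
  qed
qed

text \<open>The relation z^d J = 0 of the overview, checked on the generators of J.\<close>

lemma power_mult_chow_ideal: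
  assumes "a \<in> chow_ideal F 0 (above F)"
  shows "(\<Sum>K\<in>above F. Var K) ^ (r F - r A + \<epsilon>) * a \<in> chow_ideal A \<epsilon> (P - {F})"
proof -
  let ?I = "chow_ideal A \<epsilon> (P - {F})"
  let ?z = "\<Sum>K\<in>above F. Var K :: 'p mpoly"
  let ?d = "r F - r A + \<epsilon>"
  have "chow_ideal F 0 (above F) \<subseteq> {a. ?z ^ ?d * a \<in> ?I}"
    unfolding chow_ideal_def[of F]
  proof (intro ideal_gen_least ideal_colon ideal_chow_ideal subsetI CollectI)
    fix s assume "s \<in> chow_gens F 0 (above F)"
    then consider G where "G \<notin> above F" "s = Var G"
      | G K where "\<not> G \<le> K" "\<not> K \<le> G" "s = Var G * Var K"
      | G K where "G \<in> above F" "K \<in> above F" "G < K" "s = Var G * y K ^ (r K - r G)"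
      | G where "G \<in> above F" "s = y G ^ (r G - r F + 0)"
      unfolding chow_gens_def by blast
    then show "?z ^ ?d * s \<in> ?I"
    proof cases
      case 1
      show ?thesis
      proof (cases "G \<in> P - {F}")
        case True
        \<comment> \<open>Minimality of \<open>F\<close> in \<open>P\<close> excludes
          \<open>G < F\<close>, so \<open>G\<close> is incomparable with \<open>F\<close>.\<close>
        then have "\<not> F \<le> G" "\<not> G \<le> F"
          using 1 F_min PL by (auto simp: above_def order.order_iff_strict)
        then have "Var G * ?z ^ ?d \<in> ?I"
          using True AF FL AL PA[of G] above_F
          by (intro chow_ideal_Var_sum_power[OF upset_remove, where F = F and A' = A]) auto
        then show ?thesis using 1 by (simp add: mult.commute)
      next
        case False
        then show ?thesis using 1 by (simp add: chow_ideal_Var ideal_mult[OF ideal_chow_ideal])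
      qed
    next
      case 2
      then show ?thesis by (simp add: chow_ideal_incomparable ideal_mult[OF ideal_chow_ideal])
    next
      case 3
      then have "s \<in> ?I" using above_F by (auto intro: chow_ideal_Var_y)
      then show ?thesis by (rule ideal_mult[OF ideal_chow_ideal])
    next
      case 4
      \<comment> \<open>The power \<open>y G ^ b\<close> kills every summand of \<open>z\<close> not
        above \<open>G\<close>, so \<open>z\<close> may be replaced by \<open>y G\<close> next to
        it. The exponents then add up to that of the relation for \<open>G\<close> over
        \<open>A\<close>.\<close>
      define b where "b = r G - r F"
      have G: "G \<in> L" "F < G" "G \<in> P - {F}" using 4 above_F by (auto simp: above_def)
      have "?z = (\<Sum>K\<in>above F - {K\<in>L. G \<le> K}. Var K) + y G"
        unfolding y_def by (rule sum.subset_diff) (use G finite_L in \<open>auto simp: above_def\<close>)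
      then have "y G ^ b * ?z - y G ^ b * y G = (\<Sum>K\<in>above F - {K\<in>L. G \<le> K}. Var K * y G ^ b)"
        by (simp add: distrib_left sum_distrib_left mult.commute)
      also have "\<dots> \<in> ?I"
      proof (intro ideal_sum ideal_chow_ideal)
        fix K assume K: "K \<in> above F - {K\<in>L. G \<le> K}"
        show "Var K * y G ^ b \<in> ?I"
        proof (cases "K \<le> G")
          case True
          then have "K < G" using K G by (auto simp: above_def)
          have "r F < r K"
            using K FL by (auto simp: above_def intro!: rank_strict)
          then have le: "r G - r K \<le> b" by (simp add: b_def)
          have "Var K * y G ^ (r G - r K) \<in> ?I"
            using K G above_F \<open>K < G\<close> by (intro chow_ideal_Var_y) auto
          then have "y G ^ (r G - r K) * Var K \<in> ?I" by (simp add: mult.commute)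
          then have "y G ^ b * Var K \<in> ?I"
            by (rule ideal_power_ge[OF ideal_chow_ideal _ le])
          then show ?thesis by (simp add: mult.commute)
        next
          case False
          then have "K \<in> L" "\<not> G \<le> K" "F < K" using K by (auto simp: above_def)
          have "y G = (\<Sum>M\<in>{M\<in>L. G \<le> M}. Var M)" by (simp add: y_def)
          moreover have "Var K * (\<Sum>M\<in>{M\<in>L. G \<le> M}. Var M) ^ b \<in> ?I"
            using K above_F G FL \<open>\<not> K \<le> G\<close> \<open>\<not> G \<le> K\<close> \<open>F < K\<close>
            by (intro chow_ideal_Var_sum_power[OF upset_remove, where F = G and A' = F])
              (auto simp: b_def)
          ultimately show ?thesis by simp
        qed
      qed
      finally have "y G ^ b * ?z ^ ?d - y G ^ b * y G ^ ?d \<in> ?I"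
        by (rule ideal_mult_power_cong[OF ideal_chow_ideal])
      moreover have "y G ^ b * y G ^ ?d \<in> ?I"
      proof -
        have "r A < r F" "r F < r G" using rank_strict AL FL AF G by auto
        then have "b + ?d = r G - r A + \<epsilon>" by (simp add: b_def)
        then show ?thesis using chow_ideal_y[OF G(3), of A \<epsilon>] by (metis power_add)
      qed
      ultimately show ?thesis using ideal_cong[OF ideal_chow_ideal] 4(2)
        by (metis b_def mult.commute add_0_right)
    qed
  qed
  then show ?thesis using assms by blast
qed

lemma y_eq_Var_add: "y F = Var F + (\<Sum>K\<in>above F. Var K)"
proof -
  have "{K\<in>L. F \<le> K} = insert F (above F)" using FL by (auto simp: above_def)
  then show ?thesis using finite_L by (simp add: y_def above_def)
qed

text \<open>By minimality, \<open>Var F\<close> occurs in \<open>y G\<close> only for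
  \<open>G = F\<close>. A generator in which it occurs is thus either \<open>Var F\<close> times an
  element of the ideal of the contraction, or the power of \<open>y F\<close>, which becomes
  \<open>f\<close> itself. All other generators lie in the smaller ideal.\<close>

lemma chow_ideal_univ:
  fixes p
  defines "f \<equiv> [:\<Sum>K\<in>above F. Var K, 1:] ^ (r F - r A + \<epsilon>)"
  assumes "p \<in> chow_ideal A \<epsilon> P"
  shows "\<exists>g. coeff (univ F p - f * g) 0 \<in> chow_ideal A \<epsilon> (P - {F})
           \<and> (\<forall>e. coeff (univ F p - f * g) e \<in> chow_ideal F 0 (above F))"
proof -
  let ?I' = "chow_ideal A \<epsilon> (P - {F})" and ?J = "chow_ideal F 0 (above F)"
  let ?K = "{p. \<exists>g. coeff (p - f * g) 0 \<in> ?I' \<and> (\<forall>e. coeff (p - f * g) e \<in> ?J)}"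
  have const: "[:a:] \<in> ?K" if "a \<in> ?I'" for a
    using that chow_ideal_sub
    by (intro CollectI exI[of _ 0]) (auto simp: coeff_pCons ideal_zero[OF ideal_chow_ideal] split: nat.split)
  have lin: "[:0, 1:] * [:a:] \<in> ?K" if "a \<in> ?J" for a
    using that
    by (intro CollectI exI[of _ 0]) (auto simp: coeff_pCons ideal_zero[OF ideal_chow_ideal] split: nat.split)
  have free_const: "univ F a \<in> ?K" if "free_of F a" "a \<in> ?I'" for a
    using const[OF that(2)] by (simp only: univ_free_of[OF that(1)])
  have free_lin: "univ F (Var F * a) \<in> ?K" if "free_of F a" "a \<in> ?J" for a
    using lin[OF that(2)]
    by (simp only: univ_free_of[OF that(1)] ring_hom_1.hom_mult[OF ring_hom_univ] univ_Var refl if_True)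
  have "univ F p \<in> ?K"
  proof (rule ideal_gen_hom[OF ring_hom_univ _ _ assms(2)[unfolded chow_ideal_def]])
    show "ideal ?K" by (intro ideal_poly_monic_ext ideal_chow_ideal)
    fix s assume "s \<in> chow_gens A \<epsilon> P"
    then consider G where "G \<notin> P" "s = Var G"
      | G K where "G \<in> P" "K \<in> P" "\<not> G \<le> K" "\<not> K \<le> G" "s = Var G * Var K"
      | G K where "G \<in> P" "K \<in> P" "G < K" "s = Var G * y K ^ (r K - r G)"
      | G where "G \<in> P" "s = y G ^ (r G - r A + \<epsilon>)"
      unfolding chow_gens_def by blast
    then show "univ F s \<in> ?K"
    proof cases
      case 1
      then show ?thesis using F by (intro free_const) (auto intro: free_of_Var chow_ideal_Var)
    next
      case 2
      consider "G = F" | "K = F" | "G \<noteq> F" "K \<noteq> F" by blast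
      then show ?thesis
      proof cases
        case 1
        then have "Var K \<in> ?J" using 2 by (intro chow_ideal_Var) (auto simp: above_def)
        then show ?thesis using free_lin[of "Var K"] 1 2 by (auto simp: free_of_Var)
      next
        case eq: 2
        then have "Var G \<in> ?J" using 2 by (intro chow_ideal_Var) (auto simp: above_def)
        then show ?thesis using free_lin[of "Var G"] 2 eq by (auto simp: free_of_Var mult.commute)
      next
        case 3
        then show ?thesis using 2 chow_ideal_incomparable[of G K A \<epsilon> "P - {F}"]
          by (intro free_const) (auto intro: free_of_mult free_of_Var)
      qed
    next
      case 3
      then have "K \<noteq> F" using F_min by blast
      then have K: "K \<in> P - {F}" using 3 by blast
      show ?thesis
      proof (cases "G = F")
        case True
        then have "K \<in> above F" using 3 PL by (auto simp: above_def)
        then have "y K ^ (r K - r F) \<in> ?J" using chow_ideal_y[of K _ F 0] by simp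
        then show ?thesis
          unfolding 3(4) True by (intro free_lin free_of_power free_of_y K)
      next
        case False
        then have "free_of F s" "s \<in> ?I'" using 3 K
          by (auto intro!: free_of_mult free_of_power free_of_Var free_of_y chow_ideal_Var_y)
        then show ?thesis by (rule free_const)
      qed
    next
      case 4
      show ?thesis
      proof (cases "G = F")
        case True
        have "free_of F (\<Sum>K\<in>above F. Var K)"
          by (intro free_of_sum free_of_Var) (auto simp: above_def)
        then have "univ F (y F) = [:0, 1:] + [:\<Sum>K\<in>above F. Var K:]"
          by (simp add: y_eq_Var_add ring_hom_1.hom_add[OF ring_hom_univ] univ_Var univ_free_of)
        then have "univ F s = f"
          using True 4 by (simp add: f_def ring_hom_1.hom_power[OF ring_hom_univ])
        then show ?thesis
          by (intro CollectI exI[of _ 1]) (simp add: ideal_zero[OF ideal_chow_ideal])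
      next
        case False
        then have "free_of F s" "s \<in> ?I'" using 4
          by (auto intro!: free_of_power free_of_y chow_ideal_y)
        then show ?thesis by (rule free_const)
      qed
    qed
  qed
  then show ?thesis by simp
qed

text \<open>Among the generators for \<open>P - {F}\<close> only \<open>Var F\<close> involves
  \<open>Var F\<close>; it is sent to 0, and the others are fixed and hold for \<open>P\<close> as
  well.\<close>

lemma chow_ideal_subst:
  assumes "p \<in> chow_ideal A \<epsilon> (P - {F})"
  shows "subst (\<lambda>v. if v = F then 0 else Var v) p \<in> chow_ideal A \<epsilon> P"
proof (rule ideal_gen_hom[OF ring_hom_subst ideal_chow_ideal _ assms[unfolded chow_ideal_def]])
  fix s assume "s \<in> chow_gens A \<epsilon> (P - {F})"
  then consider "s = Var F" | "free_of F s" "s \<in> chow_ideal A \<epsilon> P"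
  proof -
    assume s: "s \<in> chow_gens A \<epsilon> (P - {F})" and thesis: "s = Var F \<Longrightarrow> thesis"
      "free_of F s \<Longrightarrow> s \<in> chow_ideal A \<epsilon> P \<Longrightarrow> thesis"
    consider "s = Var F" | G where "G \<notin> P" "s = Var G"
      | G K where "G \<in> P - {F}" "K \<in> P - {F}" "\<not> G \<le> K" "\<not> K \<le> G" "s = Var G * Var K"
      | G K where "G \<in> P - {F}" "K \<in> P - {F}" "G < K" "s = Var G * y K ^ (r K - r G)"
      | G where "G \<in> P - {F}" "s = y G ^ (r G - r A + \<epsilon>)"
      using s unfolding chow_gens_def by blast
    then show thesis
    proof cases
      case 1
      then show ?thesis by (rule thesis(1))
    next
      case 2
      then show ?thesis using F by (intro thesis(2)) (auto intro: free_of_Var chow_ideal_Var)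
    next
      case 3
      then show ?thesis
        using chow_ideal_incomparable[of G K]
        by (intro thesis(2)) (auto intro: free_of_mult free_of_Var)
    next
      case 4
      then show ?thesis
        by (intro thesis(2)) (auto intro!: free_of_mult free_of_power free_of_Var free_of_y chow_ideal_Var_y)
    next
      case 5
      then show ?thesis
        by (intro thesis(2)) (auto intro!: free_of_power free_of_y chow_ideal_y)
    qed
  qed
  then show "subst (\<lambda>v. if v = F then 0 else Var v) s \<in> chow_ideal A \<epsilon> P"
    by cases (simp_all add: subst_Var ideal_zero[OF ideal_chow_ideal] subst_free_of)
qed

text \<open>Multiplication by \<open>Var F\<close> turns the relation
  \<open>y G ^ (r G - r F)\<close> of the contraction into a relation for \<open>P\<close>, and it
  kills the variables of the elements incomparable with \<open>F\<close>.\<close>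

lemma Var_mult_subst_chow_ideal:
  assumes "p \<in> chow_ideal F 0 (above F)"
  shows "Var F * subst (\<lambda>v. if v = F then 0 else Var v) p \<in> chow_ideal A \<epsilon> P"
proof -
  let ?\<sigma> = "subst (\<lambda>v. if v = F then 0 else Var v)"
  let ?I = "chow_ideal A \<epsilon> P"
  have above_free: "G \<in> P - {F}" "G \<in> P" "F \<noteq> G" "F < G" if "G \<in> above F" for G
    using that above_F by (auto simp: above_def)
  have "?\<sigma> p \<in> {a. Var F * a \<in> ?I}"
  proof (rule ideal_gen_hom[OF ring_hom_subst _ _ assms[unfolded chow_ideal_def]])
    show "ideal {a. Var F * a \<in> ?I}" by (intro ideal_colon ideal_chow_ideal)
    fix s assume "s \<in> chow_gens F 0 (above F)"
    then consider "s = Var F" | G where "G \<notin> above F" "G \<noteq> F" "s = Var G"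
      | G K where "G \<in> above F" "K \<in> above F" "\<not> G \<le> K" "\<not> K \<le> G" "s = Var G * Var K"
      | G K where "G \<in> above F" "K \<in> above F" "G < K" "s = Var G * y K ^ (r K - r G)"
      | G where "G \<in> above F" "s = y G ^ (r G - r F)"
      unfolding chow_gens_def by auto
    then show "?\<sigma> s \<in> {a. Var F * a \<in> ?I}"
    proof cases
      case 1
      then show ?thesis by (simp add: subst_Var ideal_zero[OF ideal_chow_ideal])
    next
      case 2
      have "Var F * Var G \<in> ?I"
      proof (cases "G \<in> P")
        case True
        then have "\<not> F \<le> G" "\<not> G \<le> F" using 2 F_min[of G] PL by (auto simp: above_def)
        then show ?thesis by (rule chow_ideal_incomparable)
      next
        case False
        then show ?thesis by (intro ideal_mult[OF ideal_chow_ideal] chow_ideal_Var)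
      qed
      then show ?thesis using 2 by (simp add: subst_Var)
    next
      case 3
      then have "?\<sigma> s = s" using above_free by (auto intro!: subst_free_of free_of_mult free_of_Var)
      moreover have "s \<in> ?I" using 3 by (simp add: chow_ideal_incomparable)
      ultimately show ?thesis by (simp add: ideal_mult[OF ideal_chow_ideal])
    next
      case 4
      then have "?\<sigma> s = s" using above_free
        by (auto intro!: subst_free_of free_of_mult free_of_Var free_of_power free_of_y)
      moreover have "s \<in> ?I" using 4 above_free by (simp add: chow_ideal_Var_y)
      ultimately show ?thesis by (simp add: ideal_mult[OF ideal_chow_ideal])
    next
      case 5
      then have "?\<sigma> s = s" using above_free by (auto intro!: subst_free_of free_of_power free_of_y)
      then show ?thesis using 5 above_free F by (simp add: chow_ideal_Var_y)
    qed
  qed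
  then show ?thesis by simp
qed

end

text \<open>The shift \<open>\<epsilon>\<close> affects only the bottom step: the ring of the
  contraction at \<open>F\<close> is always the unshifted one on \<open>above F\<close>. This is why
  the same \<open>h\<close> appears for \<open>\<epsilon> = 0\<close> and
  \<open>\<epsilon> = 1\<close>.\<close>

theorem chow_basis:
  fixes h :: "'p \<Rightarrow> int fps"
  assumes h: "\<And>F. F \<in> L \<Longrightarrow> h F = 1 + (\<Sum>G\<in>above F. xsum (r G - r F - 1) * h G)"
    and P: "upset A P"
  shows "\<exists>B. basis_mod (chow_ideal A \<epsilon> P) B \<and> (\<forall>b\<in>B. set_mset b \<subseteq> P)
           \<and> mon_gf B = 1 + (\<Sum>F\<in>P. xsum (r F - r A + \<epsilon> - 1) * h F)"
  using P
\<comment> \<open>The outer induction supplies the contractions, whose bottom is higher. The inner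
  one removes a minimal element from \<open>P\<close>, which leaves an upset.\<close>
proof (induction "card (above A)" arbitrary: A P \<epsilon> rule: less_induct)
  case outer: less
  show ?case using outer.prems
  proof (induction "card P" arbitrary: P rule: less_induct)
    case inner: less
    show ?case
    proof (cases "P = {}")
      case True
      have "mon_gf {{#}} = 1" by (simp add: mon_gf_def)
      then show ?thesis using basis_mod_empty[of A \<epsilon>] True
        by (intro exI[of _ "{{#}}"]) simp
    next
      case False
      have finP: "finite P" using inner.prems by (rule finite_upset)
      obtain F where F: "F \<in> P" "\<And>G. G \<in> P \<Longrightarrow> \<not> G < F"
        using finite_has_minimal[OF finP False] by (metis order.strict_iff_order)
      note ctxt = inner.prems F
      have FL: "F \<in> L" and AF: "A < F" and AL: "A \<in> L"
        using inner.prems F by (auto simp: upset_def above_def)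
      define d where "d = r F - r A + \<epsilon>"
      have "d \<ge> 1" using rank_strict[OF AL FL AF] by (simp add: d_def)
      obtain B' where B': "basis_mod (chow_ideal A \<epsilon> (P - {F})) B'"
        "\<And>b. b \<in> B' \<Longrightarrow> set_mset b \<subseteq> P - {F}"
        "mon_gf B' = 1 + (\<Sum>G\<in>P - {F}. xsum (r G - r A + \<epsilon> - 1) * h G)"
        using inner.hyps[OF card_Diff1_less[OF finP F(1)] upset_remove[OF ctxt]] by blast
      have "above F \<subset> above A" using AF FL by (auto simp: above_def)
      then have "card (above F) < card (above A)"
        using finite_L by (intro psubset_card_mono) (auto simp: above_def)
      \<comment> \<open>With the full upset and no shift the right-hand side is the recursion for
        \<open>h F\<close>, which is folded back here.\<close>
      from outer.hyps[OF this upset_above[OF FL], of 0, unfolded add_0_right, folded h[OF FL]]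
      obtain B'' where B'': "basis_mod (chow_ideal F 0 (above F)) B''"
        "\<And>b. b \<in> B'' \<Longrightarrow> set_mset b \<subseteq> above F" "mon_gf B'' = h F"
        by blast
      have free: "F \<notin># b" if "b \<in> B' \<union> B''" for b
        using that B'(2) B''(2) by (fastforce simp: above_def)
      have "basis_mod (chow_ideal A \<epsilon> P) (extend_basis F d B' B'')"
      proof (rule basis_mod_extend[OF ideal_chow_ideal ideal_chow_ideal ideal_chow_ideal B'(1) B''(1) free \<open>d \<ge> 1\<close>])
        show "subst (\<lambda>v. if v = F then 0 else Var v) (\<Sum>K\<in>above F. Var K) = (\<Sum>K\<in>above F. Var K)"
          by (intro subst_free_of free_of_sum free_of_Var) (auto simp: above_def)
        show "(Var F + (\<Sum>K\<in>above F. Var K)) ^ d \<in> chow_ideal A \<epsilon> P"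
          using chow_ideal_y[OF F(1), of A \<epsilon>] by (simp add: y_eq_Var_add[OF ctxt] d_def)
      qed (use chow_ideal_sub[OF ctxt] power_mult_chow_ideal[OF ctxt] chow_ideal_univ[OF ctxt]
           chow_ideal_subst[OF ctxt] Var_mult_subst_chow_ideal[OF ctxt] in \<open>auto simp: d_def\<close>)
      moreover have "mon_gf (extend_basis F d B' B'')
          = 1 + (\<Sum>G\<in>P. xsum (r G - r A + \<epsilon> - 1) * h G)"
      proof -
        have "finite B'" "finite B''" using B'(1) B''(1) by (auto simp: basis_mod_def)
        then show ?thesis
          using mon_gf_extend_basis[OF _ _ free] B'(3) B''(3) finP F(1)
          by (simp add: sum.remove[of P F] d_def add_ac)
      qed
      moreover have "set_mset b \<subseteq> P" if "b \<in> extend_basis F d B' B''" for b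
      proof -
        have "above F \<subseteq> P" using inner.prems F(1) by (auto simp: upset_def)
        then show ?thesis using that B'(2) B''(2) F(1)
          by (fastforce simp: extend_basis_def split: if_splits)
      qed
      ultimately show ?thesis by blast
    qed
  qed
qed

end

section \<open>Dimensions of graded quotients\<close>

text \<open>The vectors \<open>v b\<close> form a basis of \<open>T\<close> modulo \<open>W\<close>.
  They are given as a family, so that injectivity and disjointness from a basis of \<open>W\<close>
  follow from the independence assumption.\<close>

lemma (in vector_space) dim_relative:
  assumes "W \<subseteq> T" "subspace W" "subspace T" "finite D" "T \<subseteq> span D" "finite C" "v ` C \<subseteq> T"
    and indep: "\<And>c. (\<Sum>b\<in>C. c b *s v b) \<in> W \<Longrightarrow> \<forall>b\<in>C. c b = 0"
    and spanning: "\<And>p. p \<in> T \<Longrightarrow> \<exists>c. p - (\<Sum>b\<in>C. c b *s v b) \<in> W"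
  shows "dim T = dim W + card C"
proof -
  obtain Wb where Wb: "Wb \<subseteq> W" "independent Wb" "W \<subseteq> span Wb" "card Wb = dim W"
    using basis_exists by blast
  have finWb: "finite Wb"
    using independent_span_bound[OF \<open>finite D\<close> Wb(2)] Wb(1) \<open>W \<subseteq> T\<close> \<open>T \<subseteq> span D\<close> by blast
  have inj: "inj_on v C"
  proof (rule inj_onI, rule ccontr)
    fix b b' assume b: "b \<in> C" "b' \<in> C" "v b = v b'" "b \<noteq> b'"
    let ?c = "\<lambda>a. (if a = b then 1 else 0) - (if a = b' then 1 else (0::'a))"
    have "(\<Sum>a\<in>C. ?c a *s v a) = (\<Sum>a\<in>C. if a = b then v a else 0) - (\<Sum>a\<in>C. if a = b' then v a else 0)"
      unfolding sum_subtractf[symmetric] by (intro sum.cong) (auto simp: scale_left_diff_distrib)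
    also have "\<dots> \<in> W" using b \<open>finite C\<close> \<open>subspace W\<close> by (simp add: subspace_0)
    finally have "\<forall>a\<in>C. ?c a = 0" by (rule indep)
    then have "?c b = 0" using b(1) by blast
    then show False using b(4) by simp
  qed
  have disj: "Wb \<inter> v ` C = {}"
  proof (rule ccontr)
    assume "Wb \<inter> v ` C \<noteq> {}"
    then obtain b where b: "b \<in> C" "v b \<in> Wb" by auto
    have "(\<Sum>a\<in>C. (if a = b then 1 else 0) *s v a) = (\<Sum>a\<in>C. if a = b then v a else 0)"
      by (intro sum.cong) auto
    also have "\<dots> \<in> W" using b \<open>finite C\<close> Wb(1) by auto
    finally have "\<forall>a\<in>C. (if a = b then 1 else (0::'a)) = 0" by (rule indep)
    then show False using b(1) by force
  qed
  have sum_S: "(\<Sum>x\<in>Wb \<union> v ` C. f x) = (\<Sum>x\<in>Wb. f x) + (\<Sum>b\<in>C. f (v b))" for f :: "'b \<Rightarrow> 'b"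
    using disj finWb \<open>finite C\<close> by (simp add: sum.union_disjoint sum.reindex[OF inj])
  have "independent (Wb \<union> v ` C)"
  proof -
    have "\<forall>x\<in>Wb \<union> v ` C. u x = 0" if u: "(\<Sum>x\<in>Wb \<union> v ` C. u x *s x) = 0" for u
    proof -
      have eq: "(\<Sum>b\<in>C. u (v b) *s v b) = - (\<Sum>x\<in>Wb. u x *s x)"
        using u unfolding sum_S by (simp add: eq_neg_iff_add_eq_0 add.commute)
      also have "\<dots> \<in> W" using Wb(1) \<open>subspace W\<close>
        by (intro subspace_neg subspace_sum subspace_scale) auto
      finally have C0: "\<forall>b\<in>C. u (v b) = 0" by (rule indep)
      then have "(\<Sum>x\<in>Wb. u x *s x) = 0" using eq by (simp add: neg_equal_0_iff_equal)
      then have "\<forall>x\<in>Wb. u x = 0"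
        using Wb(2) finWb dependent_finite by blast
      then show ?thesis using C0 by blast
    qed
    then show ?thesis
      using finWb \<open>finite C\<close> dependent_finite[of "Wb \<union> v ` C"] by blast
  qed
  moreover have "T \<subseteq> span (Wb \<union> v ` C)"
  proof
    fix p assume "p \<in> T"
    then obtain c where "p - (\<Sum>b\<in>C. c b *s v b) \<in> W" using spanning by blast
    then have "p - (\<Sum>b\<in>C. c b *s v b) \<in> span (Wb \<union> v ` C)"
      using Wb(3) span_mono[of Wb "Wb \<union> v ` C"] by blast
    moreover have "(\<Sum>b\<in>C. c b *s v b) \<in> span (Wb \<union> v ` C)"
      by (intro span_sum span_scale span_base) auto
    ultimately show "p \<in> span (Wb \<union> v ` C)" by (metis diff_add_cancel span_add)
  qed
  moreover have "card (Wb \<union> v ` C) = dim W + card C"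
    using disj finWb \<open>finite C\<close> Wb(4) by (simp add: card_Un_disjoint card_image[OF inj])
  moreover have "Wb \<union> v ` C \<subseteq> T" using Wb(1) \<open>W \<subseteq> T\<close> \<open>v ` C \<subseteq> T\<close> by blast
  ultimately show ?thesis by (intro dim_unique)
qed

section \<open>Coefficient functions and their homogeneous parts\<close>

interpretation qpoly: vector_space "qscale :: rat \<Rightarrow> 'v qpoly \<Rightarrow> 'v qpoly"
  by unfold_locales (auto simp: qscale_def fun_eq_iff distrib_left distrib_right)

lemma finite_monoms: "finite V \<Longrightarrow> finite (monoms V j)"
  using finite_multisets_of_size[of V j] by (simp add: monoms_def multisets_of_size_def)

definition homog_part :: "'v set \<Rightarrow> nat \<Rightarrow> 'v qpoly set" where
  "homog_part V j = {p. \<forall>m. p m \<noteq> 0 \<longrightarrow> m \<in> monoms V j}"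

lemma subspace_homog_part: "qpoly.subspace (homog_part V j)"
  by (rule qpoly.subspaceI) (auto simp: homog_part_def qscale_def, metis add_0)

lemma qpoly_sum_apply: "(\<Sum>i\<in>S. f i) m = (\<Sum>i\<in>S. (f i m :: rat))"
  by (induction S rule: infinite_finite_induct) auto

lemma qpoly_expand:
  assumes "finite M" "\<And>m. p m \<noteq> 0 \<Longrightarrow> m \<in> M"
  shows "p = (\<Sum>m\<in>M. qscale (p m) (monomial_poly m))"
proof
  fix m
  have "(\<Sum>m'\<in>M. qscale (p m') (monomial_poly m')) m = (\<Sum>m'\<in>M. if m' = m then p m' else 0)"
    unfolding qpoly_sum_apply by (intro sum.cong) (auto simp: qscale_def monomial_poly_def)
  then show "p m = (\<Sum>m\<in>M. qscale (p m) (monomial_poly m)) m"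
    using assms by auto
qed

lemma homog_part_span: "finite V \<Longrightarrow> homog_part V j \<subseteq> qpoly.span (monomial_poly ` monoms V j)"
proof
  fix p assume "finite V" "p \<in> homog_part V j"
  then have "p = (\<Sum>m\<in>monoms V j. qscale (p m) (monomial_poly m))"
    by (intro qpoly_expand finite_monoms) (auto simp: homog_part_def)
  also have "\<dots> \<in> qpoly.span (monomial_poly ` monoms V j)"
    by (intro qpoly.span_sum qpoly.span_scale qpoly.span_base) auto
  finally show "p \<in> qpoly.span (monomial_poly ` monoms V j)" .
qed

lemma dim_homog_part:
  assumes "finite V"
  shows "qpoly.dim (homog_part V j) = card (monoms V j)"
proof -
  have "qpoly.dim (homog_part V j) = qpoly.dim {0 :: 'a qpoly} + card (monoms V j)"
  proof (rule qpoly.dim_relative[OF _ _ subspace_homog_part _ homog_part_span[OF assms]])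
    show "monomial_poly ` monoms V j \<subseteq> homog_part V j"
      by (auto simp: homog_part_def monomial_poly_def split: if_splits)
    then show "{0} \<subseteq> homog_part V j" by (auto simp: homog_part_def)
    show "qpoly.subspace {0 :: 'a qpoly}" by (rule qpoly.subspace_single_0)
    show "\<forall>b\<in>monoms V j. c b = 0"
      if "(\<Sum>b\<in>monoms V j. qscale (c b) (monomial_poly b)) \<in> {0}" for c
    proof
      fix b assume b: "b \<in> monoms V j"
      have "0 = (\<Sum>b\<in>monoms V j. qscale (c b) (monomial_poly b)) b" using that by simp
      also have "\<dots> = (\<Sum>b'\<in>monoms V j. if b' = b then c b' else 0)"
        unfolding qpoly_sum_apply by (intro sum.cong) (auto simp: qscale_def monomial_poly_def)
      also have "\<dots> = c b" using b finite_monoms[OF assms] by simp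
      finally show "c b = 0" by simp
    qed
    show "\<exists>c. p - (\<Sum>b\<in>monoms V j. qscale (c b) (monomial_poly b)) \<in> {0}"
      if "p \<in> homog_part V j" for p
    proof -
      have "p = (\<Sum>b\<in>monoms V j. qscale (p b) (monomial_poly b))"
        using that by (intro qpoly_expand finite_monoms assms) (auto simp: homog_part_def)
      then show ?thesis by (metis (no_types, lifting) diff_self singletonI)
    qed
  qed (simp_all add: finite_monoms assms)
  then show ?thesis
    using qpoly.dim_span_eq_card_independent[OF qpoly.independent_empty] by simp
qed

lemma mono_mult_lookup: "mono_mult m (lookup p) = lookup (single m 1 * p)"
  by (auto simp: mono_mult_def lookup_single_mult)

lemma mono_mult_add: "mono_mult m (p + q) = mono_mult m p + mono_mult m q"
  and mono_mult_qscale: "mono_mult m (qscale c p) = qscale c (mono_mult m p)"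
  by (auto simp: mono_mult_def qscale_def)

lemma mono_mult_mono_mult: "mono_mult m (mono_mult m' g) = mono_mult (m + m') g"
proof
  fix k
  have "m \<subseteq># k \<and> m' \<subseteq># k - m \<longleftrightarrow> m + m' \<subseteq># k"
    by (metis mset_subset_eq_add_left subset_eq_diff_conv subset_mset.add_diff_inverse
        subset_mset.add_le_cancel_left subset_mset.dual_order.trans)
  then show "mono_mult m (mono_mult m' g) k = mono_mult (m + m') g k"
    by (auto simp: mono_mult_def)
qed

text \<open>This is what fits the separate spans in each degree together into one ideal.\<close>

lemma ideal_part_mono_mult:
  assumes "p \<in> ideal_part V G j" "v \<in> V"
  shows "mono_mult {#v#} p \<in> ideal_part V G (Suc j)"
  using assms(1) unfolding ideal_part_def
proof (induction rule: qpoly.span_induct_alt)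
  case base
  have "mono_mult {#v#} 0 = 0" by (auto simp: mono_mult_def)
  then show ?case by (simp only: qpoly.span_zero)
next
  case (step c x y)
  obtain m g d where x: "x = mono_mult m g" "g \<in> G" "homog d g" "set_mset m \<subseteq> V" "size m + d = j"
    using step(1) by blast
  have "mono_mult {#v#} x = mono_mult (add_mset v m) g"
    unfolding x(1) mono_mult_mono_mult by simp
  moreover have "set_mset (add_mset v m) \<subseteq> V" "size (add_mset v m) + d = Suc j"
    using x assms(2) by auto
  ultimately have "mono_mult {#v#} x \<in> {mono_mult m g |m g d. g \<in> G \<and> homog d g \<and> set_mset m \<subseteq> V \<and> size m + d = Suc j}"
    using x(2,3) by blast
  then show ?case
    unfolding mono_mult_add mono_mult_qscale
    by (rule qpoly.span_add[OF qpoly.span_scale[OF qpoly.span_base] step(2)])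
qed

text \<open>Monomials with a variable outside \<open>V\<close> are dropped as well; in this way
  those variables become members of \<open>graded_ideal\<close>.\<close>

definition component :: "'v set \<Rightarrow> nat \<Rightarrow> 'v mpoly \<Rightarrow> 'v qpoly" where
  "component V j p = (\<lambda>m. if m \<in> monoms V j then lookup p m else 0)"

text \<open>The ideal generated by \<open>G\<close> together with all variables outside \<open>V\<close>.\<close>

definition graded_ideal :: "'v set \<Rightarrow> 'v qpoly set \<Rightarrow> 'v mpoly set" where
  "graded_ideal V G = {p. \<forall>j. component V j p \<in> ideal_part V G j}"

lemma component_add: "component V j (p + q) = component V j p + component V j q"
  and component_diff: "component V j (p - q) = component V j p - component V j q"
  by (auto simp: component_def lookup_add lookup_minus)

lemma component_Cst_mult: "component V j (Cst c * p) = qscale c (component V j p)"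
  by (auto simp: component_def lookup_Cst_mult qscale_def)

lemma component_Var_mult:
  assumes "v \<in> V"
  shows "component V (Suc j) (Var v * p) = mono_mult {#v#} (component V j p)"
proof
  fix m
  show "component V (Suc j) (Var v * p) m = mono_mult {#v#} (component V j p) m"
  proof (cases "v \<in># m")
    case True
    then obtain m' where "m = add_mset v m'" by (metis insert_DiffM)
    then show ?thesis using assms
      by (auto simp: component_def mono_mult_def Var_def lookup_single_mult monoms_def)
  next
    case False
    then show ?thesis
      by (auto simp: component_def mono_mult_def Var_def lookup_single_mult)
  qed
qed

lemma component_Var_mult_0:
  assumes "v \<notin> V \<or> j = 0"
  shows "component V j (Var v * p) = 0"
proof
  fix m
  show "component V j (Var v * p) m = 0 m"
    using assms by (auto simp: component_def Var_def lookup_single_mult monoms_def)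
qed

lemma ideal_part_zero: "0 \<in> ideal_part V G j"
  and ideal_part_add: "p \<in> ideal_part V G j \<Longrightarrow> q \<in> ideal_part V G j \<Longrightarrow> p + q \<in> ideal_part V G j"
  and ideal_part_scale: "p \<in> ideal_part V G j \<Longrightarrow> qscale c p \<in> ideal_part V G j"
  by (simp_all add: ideal_part_def qpoly.span_zero qpoly.span_add qpoly.span_scale)

lemma ideal_graded_ideal: "ideal (graded_ideal V G)"
proof (intro idealI)
  have "component V j 0 = 0" for j by (auto simp: component_def)
  then show "0 \<in> graded_ideal V G" by (simp add: graded_ideal_def ideal_part_zero)
  have sum: "a + b \<in> graded_ideal V G" if "a \<in> graded_ideal V G" "b \<in> graded_ideal V G" for a b
    using that by (simp add: graded_ideal_def component_add ideal_part_add)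
  then show "a + b \<in> graded_ideal V G" if "a \<in> graded_ideal V G" "b \<in> graded_ideal V G" for a b
    using that by blast
  show "r * a \<in> graded_ideal V G" if "a \<in> graded_ideal V G" for r a
    using that
  \<comment> \<open>Only multiplication by a variable is of interest: outside \<open>V\<close> the
    product has no components at all, inside \<open>V\<close> every component moves up by one
    degree.\<close>
  proof (induction r arbitrary: a rule: mpoly_induct)
    case (const c)
    then show ?case by (simp add: graded_ideal_def component_Cst_mult ideal_part_scale)
  next
    case (var v)
    have "component V j (Var v * a) \<in> ideal_part V G j" for j
    proof (cases "v \<notin> V \<or> j = 0")
      case True
      then show ?thesis by (simp add: component_Var_mult_0 ideal_part_zero)
    next
      case False
      then obtain j' where "j = Suc j'" "v \<in> V" by (cases j) auto
      then show ?thesis using var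
        by (simp add: component_Var_mult ideal_part_mono_mult graded_ideal_def)
    qed
    then show ?case by (simp add: graded_ideal_def)
  next
    case (add p q)
    then show ?case by (simp add: sum distrib_right)
  next
    case (mult p q)
    then show ?case by (simp add: mult.assoc)
  qed
qed

lemma graded_ideal_base:
  assumes "lookup p \<in> G" "homog d (lookup p)" "\<And>m. m \<in> keys p \<Longrightarrow> set_mset m \<subseteq> V"
  shows "p \<in> graded_ideal V G"
  unfolding graded_ideal_def
proof safe
  fix j
  show "component V j p \<in> ideal_part V G j"
  proof (cases "j = d")
    case True
    have "component V j p = lookup p"
      using assms True by (intro ext) (auto simp: component_def monoms_def homog_def in_keys_iff)
    also have "\<dots> = mono_mult {#} (lookup p)" by (auto simp: mono_mult_def)
    also have "\<dots> \<in> {mono_mult m g |m g d. g \<in> G \<and> homog d g \<and> set_mset m \<subseteq> V \<and> size m + d = j}"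
      using assms True by fastforce
    finally show ?thesis unfolding ideal_part_def by (rule qpoly.span_base)
  next
    case False
    then have "component V j p = 0"
      using assms by (intro ext) (auto simp: component_def monoms_def homog_def)
    then show ?thesis by (simp only: ideal_part_zero)
  qed
qed

lemma ideal_part_sub_homog_part:
  assumes "\<And>g m. g \<in> G \<Longrightarrow> g m \<noteq> 0 \<Longrightarrow> set_mset m \<subseteq> V"
  shows "ideal_part V G j \<subseteq> homog_part V j"
  unfolding ideal_part_def
proof (intro qpoly.span_minimal subspace_homog_part subsetI)
  fix x assume "x \<in> {mono_mult m g |m g d. g \<in> G \<and> homog d g \<and> set_mset m \<subseteq> V \<and> size m + d = j}"
  then obtain m g d where x: "x = mono_mult m g" "g \<in> G" "homog d g" "set_mset m \<subseteq> V" "size m + d = j"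
    by blast
  show "x \<in> homog_part V j"
    unfolding homog_part_def
  proof safe
    fix k assume "x k \<noteq> 0"
    then have k: "m \<subseteq># k" "g (k - m) \<noteq> 0" by (auto simp: x(1) mono_mult_def split: if_splits)
    then have "k = m + (k - m)" "size (k - m) = d" "set_mset (k - m) \<subseteq> V"
      using x assms[OF x(2)] by (auto simp: homog_def)
    then show "k \<in> monoms V j" using x(4,5)
      unfolding monoms_def by (metis (mono_tags, lifting) Un_least mem_Collect_eq set_mset_union size_union)
  qed
qed

text \<open>Mutually inverse substitutions between the presentation over \<open>V\<close> and a quotient with
  a known monomial basis.\<close>

lemma quot_dim_transfer:
  fixes s :: "'u \<Rightarrow> 'v mpoly" and t :: "'v \<Rightarrow> 'u mpoly"
  assumes V: "finite V" and I: "ideal I" and B: "basis_mod I B"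
    and G: "\<And>g. g \<in> G \<Longrightarrow> \<exists>p d. g = lookup p \<and> homog d g \<and> (\<forall>m\<in>keys p. set_mset m \<subseteq> V) \<and> subst t p \<in> I"
    and s_I: "\<And>p. p \<in> I \<Longrightarrow> subst s p \<in> graded_ideal V G"
    and t_s: "\<And>u. subst t (s u) - Var u \<in> I"
    and s_t: "\<And>v. v \<in> V \<Longrightarrow> subst s (t v) - Var v \<in> graded_ideal V G"
    and s_deg: "\<And>u. keys (s u) \<subseteq> monoms V 1"
  shows "quot_dim V G j = card {b \<in> B. size b = j}"
proof -
  let ?W = "ideal_part V G j" and ?C = "{b \<in> B. size b = j}"
  let ?v = "\<lambda>b. lookup (subst s (single b 1))"
  have finB: "finite B" using B by (simp add: basis_mod_def)
  note s_hom = ring_hom_subst[of s] and t_hom = ring_hom_subst[of t]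
  note II = ideal_graded_ideal[of V G]
  \<comment> \<open>Since \<open>s\<close> sends variables to linear forms it preserves degrees, so
    the degree \<open>j\<close> component of an image involves exactly the basis monomials of size
    \<open>j\<close>.\<close>
  have keys_s: "keys (subst s (single b c)) \<subseteq> monoms V (size b)" for b c
  proof (induction b)
    case empty
    have "subst s (single {#} c) = single {#} c" by (simp only: single_zero_eq_Cst subst_Cst)
    then show ?case by (auto simp: monoms_def split: if_splits)
  next
    case (add u b)
    have "keys (subst s (single (add_mset u b) c)) \<subseteq> {m + m' |m m'. m \<in> keys (s u) \<and> m' \<in> keys (subst s (single b c))}"
      unfolding Var_mult_single[symmetric] subst_mult subst_Var by (rule keys_mult)
    also have "\<dots> \<subseteq> monoms V (size (add_mset u b))"
      using add s_deg[of u] by (fastforce simp: monoms_def)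
    finally show ?case .
  qed
  have comp_s: "component V j (subst s q) = (\<Sum>b\<in>?C. qscale (lookup q b) (?v b))"
    if "keys q \<subseteq> B" for q
  proof -
    have "component V j (subst s (single b c)) = (if size b = j then qscale c (?v b) else 0)" for b c
    proof -
      have "single b c = Cst c * single b 1" by (simp add: Cst_mult_single)
      then have "component V j (subst s (single b c)) = qscale c (component V j (subst s (single b 1)))"
        by (simp only: subst_mult subst_Cst component_Cst_mult)
      also have "component V j (subst s (single b 1)) = (if size b = j then ?v b else 0)"
        using keys_s[of b 1] by (intro ext) (auto simp: component_def in_keys_iff monoms_def subset_iff)
      finally show ?thesis by (simp add: qscale_def fun_eq_iff)
    qed
    moreover have "q = (\<Sum>b\<in>B. single b (lookup q b))"
    proof -
      have "q = (\<Sum>b\<in>keys q. single b (lookup q b))" by (rule mpoly_expand)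
      also have "\<dots> = (\<Sum>b\<in>B. single b (lookup q b))"
        using that finB by (intro sum.mono_neutral_left) (auto simp: in_keys_iff)
      finally show ?thesis .
    qed
    then have "component V j (subst s q) = component V j (\<Sum>b\<in>B. subst s (single b (lookup q b)))"
      by (metis (no_types, lifting) subst_sum sum.cong)
    moreover have "component V j (\<Sum>b\<in>S. f b) = (\<Sum>b\<in>S. component V j (f b))" for S :: "'u multiset set" and f
      by (induction S rule: infinite_finite_induct) (auto simp: component_add, auto simp: component_def)
    ultimately have "component V j (subst s q) = (\<Sum>b\<in>B. if size b = j then qscale (lookup q b) (?v b) else 0)"
      by simp
    also have "\<dots> = (\<Sum>b\<in>?C. qscale (lookup q b) (?v b))"
      using finB by (simp add: sum.inter_filter)
    finally show ?thesis .
  qed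
  have s_t_poly: "subst s (subst t p) - p \<in> graded_ideal V G" if "\<forall>m\<in>keys p. set_mset m \<subseteq> V" for p
  proof -
    have mono: "subst s (subst t (single m c)) - single m c \<in> graded_ideal V G" if "set_mset m \<subseteq> V" for m c
      using that
    proof (induction m)
      case empty
      then show ?case by (simp add: single_zero_eq_Cst subst_Cst ideal_zero[OF II])
    next
      case (add v m)
      then show ?case
        unfolding Var_mult_single[symmetric] subst_mult subst_Var
        by (intro ideal_cong_mult[OF II] s_t) auto
    qed
    have "subst s (subst t p) - p = (\<Sum>m\<in>keys p. subst s (subst t (single m (lookup p m))) - single m (lookup p m))"
      by (subst (1 2) mpoly_expand[of p]) (simp add: subst_sum sum_subtractf)
    also have "\<dots> \<in> graded_ideal V G" using that by (intro ideal_sum[OF II] mono) auto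
    finally show ?thesis .
  qed
  have t_s_poly: "subst t (subst s p) - p \<in> I" for p
  proof (induction p rule: mpoly_induct)
    case (const c)
    then show ?case by (simp add: subst_Cst ideal_zero[OF I])
  next
    case (var v)
    then show ?case by (simp add: subst_Var t_s)
  next
    case (add p q)
    then show ?case
      using ideal_add[OF I add] by (simp add: subst_add algebra_simps)
  next
    case (mult p q)
    then show ?case by (simp add: subst_mult ideal_cong_mult[OF I])
  qed
  have G_sub: "set_mset m \<subseteq> V" if "g \<in> G" "g m \<noteq> 0" for g m
    using G[OF that(1)] that(2) by (auto simp: in_keys_iff)
  have W_t: "\<exists>p. f = lookup p \<and> subst t p \<in> I" if "f \<in> ?W" for f
    using that unfolding ideal_part_def
  proof (induction rule: qpoly.span_induct_alt)
    case base
    have "0 = lookup 0" by auto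
    then show ?case using ring_hom_1.hom_zero[OF t_hom] ideal_zero[OF I] by metis
  next
    case (step c x y)
    then obtain m g p q where x: "x = mono_mult m (lookup p)" "subst t p \<in> I" "y = lookup q" "subst t q \<in> I"
      using G by blast
    have "qscale c x + y = lookup (Cst c * (single m 1 * p) + q)"
      unfolding x mono_mult_lookup by (auto simp: lookup_add lookup_Cst_mult qscale_def)
    moreover have "subst t (Cst c * (single m 1 * p) + q) \<in> I"
      unfolding subst_add subst_mult by (intro ideal_add ideal_mult I x)
    ultimately show ?case by blast
  qed
  \<comment> \<open>The images under \<open>s\<close> of the basis monomials of size
    \<open>j\<close> are a basis of degree \<open>j\<close> modulo the ideal: a relation among them
    is carried by \<open>t\<close> into \<open>I\<close>, and a form \<open>p\<close> is reached by
    reducing \<open>subst t p\<close> modulo \<open>I\<close> and returning with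
    \<open>s\<close>.\<close>
  have "qpoly.dim (homog_part V j) = qpoly.dim ?W + card ?C"
  proof (rule qpoly.dim_relative[OF ideal_part_sub_homog_part[OF G_sub] _ subspace_homog_part _ homog_part_span[OF V]])
    show "qpoly.subspace ?W" unfolding ideal_part_def by (rule qpoly.subspace_span)
    show "?v ` ?C \<subseteq> homog_part V j"
      using keys_s by (fastforce simp: homog_part_def in_keys_iff)
    show "\<forall>b\<in>?C. c b = 0" if c: "(\<Sum>b\<in>?C. qscale (c b) (?v b)) \<in> ?W" for c
    proof -
      define q where "q = (\<Sum>b\<in>?C. single b (c b))"
      have lookup_q: "lookup q b = (if b \<in> ?C then c b else 0)" for b
        using finB by (simp add: q_def lookup_sum lookup_single when_def)
      have "(\<Sum>b\<in>?C. qscale (c b) (?v b)) = lookup (\<Sum>b\<in>?C. Cst (c b) * subst s (single b 1))"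
        by (rule ext) (simp add: qpoly_sum_apply lookup_sum lookup_Cst_mult qscale_def)
      also have "(\<Sum>b\<in>?C. Cst (c b) * subst s (single b 1)) = subst s q"
        unfolding q_def subst_sum
        by (intro sum.cong refl) (metis Cst_mult_single mult_1_right subst_Cst subst_mult)
      finally have "lookup (subst s q) \<in> ?W" using c by simp
      then obtain p where "lookup (subst s q) = lookup p" "subst t p \<in> I" using W_t by blast
      then have "subst t (subst s q) \<in> I" by (simp add: poly_mapping_eq_iff[symmetric])
      then have "q \<in> I" using ideal_cong[OF I t_s_poly[of q]] by blast
      moreover have "keys q \<subseteq> B" by (auto simp: in_keys_iff lookup_q split: if_splits)
      ultimately have "q = 0" using basis_mod_indep[OF B] by blast
      then show ?thesis using lookup_q by (metis lookup_zero)
    qed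
    show "\<exists>c. f - (\<Sum>b\<in>?C. qscale (c b) (?v b)) \<in> ?W" if f: "f \<in> homog_part V j" for f
    proof -
      have "finite {m. f m \<noteq> 0}"
        using f finite_monoms[OF V, of j] by (auto simp: homog_part_def intro: finite_subset)
      then have lk: "lookup (Abs_poly_mapping f) = f" by simp
      define p where "p = Abs_poly_mapping f"
      have p: "\<forall>m\<in>keys p. set_mset m \<subseteq> V" "component V j p = f"
        using f lk by (auto simp: p_def in_keys_iff homog_part_def monoms_def component_def fun_eq_iff)
      obtain q where q: "keys q \<subseteq> B" "subst t p - q \<in> I" using basis_modE[OF B] by blast
      have "subst s (subst t p) - subst s q \<in> graded_ideal V G"
        using s_I[OF q(2)] by (simp add: subst_diff)
      then have "p - subst s q \<in> graded_ideal V G"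
        using ideal_cong_trans[OF II ideal_cong_sym[OF II s_t_poly[OF p(1)]]] by blast
      then have "component V j (p - subst s q) \<in> ?W" by (simp add: graded_ideal_def)
      then show ?thesis unfolding component_diff p(2) comp_s[OF q(1)] by blast
    qed
  qed (simp_all add: finite_monoms V finB)
  then show ?thesis by (simp add: quot_dim_def dim_homog_part[OF V])
qed

lemma hilbert_transfer:
  fixes s :: "'u \<Rightarrow> 'v mpoly" and t :: "'v \<Rightarrow> 'u mpoly"
  assumes "finite V" "ideal I" "basis_mod I B"
    and "\<And>g. g \<in> G \<Longrightarrow> \<exists>p d. g = lookup p \<and> homog d g \<and> (\<forall>m\<in>keys p. set_mset m \<subseteq> V) \<and> subst t p \<in> I"
    and "\<And>p. p \<in> I \<Longrightarrow> subst s p \<in> graded_ideal V G"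
    and "\<And>u. subst t (s u) - Var u \<in> I"
    and "\<And>v. v \<in> V \<Longrightarrow> subst s (t v) - Var v \<in> graded_ideal V G"
    and "\<And>u. keys (s u) \<subseteq> monoms V 1"
  shows "hilbert V G = mon_gf B"
proof (rule fps_ext)
  fix j
  have "fps_nth (mon_gf B) j = (\<Sum>b\<in>B. if size b = j then 1 else 0)"
    unfolding mon_gf_def fps_sum_nth by (intro sum.cong) (auto simp: fps_X_power_nth)
  also have "\<dots> = int (card {b \<in> B. size b = j})"
    using assms(3) by (simp add: basis_mod_def sum.inter_filter[symmetric])
  finally show "fps_nth (hilbert V G) j = fps_nth (mon_gf B) j"
    using quot_dim_transfer[OF assms, of j] by (simp add: hilbert_def)
qed

section \<open>The defining generators as elements of the polynomial ring\<close>

lemma lin_poly_lookup: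
  assumes "finite V"
  shows "lin_poly V c = lookup (\<Sum>v\<in>V. Cst (c v) * Var v)"
proof
  fix m
  have "lookup (\<Sum>v\<in>V. Cst (c v) * Var v) m = (\<Sum>v\<in>V. if {#v#} = m then c v else 0)"
    by (simp add: Var_def Cst_mult_single lookup_sum lookup_single when_def)
  also have "\<dots> = lin_poly V c m"
  proof (cases "size m = 1")
    case True
    then obtain x where "m = {#x#}" using size_1_singleton_mset by blast
    then show ?thesis using assms by (simp add: lin_poly_def)
  next
    case False
    then have "(if {#v#} = m then c v else 0) = 0" for v by auto
    then show ?thesis using False by (simp add: lin_poly_def)
  qed
  finally show "lin_poly V c m = lookup (\<Sum>v\<in>V. Cst (c v) * Var v) m" by simp
qed

lemma homog_lin_poly: "homog 1 (lin_poly V c)"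
  by (auto simp: homog_def lin_poly_def split: if_splits)

lemma homog_monomial_poly: "homog (size m) (monomial_poly m)"
  by (auto simp: homog_def monomial_poly_def split: if_splits)

lemma monomial_poly_lookup: "monomial_poly {#u, v#} = lookup (Var u * Var v)"
  by (rule ext) (auto simp: Var_def mult_single monomial_poly_def lookup_single when_def)

lemma Cst_if: "Cst (if b then 1 else 0) * p = (if b then p else 0)"
  and Cst_if_uminus: "Cst (if b then - 1 else 0) * p = (if b then - p else 0)"
  by (simp_all add: ring_hom_1.hom_one[OF ring_hom_Cst] ring_hom_1.hom_zero[OF ring_hom_Cst]
      ring_hom_1.hom_uminus[OF ring_hom_Cst])

lemma keys_sum_Var: "A \<subseteq> V \<Longrightarrow> keys (\<Sum>v\<in>A. Var v) \<subseteq> monoms V 1"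
proof (induction A rule: infinite_finite_induct)
  case (insert x F)
  have "keys (\<Sum>v\<in>insert x F. Var v) \<subseteq> keys (Var x) \<union> keys (\<Sum>v\<in>F. Var v)"
    using insert Poly_Mapping.keys_add[of "Var x" "\<Sum>v\<in>F. Var v"] by simp
  also have "\<dots> \<subseteq> monoms V 1"
  proof (rule Un_least)
    show "keys (Var x) \<subseteq> monoms V 1" using insert.prems by (simp add: monoms_def Var_def)
    show "keys (\<Sum>v\<in>F. Var v) \<subseteq> monoms V 1" using insert by simp
  qed
  finally show ?case .
qed auto

lemma keys_uminus: "keys (- p) = keys p" for p :: "'v mpoly"
  by (auto simp: in_keys_iff)

lemma graded_ideal_Var_mult:
  assumes "monomial_poly {#u, v#} \<in> G" "u \<in> V" "v \<in> V"
  shows "Var u * Var v \<in> graded_ideal V G"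
proof (rule graded_ideal_base)
  show "lookup (Var u * Var v) \<in> G" using assms(1) by (simp add: monomial_poly_lookup)
  show "homog 2 (lookup (Var u * Var v))"
    using homog_monomial_poly[of "{#u, v#}"] by (simp add: monomial_poly_lookup numeral_2_eq_2)
  fix m assume "m \<in> keys (Var u * Var v)"
  then have "m = {#u, v#}" by (simp add: Var_def mult_single)
  then show "set_mset m \<subseteq> V" using assms by simp
qed

lemma graded_ideal_lin_poly:
  assumes "lin_poly V c \<in> G" "finite V"
  shows "(\<Sum>v\<in>V. Cst (c v) * Var v) \<in> graded_ideal V G"
proof (rule graded_ideal_base)
  show "lookup (\<Sum>v\<in>V. Cst (c v) * Var v) \<in> G" using assms by (simp add: lin_poly_lookup)
  show "homog 1 (lookup (\<Sum>v\<in>V. Cst (c v) * Var v))"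
    using homog_lin_poly[of V c] assms by (simp add: lin_poly_lookup)
  fix m assume "m \<in> keys (\<Sum>v\<in>V. Cst (c v) * Var v)"
  then have "lin_poly V c m \<noteq> 0" using assms by (simp add: lin_poly_lookup in_keys_iff)
  then show "set_mset m \<subseteq> V" by (auto simp: lin_poly_def split: if_splits)
qed

text \<open>Together with \<open>monomial_poly_presented\<close>, this puts the generators into the
  form that \<open>hilbert_transfer\<close> demands.\<close>

lemma lin_poly_presented:
  assumes "finite V" "subst t (\<Sum>v\<in>V. Cst (c v) * Var v) \<in> I"
  shows "\<exists>p d. lin_poly V c = lookup p \<and> homog d (lin_poly V c)
           \<and> (\<forall>m\<in>keys p. set_mset m \<subseteq> V) \<and> subst t p \<in> I"
proof (intro exI conjI ballI)
  show eq: "lin_poly V c = lookup (\<Sum>v\<in>V. Cst (c v) * Var v)" by (rule lin_poly_lookup[OF assms(1)])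
  show "homog 1 (lin_poly V c)" by (rule homog_lin_poly)
  fix m assume "m \<in> keys (\<Sum>v\<in>V. Cst (c v) * Var v)"
  then have "lin_poly V c m \<noteq> 0" by (simp add: eq in_keys_iff)
  then show "set_mset m \<subseteq> V" by (auto simp: lin_poly_def split: if_splits)
qed (rule assms(2))

lemma monomial_poly_presented:
  assumes "u \<in> V" "v \<in> V" "t u * t v \<in> I"
  shows "\<exists>p d. monomial_poly {#u, v#} = lookup p \<and> homog d (monomial_poly {#u, v#})
           \<and> (\<forall>m\<in>keys p. set_mset m \<subseteq> V) \<and> subst t p \<in> I"
proof (intro exI conjI ballI)
  show "monomial_poly {#u, v#} = lookup (Var u * Var v)" by (rule monomial_poly_lookup)
  show "homog (size {#u, v#}) (monomial_poly {#u, v#})" by (rule homog_monomial_poly)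
  show "subst t (Var u * Var v) \<in> I" using assms(3) by (simp only: subst_mult subst_Var)
  fix m assume "m \<in> keys (Var u * Var v)"
  then have "m = {#u, v#}" by (simp add: Var_def mult_single)
  then show "set_mset m \<subseteq> V" using assms by simp
qed

context ranked_lattice
begin

text \<open>For an ideal with the incomparability relations, the higher power relations follow from
  those between consecutive ranks.\<close>

lemma chow_ideal_least:
  assumes K: "ideal K" and A: "A \<in> L" "\<And>F. F \<in> L \<Longrightarrow> A \<le> F"
    and cover: "\<And>F G. F \<in> L \<Longrightarrow> G \<in> L \<Longrightarrow> F < G \<Longrightarrow> \<exists>M\<in>L. F \<le> M \<and> M < G \<and> r G = Suc (r M)"
    and K_Var: "\<And>F. F \<notin> above A \<Longrightarrow> Var F \<in> K"
    and K_inc: "\<And>F G. F \<in> above A \<Longrightarrow> G \<in> above A \<Longrightarrow> \<not> F \<le> G \<Longrightarrow> \<not> G \<le> F \<Longrightarrow> Var F * Var G \<in> K"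
    and K_cover: "\<And>F G. F \<in> above A \<Longrightarrow> G \<in> above A \<Longrightarrow> F < G \<Longrightarrow> r G = Suc (r F) \<Longrightarrow> Var F * y G \<in> K"
    and K_atom: "\<And>G. G \<in> above A \<Longrightarrow> r G = Suc (r A) \<Longrightarrow> y G ^ Suc \<epsilon> \<in> K"
  shows "chow_ideal A \<epsilon> (above A) \<subseteq> K"
proof -
  have inc: "Var F * Var G \<in> K" if "\<not> F \<le> G" "\<not> G \<le> F" for F G
    using that K_inc K_Var ideal_mult[OF K] by (metis mult.commute)
  \<comment> \<open>Passing from \<open>M\<close> to an element \<open>G\<close> one rank higher
    costs one more factor: \<open>y G * y M\<close> and \<open>y G * y G\<close> agree modulo
    \<open>K\<close>, because \<open>y G\<close> kills every variable above \<open>M\<close> that is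
    not above \<open>G\<close>.\<close>
  have step: "x * y G ^ Suc e \<in> K"
    if M: "M \<in> above A" "G \<in> L" "M < G" "r G = Suc (r M)" and x: "x * y M ^ e \<in> K" for M G x e
  proof -
    have "y M = (\<Sum>N\<in>{N\<in>L. M \<le> N} - {N\<in>L. G \<le> N}. Var N) + y G"
      unfolding y_def by (rule sum.subset_diff) (use M finite_L in auto)
    then have "y G * y M - y G * y G = (\<Sum>N\<in>{N\<in>L. M \<le> N} - {N\<in>L. G \<le> N}. Var N * y G)"
      by (simp add: distrib_left sum_distrib_left mult.commute)
    also have "\<dots> \<in> K"
    proof (intro ideal_sum K)
      fix N assume "N \<in> {N\<in>L. M \<le> N} - {N\<in>L. G \<le> N}"
      then have N: "N \<in> L" "M \<le> N" "\<not> G \<le> N" by auto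
      then have NA: "N \<in> above A" using M(1) by (auto simp: above_def)
      obtain J where J: "J \<in> L" "N \<le> J" "G \<le> J" "\<And>K. K \<in> L \<Longrightarrow> G \<le> K \<Longrightarrow> N \<le> K \<Longrightarrow> J \<le> K"
        "r J + r M \<le> r N + r G"
        using join_ex[OF N(1) M(2)] M N by (metis above_def mem_Collect_eq less_imp_le)
      have "N < J" using J N by (metis order.not_eq_order_implies_strict)
      \<comment> \<open>Submodularity against \<open>M\<close> gives at most one rank more, so the
        consecutive-rank relation applies to \<open>N\<close> and the join \<open>J\<close>.\<close>
      then have "r J = Suc (r N)" using rank_strict[OF N(1) J(1)] J(5) M(4) by linarith
      then have "Var N * y J \<in> K"
        using \<open>N < J\<close> NA J(1) by (intro K_cover) (auto simp: above_def)
      moreover have "Var N * y G - Var N * y J \<in> K"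
        unfolding y_def[of G]
        by (rule sum_Var_join[OF K, where F = G]) (use J N finite_L inc in auto)
      ultimately show "Var N * y G \<in> K" using ideal_cong[OF K] by blast
    qed
    finally have "y G * y M ^ e - y G * y G ^ e \<in> K" by (rule ideal_mult_power_cong[OF K])
    then have "x * (y G * y M ^ e - y G * y G ^ e) \<in> K" by (rule ideal_mult[OF K])
    moreover have "x * (y G * y M ^ e - y G * y G ^ e) = y G * (x * y M ^ e) - x * y G ^ Suc e"
      by (simp add: algebra_simps)
    ultimately show ?thesis
      using ideal_cong[OF K] ideal_mult[OF K x] by metis
  qed
  have aboveL: "F \<in> L" if "F \<in> above A" for F using that by (simp add: above_def)
  have power: "Var F * y G ^ (r G - r F) \<in> K" if "F \<in> above A" "G \<in> above A" "F < G" for F G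
    using that
  proof (induction "r G" arbitrary: G rule: less_induct)
    case less
    obtain M where M: "M \<in> L" "F \<le> M" "M < G" "r G = Suc (r M)"
      using cover less.prems aboveL by metis
    show ?case
    proof (cases "M = F")
      case True
      then show ?thesis using K_cover less.prems M by simp
    next
      case False
      then have "F < M" using M by (metis order.not_eq_order_implies_strict)
      then have MA: "M \<in> above A" using less.prems(1) M(1) by (auto simp: above_def)
      have "r F < r M" using rank_strict \<open>F < M\<close> aboveL[OF less.prems(1)] M(1) by blast
      then have "r G - r F = Suc (r M - r F)" using M(4) by simp
      then show ?thesis
        using step[OF MA aboveL[OF less.prems(2)] M(3,4) less.hyps[OF _ less.prems(1) MA \<open>F < M\<close>]] M(4)
        by simp
    qed
  qed
  have power': "y G ^ (r G - r A + \<epsilon>) \<in> K" if "G \<in> above A" for G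
    using that
  proof (induction "r G" arbitrary: G rule: less_induct)
    case less
    have "A < G" using less.prems by (simp add: above_def)
    then obtain M where M: "M \<in> L" "A \<le> M" "M < G" "r G = Suc (r M)"
      using cover[OF A(1) aboveL[OF less.prems]] by metis
    show ?case
    proof (cases "M = A")
      case True
      then show ?thesis using K_atom[OF less.prems] M by simp
    next
      case False
      then have MA: "M \<in> above A" using M by (auto simp: above_def)
      have "r A < r M" using rank_strict MA A(1) by (auto simp: above_def)
      then have "r G - r A + \<epsilon> = Suc (r M - r A + \<epsilon>)" using M(4) by simp
      then show ?thesis
        using step[OF MA aboveL[OF less.prems] M(3,4), of 1 "r M - r A + \<epsilon>"] less.hyps[OF _ MA] M(4)
        by simp
    qed
  qed
  show ?thesis
    unfolding chow_ideal_def chow_gens_def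
    by (intro ideal_gen_least K) (use K_Var K_inc power power' in auto)
qed

end

section \<open>Matroids and their lattices of flats\<close>

text \<open>A nonempty ground set keeps \<open>E\<close> apart from the empty flat, so that
  \<open>E\<close> has a variable of its own.\<close>

locale loopless_matroid =
  fixes E :: "'a set" and indep :: "'a set \<Rightarrow> bool"
  assumes matroid: "matroid E indep" and loopless: "loopless E indep" and nonempty: "E \<noteq> {}"
begin

abbreviation rk :: "'a set \<Rightarrow> nat" where "rk \<equiv> rank indep"

lemma finite_E: "finite E"
  and indep_empty: "indep {}"
  and indep_sub_E: "indep X \<Longrightarrow> X \<subseteq> E"
  and indep_subset: "indep Y \<Longrightarrow> X \<subseteq> Y \<Longrightarrow> indep X"
  and indep_augment: "indep X \<Longrightarrow> indep Y \<Longrightarrow> card X < card Y \<Longrightarrow> \<exists>y\<in>Y - X. indep (insert y X)"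
  using matroid unfolding matroid_def by blast+

lemma indep_finite: "indep X \<Longrightarrow> finite X"
  using indep_sub_E finite_E finite_subset by blast

lemma finite_rank_set: "finite {card X |X. X \<subseteq> A \<and> indep X}"
proof -
  have "{card X |X. X \<subseteq> A \<and> indep X} \<subseteq> {..card E}"
    using indep_sub_E finite_E card_mono by fastforce
  then show ?thesis using finite_subset by blast
qed

lemma card_le_rank: "indep X \<Longrightarrow> X \<subseteq> A \<Longrightarrow> card X \<le> rk A"
  unfolding rank_def by (intro Max_ge finite_rank_set) blast

lemma rank_attained:
  obtains X where "X \<subseteq> A" "indep X" "card X = rk A"
proof -
  have "rk A \<in> {card X |X. X \<subseteq> A \<and> indep X}"
    unfolding rank_def using indep_empty by (intro Max_in finite_rank_set) blast
  then show ?thesis using that by auto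
qed

lemma rank_mono: "A \<subseteq> B \<Longrightarrow> rk A \<le> rk B"
  by (metis card_le_rank order_trans rank_attained)

lemma rank_le_card: "finite A \<Longrightarrow> rk A \<le> card A"
  by (metis card_mono rank_attained)

lemma rank_indep: "indep X \<Longrightarrow> rk X = card X"
  by (metis card_le_rank indep_finite le_antisym order_refl rank_le_card)

lemma rank_empty: "rk {} = 0"
  using rank_indep[OF indep_empty] by simp

lemma indep_singleton: "x \<in> E \<Longrightarrow> indep {x}"
  using loopless by (simp add: loopless_def)

lemma extend_to_basis:
  assumes "indep X" "X \<subseteq> A"
  obtains B where "X \<subseteq> B" "B \<subseteq> A" "indep B" "card B = rk A"
proof -
  have "\<exists>B. X \<subseteq> B \<and> B \<subseteq> A \<and> indep B \<and> card B = rk A" if "X \<subseteq> A" "indep X" for X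
    using that
  proof (induction "rk A - card X" arbitrary: X rule: less_induct)
    case less
    show ?case
    proof (cases "card X = rk A")
      case True
      then show ?thesis using less.prems by blast
    next
      case False
      then have lt: "card X < rk A" using card_le_rank[OF less.prems(2,1)] by simp
      obtain Y where Y: "Y \<subseteq> A" "indep Y" "card Y = rk A" by (rule rank_attained)
      then obtain z where z: "z \<in> Y - X" "indep (insert z X)"
        using indep_augment[OF less.prems(2) Y(2)] lt by auto
      have "rk A - card (insert z X) < rk A - card X"
        using z lt indep_finite[OF less.prems(2)] by simp
      then show ?thesis using less.hyps[of "insert z X"] z Y less.prems by auto
    qed
  qed
  then show ?thesis using assms that by blast
qed

lemma rank_submodular: "rk (A \<union> B) + rk (A \<inter> B) \<le> rk A + rk B"
proof -
  obtain X where X: "X \<subseteq> A \<inter> B" "indep X" "card X = rk (A \<inter> B)" by (rule rank_attained)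
  obtain Y where Y: "X \<subseteq> Y" "Y \<subseteq> A \<union> B" "indep Y" "card Y = rk (A \<union> B)"
    using extend_to_basis[OF X(2), of "A \<union> B"] X(1) by blast
  have fin: "finite Y" using Y(3) by (rule indep_finite)
  have "card (Y \<inter> A) \<le> rk A" "card (Y \<inter> B) \<le> rk B"
    using Y(3) by (auto intro!: card_le_rank intro: indep_subset)
  moreover have "card (Y \<inter> A) + card (Y \<inter> B) = card Y + card (Y \<inter> A \<inter> B)"
  proof -
    have "(Y \<inter> A) \<union> (Y \<inter> B) = Y" "(Y \<inter> A) \<inter> (Y \<inter> B) = Y \<inter> A \<inter> B" using Y(2) by auto
    then show ?thesis using card_Un_Int[of "Y \<inter> A" "Y \<inter> B"] fin by simp
  qed
  moreover have "card X \<le> card (Y \<inter> A \<inter> B)"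
    using X(1) Y(1) fin by (intro card_mono) auto
  ultimately show ?thesis using X(3) Y(4) by linarith
qed

lemma rank_insert_le: "rk (insert x A) \<le> Suc (rk A)"
  using rank_submodular[of A "{x}"] rank_le_card[of "{x}"] by simp

section \<open>Closures and the lattice of flats\<close>

definition closure :: "'a set \<Rightarrow> 'a set" where
  "closure A = {x \<in> E. rk (insert x A) = rk A}"

lemma closure_superset: "A \<subseteq> E \<Longrightarrow> A \<subseteq> closure A"
  by (auto simp: closure_def insert_absorb)

lemma closure_sub_E: "closure A \<subseteq> E"
  by (auto simp: closure_def)

lemma rank_closure:
  assumes "A \<subseteq> E"
  shows "rk (closure A) = rk A"
proof (rule ccontr)
  assume ne: "rk (closure A) \<noteq> rk A"
  have le: "rk A \<le> rk (closure A)" by (intro rank_mono closure_superset assms)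
  obtain X where X: "X \<subseteq> A" "indep X" "card X = rk A" by (rule rank_attained)
  obtain Y where Y: "X \<subseteq> Y" "Y \<subseteq> closure A" "indep Y" "card Y = rk (closure A)"
    using extend_to_basis[OF X(2), of "closure A"] X(1) closure_superset[OF assms] by blast
  have "X \<noteq> Y" using ne X Y by auto
  then obtain x where x: "x \<in> Y - X" using Y(1) by blast
  have "indep (insert x X)" using x Y(1) by (intro indep_subset[OF Y(3)]) auto
  then have "card (insert x X) \<le> rk (insert x A)" using X(1) by (intro card_le_rank) auto
  moreover have "rk (insert x A) = rk A" using x Y(2) by (auto simp: closure_def)
  ultimately show False using x X(3) indep_finite[OF X(2)] by simp
qed

lemma flat_closure:
  assumes "A \<subseteq> E"
  shows "flat E indep (closure A)"
  unfolding flat_def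
proof (intro conjI ballI closure_sub_E)
  fix x assume x: "x \<in> E - closure A"
  have "rk A < rk (insert x A)"
    using x rank_mono[of A "insert x A"] by (auto simp: closure_def order.strict_iff_order)
  also have "\<dots> \<le> rk (insert x (closure A))"
    using closure_superset[OF assms] by (intro rank_mono) auto
  finally show "rk (closure A) < rk (insert x (closure A))"
    using rank_closure[OF assms] by simp
qed

lemma closure_minimal:
  assumes "flat E indep F" "A \<subseteq> F"
  shows "closure A \<subseteq> F"
proof
  fix x assume x: "x \<in> closure A"
  show "x \<in> F"
  proof (rule ccontr)
    assume "x \<notin> F"
    then have "rk F < rk (insert x F)" using x assms by (auto simp: flat_def closure_def)
    moreover have "rk (F \<union> insert x A) + rk (F \<inter> insert x A) \<le> rk F + rk (insert x A)"
      by (rule rank_submodular)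
    moreover have "F \<union> insert x A = insert x F" using assms(2) by auto
    moreover have "rk A \<le> rk (F \<inter> insert x A)" using assms(2) by (intro rank_mono) auto
    ultimately show False using x by (simp add: closure_def)
  qed
qed

abbreviation flats :: "'a set set" where "flats \<equiv> {F. flat E indep F}"

lemma flat_sub_E: "flat E indep F \<Longrightarrow> F \<subseteq> E"
  by (simp add: flat_def)

lemma flat_rank_strict:
  assumes "flat E indep F" "flat E indep G" "F \<subset> G"
  shows "rk F < rk G"
proof -
  obtain x where "x \<in> G" "x \<notin> F" using assms by blast
  then have "rk F < rk (insert x F)" using assms(1) flat_sub_E[OF assms(2)] by (auto simp: flat_def)
  also have "\<dots> \<le> rk G" using \<open>x \<in> G\<close> assms(3) by (intro rank_mono) auto
  finally show ?thesis .
qed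

text \<open>Joins are closures of unions. Submodularity against a common lower flat follows from
  that against the intersection by monotonicity of the rank.\<close>

sublocale ranked_lattice flats rk
proof
  show "finite flats"
    using finite_E flat_sub_E by (auto intro: finite_subset[of _ "Pow E"])
  show "rk F < rk G" if "F \<in> flats" "G \<in> flats" "F < G" for F G
    using that flat_rank_strict by blast
  fix F G assume FG: "F \<in> flats" "G \<in> flats"
  then have sub: "F \<union> G \<subseteq> E" using flat_sub_E by auto
  show "\<exists>J\<in>flats. F \<le> J \<and> G \<le> J \<and> (\<forall>K\<in>flats. F \<le> K \<longrightarrow> G \<le> K \<longrightarrow> J \<le> K)
        \<and> (\<forall>A\<in>flats. A \<le> F \<longrightarrow> A \<le> G \<longrightarrow> rk J + rk A \<le> rk F + rk G)"
  proof (intro bexI conjI ballI impI)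
    show "closure (F \<union> G) \<in> flats" using flat_closure[OF sub] by simp
    show "F \<subseteq> closure (F \<union> G)" "G \<subseteq> closure (F \<union> G)" using closure_superset[OF sub] by auto
    show "closure (F \<union> G) \<subseteq> K" if "K \<in> flats" "F \<subseteq> K" "G \<subseteq> K" for K
      using that by (intro closure_minimal) auto
    show "rk (closure (F \<union> G)) + rk A \<le> rk F + rk G" if "A \<subseteq> F" "A \<subseteq> G" for A
      using rank_submodular[of F G] rank_mono[of A "F \<inter> G"] that rank_closure[OF sub] by simp
  qed
qed

lemma flat_empty: "flat E indep {}"
  using rank_indep[OF indep_singleton] rank_empty by (auto simp: flat_def)

lemma flat_E: "flat E indep E"
  by (simp add: flat_def)

lemma above_iff: "F \<in> above G \<longleftrightarrow> flat E indep F \<and> G \<subset> F"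
  by (auto simp: above_def)

lemma above_empty_iff: "F \<in> above {} \<longleftrightarrow> flat E indep F \<and> F \<noteq> {}"
  by (auto simp: above_def)

lemma E_above_empty: "E \<in> above {}"
  using flat_E nonempty by (simp add: above_empty_iff)

lemma finite_above: "finite (above F)"
  using finite_L by (auto simp: above_def)

text \<open>A maximal flat between \<open>F\<close> and \<open>G\<close>, different from
  \<open>G\<close>, will do: one further element already generates \<open>G\<close> from it, and one
  element raises the rank by at most one.\<close>

lemma flat_cover:
  assumes F: "flat E indep F" and G: "flat E indep G" and "F \<subset> G"
  shows "\<exists>M\<in>flats. F \<le> M \<and> M < G \<and> rk G = Suc (rk M)"
proof -
  let ?S = "{M \<in> flats. F \<le> M \<and> M < G}"
  have fin: "finite ?S" using finite_L by (rule rev_finite_subset) auto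
  have "F \<in> ?S" using assms by simp
  then have "?S \<noteq> {}" by (metis empty_iff)
  from finite_has_maximal[OF fin this]
  obtain M where M: "M \<in> ?S" "\<forall>N\<in>?S. M \<le> N \<longrightarrow> M = N" by (rule bexE)
  obtain x where x: "x \<in> G" "x \<notin> M" using M(1) by blast
  have sub: "insert x M \<subseteq> E" using x M(1) flat_sub_E[OF G] by auto
  let ?N = "closure (insert x M)"
  have N: "flat E indep ?N" "insert x M \<subseteq> ?N" "?N \<subseteq> G"
    using flat_closure[OF sub] closure_superset[OF sub] closure_minimal[OF G, of "insert x M"] x M(1) by auto
  have "?N = G"
  proof (rule ccontr)
    assume "?N \<noteq> G"
    then have "?N \<in> ?S" using N M(1) by auto
    moreover have "M \<le> ?N" using N(2) by auto
    ultimately have "M = ?N" using M(2) by blast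
    then show False using N(2) x by blast
  qed
  then have "rk G = rk (insert x M)" using rank_closure[OF sub] by simp
  moreover have "rk M < rk G" using M(1) G flat_rank_strict by auto
  ultimately show ?thesis using rank_insert_le[of x M] M(1) by (intro bexI[of _ M]) auto
qed

text \<open>There is no rank left between \<open>F\<close> and \<open>G\<close>, so the closure of
  \<open>insert x F\<close> is all of \<open>G\<close>.\<close>

lemma flat_cover_closure:
  assumes F: "flat E indep F" and G: "flat E indep G" and "F \<subset> G" "rk G = Suc (rk F)"
    and "x \<in> G" "x \<notin> F" and M: "flat E indep M" "F \<subseteq> M" "x \<in> M"
  shows "G \<subseteq> M"
proof -
  have sub: "insert x F \<subseteq> E" using assms flat_sub_E[OF G] by auto
  have cl: "closure (insert x F) \<subseteq> G" using assms by (intro closure_minimal) auto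
  have "F \<subset> closure (insert x F)" using closure_superset[OF sub] \<open>x \<notin> F\<close> by auto
  then have "rk F < rk (closure (insert x F))" using F flat_closure[OF sub] flat_rank_strict by blast
  then have "\<not> closure (insert x F) \<subset> G"
    using flat_rank_strict[OF flat_closure[OF sub] G] assms(4) by auto
  then have "closure (insert x F) = G" using cl by blast
  moreover have "closure (insert x F) \<subseteq> M" using M by (intro closure_minimal) auto
  ultimately show ?thesis by simp
qed

section \<open>The two presentations\<close>

text \<open>This is \<open>y\<close> of the rank-one flat through \<open>i\<close>. Unlike the
  linear forms of the definition, it includes the variable of \<open>E\<close>.\<close>

definition Y :: "'a \<Rightarrow> 'a set mpoly" where
  "Y i = (\<Sum>M\<in>{M \<in> above {}. i \<in> M}. Var M)"

lemma atom:
  assumes "i \<in> E"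
  shows "closure {i} \<in> above {}" "i \<in> closure {i}" "rk (closure {i}) = 1" "y (closure {i}) = Y i"
proof -
  have sub: "{i} \<subseteq> E" using assms by simp
  show mem: "i \<in> closure {i}" using closure_superset[OF sub] by simp
  then show "closure {i} \<in> above {}" using flat_closure[OF sub] by (auto simp: above_empty_iff)
  show "rk (closure {i}) = 1" using rank_closure[OF sub] rank_indep[OF indep_singleton[OF assms]] by simp
  have "closure {i} \<subseteq> M \<longleftrightarrow> i \<in> M" if "flat E indep M" for M
    using closure_minimal[OF that, of "{i}"] mem by auto
  then show "y (closure {i}) = Y i"
    unfolding y_def Y_def by (intro sum.cong) (auto simp: above_empty_iff)
qed

lemma y_rank_one:
  assumes "G \<in> above {}" "rk G = 1" "i \<in> G"
  shows "y G = Y i"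
proof -
  have "G \<subseteq> M \<longleftrightarrow> i \<in> M" if "flat E indep M" for M
    using flat_cover_closure[OF flat_empty _ _ _ assms(3) _ that] assms
    by (auto simp: above_empty_iff rank_empty)
  then show ?thesis
    unfolding y_def Y_def using assms by (intro sum.cong) (auto simp: above_empty_iff)
qed

text \<open>A flat containing \<open>i\<close> that is comparable with \<open>F\<close> must contain
  \<open>F\<close>, as \<open>i \<notin> F\<close>, and therefore \<open>G\<close>; so
  \<open>Y i\<close> and \<open>y G\<close> agree next to \<open>Var F\<close>. In this way
  relations attached to elements produce those between consecutive ranks.\<close>

lemma Var_mult_y_cover:
  assumes K: "ideal K"
    and inc: "\<And>F G. F \<in> above {} \<Longrightarrow> G \<in> above {} \<Longrightarrow> \<not> F \<subseteq> G \<Longrightarrow> \<not> G \<subseteq> F \<Longrightarrow> Var F * Var G \<in> K"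
    and F: "F \<in> above {}" and G: "G \<in> above {}" "F \<subset> G" "rk G = Suc (rk F)"
    and i: "i \<in> G" "i \<notin> F" and Y: "Var F * Y i \<in> K"
  shows "Var F * y G \<in> K"
proof -
  have fin: "finite {M \<in> above {}. i \<in> M}" using finite_above by simp
  have "Y i = (\<Sum>M\<in>{M \<in> above {}. i \<in> M} - {M \<in> flats. G \<subseteq> M}. Var M) + y G"
    unfolding Y_def y_def
    using i G(1) by (intro sum.subset_diff fin) (auto simp: above_empty_iff)
  then have "Var F * Y i - Var F * y G = (\<Sum>M\<in>{M \<in> above {}. i \<in> M} - {M \<in> flats. G \<subseteq> M}. Var F * Var M)"
    by (simp add: distrib_left sum_distrib_left)
  also have "\<dots> \<in> K"
  proof (intro ideal_sum K inc F)
    fix M assume M: "M \<in> {M \<in> above {}. i \<in> M} - {M \<in> flats. G \<subseteq> M}"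
    then show "M \<in> above {}" by simp
    show "\<not> M \<subseteq> F" using M i by blast
    show "\<not> F \<subseteq> M"
      using M flat_cover_closure[of F G i M] F G i by (auto simp: above_empty_iff)
  qed
  finally show ?thesis using ideal_cong[OF K] Y by blast
qed

theorem red_H_eq:
  assumes h: "\<And>F. flat E indep F \<Longrightarrow> h F = 1 + (\<Sum>G\<in>above F. xsum (rk G - rk F - 1) * h G)"
  shows "red_H E indep = 1 + (\<Sum>F\<in>above {}. xsum (rk F - 1) * h F)"
proof -
  let ?V = "red_vars E indep" and ?G = "red_gens E indep" and ?I = "chow_ideal {} 0 (above {})"
  obtain B where B: "basis_mod ?I B" "mon_gf B = 1 + (\<Sum>F\<in>above {}. xsum (rk F - 1) * h F)"
    using chow_basis[of h "{}" "above {}" 0] h flat_empty upset_above[of "{}"]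
    by (auto simp: rank_empty)
  have V_iff: "F \<in> ?V \<longleftrightarrow> F \<in> above {} \<and> F \<noteq> E" for F
    by (auto simp: red_vars_def above_empty_iff)
  have finV: "finite ?V"
    using finite_above by (rule rev_finite_subset) (auto simp: V_iff)
  obtain i0 where i0: "i0 \<in> E" using nonempty by blast
  define L where "L i = (\<Sum>M\<in>{M \<in> ?V. i \<in> M}. Var M)" for i
  \<comment> \<open>The value at \<open>E\<close> is forced: \<open>Y i = Var E + L i\<close> has to
    go to zero, and with this choice it goes to the linear generator
    \<open>L i - L i0\<close>.\<close>
  define s where "s F = (if F \<in> ?V then Var F else if F = E then - L i0 else 0)" for F
  have Y_eq: "Y i = Var E + L i" if "i \<in> E" for i
  proof -
    have "{M \<in> above {}. i \<in> M} = insert E {M \<in> ?V. i \<in> M}"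
      using that E_above_empty by (auto simp: V_iff)
    moreover have "finite {M \<in> ?V. i \<in> M}" "E \<notin> {M \<in> ?V. i \<in> M}"
      using finV by simp (simp add: red_vars_def)
    ultimately show ?thesis by (simp only: Y_def L_def sum.insert not_False_eq_True)
  qed
  have Y_I: "Y i \<in> ?I" if "i \<in> E" for i
    using chow_ideal_y[OF atom(1)[OF that], of "{}" 0] atom[OF that] by (simp add: rank_empty)
  have lin: "(\<Sum>F\<in>?V. Cst ((if i \<in> F then 1 else 0) - (if j \<in> F then 1 else 0)) * Var F) = L i - L j" for i j
    unfolding L_def ring_hom_1.hom_diff[OF ring_hom_Cst] left_diff_distrib Cst_if
    using finV by (simp add: sum_subtractf sum.inter_filter)
  have lin_ideal: "L i - L j \<in> graded_ideal ?V ?G" if "i \<in> E" "j \<in> E" for i j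
    unfolding lin[symmetric]
    by (rule graded_ideal_lin_poly[OF _ finV]) (use that in \<open>auto simp: red_gens_def\<close>)
  have s_L: "subst s (L i) = L i" for i
    unfolding L_def subst_sum subst_Var by (intro sum.cong) (auto simp: s_def)
  have E_V: "E \<notin> ?V" by (simp add: red_vars_def)
  have s_Y: "subst s (Y i) \<in> graded_ideal ?V ?G" if "i \<in> E" for i
    using lin_ideal[OF that i0] E_V by (simp add: Y_eq[OF that] subst_add s_L subst_Var s_def)
  let ?K = "{p. subst s p \<in> graded_ideal ?V ?G}"
  have K: "ideal ?K" by (intro ideal_vimage ring_hom_subst ideal_graded_ideal)
  have K_inc: "Var F * Var G \<in> ?K" if "F \<in> above {}" "G \<in> above {}" "\<not> F \<subseteq> G" "\<not> G \<subseteq> F" for F G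
  proof -
    have V: "F \<in> ?V" "G \<in> ?V" using that flat_sub_E by (auto simp: V_iff above_empty_iff)
    then have "Var F * Var G \<in> graded_ideal ?V ?G"
      using that by (intro graded_ideal_Var_mult) (auto simp: red_gens_def)
    then show ?thesis using V by (simp add: subst_mult subst_Var s_def)
  qed
  have "?I \<subseteq> ?K"
  proof (rule chow_ideal_least[OF K])
    show "{} \<in> flats" using flat_empty by simp
    show "\<exists>M\<in>flats. F \<le> M \<and> M < G \<and> rk G = Suc (rk M)" if "F \<in> flats" "G \<in> flats" "F < G" for F G
      using flat_cover that by blast
    show "Var F \<in> ?K" if "F \<notin> above {}" for F
      using that E_above_empty by (auto simp: subst_Var s_def V_iff ideal_zero[OF ideal_graded_ideal])
    show "Var F * y G \<in> ?K"
      if FG: "F \<in> above {}" "G \<in> above {}" "F < G" "rk G = Suc (rk F)" for F G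
    proof -
      obtain i where i: "i \<in> G" "i \<notin> F" using FG by blast
      then have "i \<in> E" using FG flat_sub_E by (auto simp: above_empty_iff)
      then have "Y i \<in> ?K" using s_Y by simp
      then have "Var F * Y i \<in> ?K" by (rule ideal_mult[OF K])
      then show ?thesis using Var_mult_y_cover[OF K K_inc] FG i by blast
    qed
    show "y G ^ Suc 0 \<in> ?K" if G: "G \<in> above {}" "rk G = Suc (rk {})" for G
    proof -
      obtain i where i: "i \<in> G" using G by (auto simp: above_empty_iff)
      then have "i \<in> E" using G flat_sub_E by (auto simp: above_empty_iff)
      then show ?thesis using s_Y[of i] y_rank_one[OF G(1) _ i] G(2) by (simp add: rank_empty)
    qed
  qed (use K_inc in auto)
  then have s_I: "subst s p \<in> graded_ideal ?V ?G" if "p \<in> ?I" for p using that by blast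
  have "hilbert ?V ?G = mon_gf B"
  proof (rule hilbert_transfer[OF finV ideal_chow_ideal B(1) _ s_I, where t = Var])
    fix g assume "g \<in> ?G"
    then consider F G where "g = monomial_poly {#F, G#}" "F \<in> ?V" "G \<in> ?V" "\<not> F \<subseteq> G" "\<not> G \<subseteq> F"
      | i j where "g = lin_poly ?V (\<lambda>F. (if i \<in> F then 1 else 0) - (if j \<in> F then 1 else 0))" "i \<in> E" "j \<in> E"
      unfolding red_gens_def by blast
    then show "\<exists>p d. g = lookup p \<and> homog d g \<and> (\<forall>m\<in>keys p. set_mset m \<subseteq> ?V) \<and> subst Var p \<in> ?I"
    proof cases
      case 1
      show ?thesis unfolding 1(1)
        by (rule monomial_poly_presented) (use 1 chow_ideal_incomparable in auto)
    next
      case 2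
      have "L i - L j = Y i - Y j" using 2 by (simp add: Y_eq)
      then have "L i - L j \<in> ?I" using Y_I 2 by (simp add: ideal_diff[OF ideal_chow_ideal])
      moreover have "subst Var (L i - L j) = L i - L j" by (rule subst_keys_id) simp
      ultimately show ?thesis unfolding 2(1)
        by (intro lin_poly_presented finV) (simp only: lin)
    qed
  next
    fix F
    show "subst Var (s F) - Var F \<in> ?I"
    proof -
      have "subst Var (s F) = s F" by (rule subst_keys_id) simp
      moreover have "s F - Var F \<in> ?I"
      proof -
        consider "F \<in> ?V" | "F = E" | "F \<notin> above {}" by (auto simp: V_iff)
        then show ?thesis
        proof cases
          case 1
          then show ?thesis by (simp add: s_def ideal_zero[OF ideal_chow_ideal])
        next
          case 2
          then have "s F - Var F = - Y i0" using E_V by (simp add: s_def Y_eq[OF i0])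
          then show ?thesis using ideal_uminus[OF ideal_chow_ideal Y_I[OF i0]] by simp
        next
          case 3
          then have "s F = 0" using E_above_empty by (auto simp: s_def V_iff)
          then show ?thesis using ideal_uminus[OF ideal_chow_ideal chow_ideal_Var[OF 3]] by simp
        qed
      qed
      ultimately show ?thesis by simp
    qed
    show "keys (s F) \<subseteq> monoms ?V 1"
      using keys_sum_Var[of "{F}" ?V] keys_sum_Var[of "{M \<in> ?V. i0 \<in> M}" ?V]
      by (auto simp: s_def L_def keys_uminus)
  next
    fix F assume "F \<in> ?V"
    then show "subst s (Var F) - Var F \<in> graded_ideal ?V ?G"
      by (simp add: subst_Var s_def ideal_zero[OF ideal_graded_ideal])
  qed
  then show ?thesis by (simp add: red_H_def B(2))
qed

theorem aug_H_eq:
  assumes h: "\<And>F. flat E indep F \<Longrightarrow> h F = 1 + (\<Sum>G\<in>above F. xsum (rk G - rk F - 1) * h G)"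
  shows "aug_H E indep = 1 + (\<Sum>F\<in>above {}. xsum (rk F) * h F)"
proof -
  let ?V = "aug_vars E indep" and ?G = "aug_gens E indep" and ?I = "chow_ideal {} 1 (above {})"
  let ?P = "above {}" and ?Q = "{F. flat E indep F \<and> F \<noteq> E}"
  let ?GI = "graded_ideal ?V ?G"
  obtain B where B: "basis_mod ?I B" "mon_gf B = 1 + (\<Sum>F\<in>?P. xsum (rk F) * h F)"
    using chow_basis[of h "{}" ?P 1] h flat_empty upset_above[of "{}"]
    by (auto simp: rank_empty)
  have finQ: "finite ?Q" using finite_L by (rule rev_finite_subset) auto
  have finP: "finite ?P" by (rule finite_above)
  have V_eq: "?V = Inl ` ?Q \<union> Inr ` E" by (simp add: aug_vars_def)
  have finV: "finite ?V" using finQ finite_E by (simp add: V_eq)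
  have sum_V: "(\<Sum>v\<in>?V. f v) = (\<Sum>F\<in>?Q. f (Inl F)) + (\<Sum>i\<in>E. f (Inr i))" for f :: "_ \<Rightarrow> 'b::comm_monoid_add"
    unfolding V_eq using finQ finite_E
    by (subst sum.union_disjoint) (auto simp: sum.reindex)
  have QP: "?Q - {{}} = ?P - {E}" by (auto simp: above_empty_iff)
  have empty_Q: "{} \<in> ?Q" using flat_empty nonempty by auto
  \<comment> \<open>The value at \<open>E\<close> is chosen so that \<open>Y i\<close> goes to
    \<open>- N i\<close>, which is \<open>- Var (Inr i)\<close> modulo the linear
    generators.\<close>
  define s where "s F = (if F \<in> ?P \<and> F \<noteq> E then Var (Inl F) else
      if F = E then - (\<Sum>G\<in>?Q. Var (Inl G)) else 0 :: ('a set + 'a) mpoly)" for F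
  define X where "X = (\<Sum>M\<in>?P. Var M)"
  \<comment> \<open>Inverse dictionary: the variable of the empty flat is minus the sum
    \<open>X\<close> of all variables of nonempty flats, \<open>E\<close> included, and the variable
    of an element is \<open>- Y i\<close>.\<close>
  define t where "t v = (case v of Inl F \<Rightarrow> if F = {} then - X else Var F | Inr i \<Rightarrow> - Y i)" for v
  define N where "N i = (\<Sum>M\<in>{M \<in> ?Q. i \<notin> M}. Var (Inl M) :: ('a set + 'a) mpoly)" for i
  have s_Q: "(\<Sum>G\<in>{G \<in> ?P - {E}. R G}. s G) = (\<Sum>G\<in>{G \<in> ?P - {E}. R G}. Var (Inl G))" for R
    by (intro sum.cong) (auto simp: s_def)
  have s_E: "s E = - (\<Sum>G\<in>?Q. Var (Inl G))" by (simp add: s_def)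
  have s_Y: "subst s (Y i) = - N i" if i: "i \<in> E" for i
  proof -
    have eq: "{M \<in> ?P. i \<in> M} = insert E {M \<in> ?P - {E}. i \<in> M}"
      using i E_above_empty by auto
    have "subst s (Y i) = s E + (\<Sum>G\<in>{G \<in> ?P - {E}. i \<in> G}. s G)"
      unfolding Y_def subst_sum subst_Var eq using finP by (subst sum.insert) auto
    also have "(\<Sum>G\<in>{G \<in> ?P - {E}. i \<in> G}. s G) = (\<Sum>G\<in>{G \<in> ?P - {E}. i \<in> G}. Var (Inl G))"
      by (rule s_Q)
    also have "{G \<in> ?P - {E}. i \<in> G} = ?Q - {M \<in> ?Q. i \<notin> M}"
      by (auto simp: above_empty_iff)
    also have "(\<Sum>G\<in>?Q - {M \<in> ?Q. i \<notin> M}. Var (Inl G)) = (\<Sum>G\<in>?Q. Var (Inl G)) - N i"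
      unfolding N_def using finQ by (intro sum_diff) auto
    finally show ?thesis by (simp add: s_E)
  qed
  let ?lin = "\<lambda>i v. case v of Inr i' \<Rightarrow> (if i' = i then 1 else 0) | Inl F \<Rightarrow> (if i \<notin> F then -1 else 0 :: rat)"
  have lin: "(\<Sum>v\<in>?V. Cst (?lin i v) * f v)
      = f (Inr i) - (\<Sum>M\<in>{M \<in> ?Q. i \<notin> M}. f (Inl M))" if "i \<in> E" for i and f :: "_ \<Rightarrow> 'w mpoly"
    unfolding sum_V sum.case Cst_if Cst_if_uminus using that finQ finite_E
    by (simp add: sum.inter_filter[symmetric] sum_negf Cst_if Cst_if_uminus)
  have lin_ideal: "Var (Inr i) - N i \<in> ?GI" if "i \<in> E" for i
    unfolding N_def lin[OF that, symmetric]
    by (rule graded_ideal_lin_poly[OF _ finV]) (use that in \<open>auto simp: aug_gens_def\<close>)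
  have Inr_Inl: "Var (Inr i) * Var (Inl F) \<in> ?GI" if "i \<in> E" "F \<in> ?Q" "i \<notin> F" for i F
    using that by (intro graded_ideal_Var_mult) (auto simp: aug_gens_def V_eq)
  have Inr_N: "Var (Inr i) * N i \<in> ?GI" if "i \<in> E" for i
    unfolding N_def sum_distrib_left using that by (intro ideal_sum ideal_graded_ideal Inr_Inl) auto
  have N_Inl: "N i * Var (Inl F) \<in> ?GI" if "i \<in> E" "F \<in> ?Q" "i \<notin> F" for i F
  proof -
    have "Var (Inr i) * Var (Inl F) - N i * Var (Inl F) \<in> ?GI"
      using ideal_mult_right[OF ideal_graded_ideal lin_ideal[OF that(1)], of "Var (Inl F)"]
      by (simp add: left_diff_distrib)
    then show ?thesis using ideal_cong[OF ideal_graded_ideal] Inr_Inl[OF that] by blast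
  qed
  \<comment> \<open>The element variable kills each summand of \<open>N i\<close> and agrees with
    \<open>N i\<close>. This square is the atom relation for \<open>\<epsilon> = 1\<close>.\<close>
  have N_N: "N i * N i \<in> ?GI" if "i \<in> E" for i
  proof -
    have "Var (Inr i) * N i - N i * N i \<in> ?GI"
      using ideal_mult_right[OF ideal_graded_ideal lin_ideal[OF that], of "N i"]
      by (simp add: left_diff_distrib)
    then show ?thesis using ideal_cong[OF ideal_graded_ideal] Inr_N[OF that] by blast
  qed
  let ?K = "{p. subst s p \<in> ?GI}"
  have K: "ideal ?K" by (intro ideal_vimage ring_hom_subst ideal_graded_ideal)
  have K_inc: "Var F * Var G \<in> ?K" if "F \<in> ?P" "G \<in> ?P" "\<not> F \<subseteq> G" "\<not> G \<subseteq> F" for F G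
  proof -
    have FG: "F \<in> ?Q" "G \<in> ?Q" using that flat_sub_E by (auto simp: above_empty_iff)
    have "monomial_poly {#Inl F, Inl G#} \<in> ?G"
      unfolding aug_gens_def using that FG by blast
    then have "Var (Inl F) * Var (Inl G) \<in> ?GI"
      by (rule graded_ideal_Var_mult) (use FG in \<open>auto simp: V_eq\<close>)
    then show ?thesis using that(1,2) FG by (simp add: subst_mult subst_Var s_def)
  qed
  have "?I \<subseteq> ?K"
  proof (rule chow_ideal_least[OF K])
    show "{} \<in> flats" using flat_empty by simp
    show "\<exists>M\<in>flats. F \<le> M \<and> M < G \<and> rk G = Suc (rk M)" if "F \<in> flats" "G \<in> flats" "F < G" for F G
      using flat_cover that by blast
    show "Var F \<in> ?K" if "F \<notin> ?P" for F
      using that E_above_empty by (auto simp: subst_Var s_def ideal_zero[OF ideal_graded_ideal])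
    show "Var F * y G \<in> ?K"
      if FG: "F \<in> ?P" "G \<in> ?P" "F < G" "rk G = Suc (rk F)" for F G
    proof -
      obtain i where i: "i \<in> G" "i \<notin> F" using FG by blast
      then have iE: "i \<in> E" using FG flat_sub_E by (auto simp: above_empty_iff)
      then have "F \<noteq> E" using i by blast
      then have "subst s (Var F * Y i) = - (N i * Var (Inl F))"
        using FG by (simp add: subst_mult subst_Var s_Y[OF iE] s_def mult.commute)
      moreover have "N i * Var (Inl F) \<in> ?GI"
        using iE FG i \<open>F \<noteq> E\<close> by (intro N_Inl) (auto simp: above_empty_iff)
      ultimately have "Var F * Y i \<in> ?K" by (simp add: ideal_uminus[OF ideal_graded_ideal])
      then show ?thesis using Var_mult_y_cover[OF K K_inc] FG i by blast
    qed
    show "y G ^ Suc 1 \<in> ?K" if G: "G \<in> ?P" "rk G = Suc (rk {})" for G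
    proof -
      obtain i where i: "i \<in> G" using G by (auto simp: above_empty_iff)
      then have iE: "i \<in> E" using G flat_sub_E by (auto simp: above_empty_iff)
      have "y G = Y i" using y_rank_one[OF G(1) _ i] G(2) by (simp add: rank_empty)
      then show ?thesis using N_N[OF iE] by (simp add: subst_mult s_Y[OF iE])
    qed
  qed (use K_inc in auto)
  then have s_I: "subst s p \<in> ?GI" if "p \<in> ?I" for p using that by blast
  \<comment> \<open>The rank-one flat of \<open>i\<close> is incomparable with \<open>F\<close>, so
    exponent 1 suffices: relations with a factor \<open>Var F\<close> carry no shift
    \<open>\<epsilon>\<close>.\<close>
  have Y_Var: "Y i * Var F \<in> ?I" if i: "i \<in> E" and F: "F \<in> ?P" "i \<notin> F" for i F
  proof -
    note a = atom[OF i]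
    have "\<not> F \<subseteq> closure {i}"
    proof
      assume "F \<subseteq> closure {i}"
      then have "F \<subset> closure {i}" using a(2) F(2) by blast
      then have "rk F < 1" using flat_rank_strict[of F "closure {i}"] F(1) a(1,3) by (auto simp: above_empty_iff)
      moreover have "rk {} < rk F" using flat_rank_strict[OF flat_empty] F(1) by (auto simp: above_empty_iff)
      ultimately show False by simp
    qed
    moreover have "\<not> closure {i} \<subseteq> F" using a(2) F(2) by blast
    ultimately have "Var F * (\<Sum>M\<in>{M \<in> flats. closure {i} \<subseteq> M}. Var M) ^ 1 \<in> ?I"
      using a flat_empty F(1) upset_above[of "{}"]
      by (intro chow_ideal_Var_sum_power[where A' = "{}"]) (auto simp: above_empty_iff rank_empty)
    then show ?thesis using a(4) by (simp add: y_def mult.commute)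
  qed
  have Y_Y: "Y i * Y i \<in> ?I" if "i \<in> E" for i
    using chow_ideal_y[OF atom(1)[OF that], of "{}" 1] atom[OF that]
    by (simp add: rank_empty numeral_2_eq_2)
  \<comment> \<open>The counterpart of the relation between an element and the empty flat. Only the
    summand \<open>Y i * Y i\<close> remains, and it vanishes by the atom relation with exponent
    2.\<close>
  have Y_X: "Y i * X \<in> ?I" if "i \<in> E" for i
  proof -
    have "X = (\<Sum>M\<in>{M \<in> ?P. i \<notin> M}. Var M) + Y i"
    proof -
      have "{M \<in> ?P. i \<notin> M} = ?P - {M \<in> ?P. i \<in> M}" by auto
      then show ?thesis unfolding X_def Y_def using finP by (auto intro!: sum.subset_diff)
    qed
    then have "Y i * X = (\<Sum>M\<in>{M \<in> ?P. i \<notin> M}. Y i * Var M) + Y i * Y i"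
      by (simp add: distrib_left sum_distrib_left)
    also have "\<dots> \<in> ?I"
      using that by (intro ideal_add ideal_sum ideal_chow_ideal Y_Var Y_Y) auto
    finally show ?thesis .
  qed
  have t_sum: "(\<Sum>M\<in>{M \<in> ?Q. R M}. t (Inl M)) = (\<Sum>M\<in>{M \<in> ?P - {E}. R M}. Var M) - X"
    if "R {}" for R
  proof -
    have "{M \<in> ?Q. R M} = insert {} {M \<in> ?P - {E}. R M}"
      using that empty_Q by (auto simp: above_empty_iff)
    moreover have "finite {M \<in> ?P - {E}. R M}" using finP by simp
    moreover have "{} \<notin> {M \<in> ?P - {E}. R M}" by (simp add: above_empty_iff)
    ultimately have "(\<Sum>M\<in>{M \<in> ?Q. R M}. t (Inl M)) = t (Inl {}) + (\<Sum>M\<in>{M \<in> ?P - {E}. R M}. t (Inl M))"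
      by (simp only: sum.insert not_False_eq_True)
    also have "(\<Sum>M\<in>{M \<in> ?P - {E}. R M}. t (Inl M)) = (\<Sum>M\<in>{M \<in> ?P - {E}. R M}. Var M)"
      by (intro sum.cong) (auto simp: t_def above_empty_iff)
    finally show ?thesis by (simp add: t_def)
  qed
  have X_E: "X = (\<Sum>M\<in>?P - {E}. Var M) + Var E"
    unfolding X_def using finP E_above_empty by (simp add: sum.remove[of ?P E] add.commute)
  have "hilbert ?V ?G = mon_gf B"
  proof (rule hilbert_transfer[OF finV ideal_chow_ideal B(1) _ s_I, where t = t])
    fix g assume "g \<in> ?G"
    then consider i where "g = lin_poly ?V (?lin i)" "i \<in> E"
      | F G where "g = monomial_poly {#Inl F, Inl G#}" "F \<in> ?Q" "G \<in> ?Q" "\<not> F \<subseteq> G" "\<not> G \<subseteq> F"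
      | i F where "g = monomial_poly {#Inr i, Inl F#}" "i \<in> E" "F \<in> ?Q" "i \<notin> F"
      unfolding aug_gens_def by blast
    then show "\<exists>p d. g = lookup p \<and> homog d g \<and> (\<forall>m\<in>keys p. set_mset m \<subseteq> ?V) \<and> subst t p \<in> ?I"
    proof cases
      case 1
      have "X = (\<Sum>M\<in>{M \<in> ?P - {E}. i \<notin> M}. Var M) + Y i"
      proof -
        have "{M \<in> ?P - {E}. i \<notin> M} = ?P - {M \<in> ?P. i \<in> M}" using 1 by auto
        then show ?thesis unfolding X_def Y_def using finP by (auto intro!: sum.subset_diff)
      qed
      moreover have "(\<Sum>M\<in>{M \<in> ?Q. i \<notin> M}. t (Inl M)) = (\<Sum>M\<in>{M \<in> ?P - {E}. i \<notin> M}. Var M) - X"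
        by (rule t_sum) simp
      moreover have "t (Inr i) = - Y i" by (simp add: t_def)
      ultimately have "t (Inr i) - (\<Sum>M\<in>{M \<in> ?Q. i \<notin> M}. t (Inl M)) = 0"
        by (simp only: diff_add_cancel) simp
      then have "subst t (\<Sum>v\<in>?V. Cst (?lin i v) * Var v) = 0"
        unfolding lin[OF 1(2)] subst_diff subst_sum subst_Var .
      then show ?thesis unfolding 1(1)
        by (intro lin_poly_presented finV) (simp only: ideal_zero[OF ideal_chow_ideal])
    next
      case 2
      then have "t (Inl F) * t (Inl G) = Var F * Var G" by (auto simp: t_def)
      then show ?thesis unfolding 2(1)
        by (intro monomial_poly_presented) (use 2 chow_ideal_incomparable in \<open>auto simp: V_eq\<close>)
    next
      case 3
      have "t (Inr i) * t (Inl F) \<in> ?I"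
      proof (cases "F = {}")
        case True
        then show ?thesis using Y_X[OF 3(2)] by (simp add: t_def)
      next
        case False
        then show ?thesis using Y_Var[OF 3(2) _ 3(4)] 3(3)
          by (simp add: t_def above_empty_iff ideal_uminus[OF ideal_chow_ideal])
      qed
      then show ?thesis unfolding 3(1)
        by (intro monomial_poly_presented) (use 3 in \<open>auto simp: V_eq\<close>)
    qed
  next
    fix F
    show "subst t (s F) - Var F \<in> ?I"
    proof -
      consider "F \<in> ?P" "F \<noteq> E" | "F = E" | "F \<notin> ?P" by blast
      then show ?thesis
      proof cases
        case 1
        then have "subst t (s F) = Var F" by (simp add: s_def subst_Var t_def above_empty_iff)
        then show ?thesis by (simp add: ideal_zero[OF ideal_chow_ideal])
      next
        case 2
        have "(\<Sum>G\<in>?Q. t (Inl G)) = - Var E"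
          using t_sum[of "\<lambda>_. True"] X_E by (simp add: set_diff_eq)
        then have "subst t (s F) = Var F"
          using 2 by (simp add: s_E subst_uminus subst_sum subst_Var)
        then show ?thesis by (simp add: ideal_zero[OF ideal_chow_ideal])
      next
        case 3
        then have "s F = 0" using E_above_empty by (auto simp: s_def)
        then show ?thesis
          using ideal_uminus[OF ideal_chow_ideal chow_ideal_Var[OF 3]]
          by (simp add: ring_hom_1.hom_zero[OF ring_hom_subst])
      qed
    qed
    have "keys (\<Sum>G\<in>?Q. Var (Inl G) :: ('a set + 'a) mpoly) \<subseteq> monoms ?V 1"
    proof -
      have "(\<Sum>G\<in>?Q. Var (Inl G)) = (\<Sum>v\<in>Inl ` ?Q. Var v :: ('a set + 'a) mpoly)"
        by (simp add: sum.reindex)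
      then show ?thesis using keys_sum_Var[of "Inl ` ?Q" ?V] by (simp add: V_eq)
    qed
    moreover have "keys (Var (Inl F) :: ('a set + 'a) mpoly) \<subseteq> monoms ?V 1" if "F \<in> ?P" "F \<noteq> E"
      using keys_sum_Var[of "{Inl F}" ?V] that by (simp add: V_eq above_empty_iff)
    ultimately show "keys (s F) \<subseteq> monoms ?V 1"
      by (simp add: s_def keys_uminus)
  next
    fix v assume v: "v \<in> ?V"
    show "subst s (t v) - Var v \<in> ?GI"
    proof (cases v)
      case (Inr i)
      then have i: "i \<in> E" using v by (auto simp: V_eq)
      then have "subst s (t v) - Var v = - (Var (Inr i) - N i)"
        using Inr by (simp add: t_def subst_uminus s_Y)
      then show ?thesis using ideal_uminus[OF ideal_graded_ideal lin_ideal[OF i]] by simp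
    next
      case (Inl F)
      then have F: "F \<in> ?Q" using v by (auto simp: V_eq)
      show ?thesis
      proof (cases "F = {}")
        case True
        have "subst s X = (\<Sum>M\<in>?P - {E}. s M) + s E"
          by (simp add: X_E subst_add subst_sum subst_Var)
        also have "(\<Sum>M\<in>?P - {E}. s M) = (\<Sum>M\<in>?P - {E}. Var (Inl M))"
          by (intro sum.cong) (auto simp: s_def)
        also have "\<dots> = (\<Sum>M\<in>?Q. Var (Inl M)) - Var (Inl {})"
          using sum.remove[OF finQ empty_Q, of "\<lambda>M. Var (Inl M) :: ('a set + 'a) mpoly"] unfolding QP by simp
        finally have "subst s X = - Var (Inl {})" by (simp add: s_E)
        then have "subst s (t v) = Var v" using True Inl by (simp add: t_def subst_uminus)
        then show ?thesis by (simp add: ideal_zero[OF ideal_graded_ideal])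
      next
        case False
        then have "subst s (t v) = Var v"
          using F Inl by (simp add: t_def subst_Var s_def above_empty_iff)
        then show ?thesis by (simp add: ideal_zero[OF ideal_graded_ideal])
      qed
    qed
  qed
  then show ?thesis by (simp add: aug_H_def B(2))
qed

end

section \<open>Paving matroids\<close>

text \<open>For a set \<open>S\<close> of \<open>s \<le> k - 2\<close> elements, the reduced Hilbert series of the contraction \<open>M / S\<close>
  is \<open>low_gf n k s\<close> plus \<open>hyp_gf k m s\<close> for each hyperplane of size \<open>m\<close> containing \<open>S\<close>.\<close>

function low_gf :: "nat \<Rightarrow> nat \<Rightarrow> nat \<Rightarrow> int fps" where
  "low_gf n k s = 1 + xsum (k - s - 1)
     + (\<Sum>t\<in>{s<..<k - 1}. xsum (t - s - 1) * (of_nat ((n - s) choose (t - s)) * low_gf n k t))"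
  by auto
termination by (relation "measure (\<lambda>(n, k, s). k - s)") auto

function hyp_gf :: "nat \<Rightarrow> nat \<Rightarrow> nat \<Rightarrow> int fps" where
  "hyp_gf k m s = xsum (k - 1 - s - 1)
     + (\<Sum>t\<in>{s<..<k - 1}. xsum (t - s - 1) * (of_nat ((m - s) choose (t - s)) * hyp_gf k m t))"
  by auto
termination by (relation "measure (\<lambda>(k, m, s). k - s)") auto

text \<open>The weight \<open>w\<close> of a rank is \<open>\<lambda>r. xsum (r - 1)\<close> for the
  reduced series and \<open>xsum\<close> for the augmented one, which allows one computation for
  both.\<close>

definition low_total :: "(nat \<Rightarrow> int fps) \<Rightarrow> nat \<Rightarrow> nat \<Rightarrow> int fps" where
  "low_total w n k = 1 + w k + (\<Sum>t\<in>{0<..<k - 1}. w t * (of_nat (n choose t) * low_gf n k t))"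

text \<open>The function f_k of the overview: the weight of the hyperplane itself plus its share in
  the nonempty small flats below it.\<close>

definition hyp_total :: "(nat \<Rightarrow> int fps) \<Rightarrow> nat \<Rightarrow> nat \<Rightarrow> int fps" where
  "hyp_total w k m = w (k - 1) + (\<Sum>t\<in>{0<..<k - 1}. w t * (of_nat (m choose t) * hyp_gf k m t))"

declare low_gf.simps [simp del] hyp_gf.simps [simp del]

lemma card_subsets_between:
  assumes "finite X" "S \<subseteq> X" "card S \<le> t"
  shows "card {T. S \<subseteq> T \<and> T \<subseteq> X \<and> card T = t} = (card X - card S) choose (t - card S)"
proof -
  have finS: "finite S" using assms finite_subset by blast
  have "bij_betw (\<lambda>R. S \<union> R) {R. R \<subseteq> X - S \<and> card R = t - card S} {T. S \<subseteq> T \<and> T \<subseteq> X \<and> card T = t}"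
  proof (rule bij_betw_byWitness[where f' = "\<lambda>T. T - S"])
    show "(\<lambda>R. S \<union> R) ` {R. R \<subseteq> X - S \<and> card R = t - card S} \<subseteq> {T. S \<subseteq> T \<and> T \<subseteq> X \<and> card T = t}"
    proof safe
      fix R assume R: "R \<subseteq> X - S" "card R = t - card S"
      then have "finite R" "S \<inter> R = {}" using assms finite_subset by blast+
      then show "card (S \<union> R) = t" using R assms(3) finS by (simp add: card_Un_disjoint)
    qed (use assms in auto)
    show "(\<lambda>T. T - S) ` {T. S \<subseteq> T \<and> T \<subseteq> X \<and> card T = t} \<subseteq> {R. R \<subseteq> X - S \<and> card R = t - card S}"
      using finS by (auto simp: card_Diff_subset)
  qed auto
  then have "card {T. S \<subseteq> T \<and> T \<subseteq> X \<and> card T = t} = card {R. R \<subseteq> X - S \<and> card R = t - card S}"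
    by (simp add: bij_betw_same_card)
  also have "\<dots> = (card X - card S) choose (t - card S)"
    using assms finS by (simp add: n_subsets card_Diff_subset)
  finally show ?thesis .
qed

section \<open>Flats of a paving matroid and the solution of the recursion\<close>

locale paving_matroid = loopless_matroid +
  fixes k :: nat
  assumes paving: "paving E indep" and rank_E: "rank indep E = k"
begin

lemma k_pos: "k \<ge> 1"
proof -
  obtain x where "x \<in> E" using nonempty by blast
  then show ?thesis using card_le_rank[OF indep_singleton, of x E] rank_E by simp
qed

text \<open>A minimal dependent subset would be a circuit with fewer than \<open>k\<close>
  elements.\<close>

lemma indep_small:
  assumes "X \<subseteq> E" "card X < k"
  shows "indep X"
proof (rule ccontr)
  assume X: "\<not> indep X"
  let ?D = "{C. C \<subseteq> X \<and> \<not> indep C}"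
  have finX: "finite X" using assms finite_E finite_subset by blast
  have "finite ?D" by (rule finite_subset[of _ "Pow X"]) (use finX in auto)
  moreover have "?D \<noteq> {}" using X by blast
  ultimately have "\<exists>C\<in>?D. \<forall>D\<in>?D. D \<le> C \<longrightarrow> C = D" by (rule finite_has_minimal)
  then obtain C where C: "C \<in> ?D" "\<forall>D\<in>?D. D \<le> C \<longrightarrow> C = D" by (rule bexE)
  then have "circuit E indep C" using assms(1) unfolding circuit_def by blast
  then have "k \<le> card C" using paving rank_E by (simp add: paving_def)
  moreover have "card C \<le> card X" using C(1) finX by (intro card_mono) auto
  ultimately show False using assms(2) by simp
qed

lemma rank_small: "X \<subseteq> E \<Longrightarrow> card X < k \<Longrightarrow> rk X = card X"
  by (intro rank_indep indep_small)

lemma rank_large: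
  assumes "X \<subseteq> E" "k - 1 \<le> card X"
  shows "k - 1 \<le> rk X"
proof -
  obtain T where T: "T \<subseteq> X" "card T = k - 1" using assms(2) by (metis obtain_subset_with_card_n)
  then have "indep T" using assms(1) k_pos by (intro indep_small) auto
  then show ?thesis using T card_le_rank by metis
qed

definition HP :: "'a set set" where "HP = {H. hyperplane E indep H}"

lemma HP_D:
  assumes "H \<in> HP"
  shows "flat E indep H" "H \<subseteq> E" "rk H = k - 1" "H \<noteq> E" "k - 1 \<le> card H"
proof -
  show f: "flat E indep H" and r: "rk H = k - 1" and "H \<noteq> E" and sub: "H \<subseteq> E"
    using assms rank_E flat_sub_E by (auto simp: HP_def hyperplane_def)
  show "k - 1 \<le> card H"
    using rank_le_card[of H] r sub finite_E finite_subset by metis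
qed

lemma HP_I: "flat E indep H \<Longrightarrow> rk H = k - 1 \<Longrightarrow> H \<in> HP"
  using k_pos rank_E by (simp add: HP_def hyperplane_def)

lemma finite_HP: "finite HP"
  using HP_D(2) finite_E by (auto intro: finite_subset[of _ "Pow E"])

lemma flat_cases:
  assumes "flat E indep F"
  obtains "F = E" | "F \<in> HP" | "card F + 2 \<le> k"
proof -
  consider "F = E" | "rk F < k"
    using flat_rank_strict[OF assms flat_E] flat_sub_E[OF assms] rank_E by blast
  then show ?thesis
  proof cases
    case 1
    then show ?thesis by (rule that(1))
  next
    case 2
    show ?thesis
    proof (cases "k - 1 \<le> card F")
      case True
      then have "rk F = k - 1" using rank_large[OF flat_sub_E[OF assms]] 2 by simp
      then show ?thesis using that(2) HP_I assms by blast
    next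
      case False
      then show ?thesis using that(3) by simp
    qed
  qed
qed

lemma flat_small:
  assumes "F \<subseteq> E" "card F + 2 \<le> k"
  shows "flat E indep F"
  unfolding flat_def
proof (intro conjI ballI assms)
  fix x assume x: "x \<in> E - F"
  have "finite F" using assms finite_E finite_subset by blast
  then have "card (insert x F) = Suc (card F)" using x by simp
  then show "rk F < rk (insert x F)" using x assms by (simp add: rank_small)
qed

lemma card_E_ge: "k \<le> card E"
  using rank_le_card[OF finite_E] rank_E by simp

text \<open>The bound is \<open>k - 2\<close> because sets with \<open>k - 1\<close> elements,
  although independent, need not be closed.\<close>

definition mid :: "'a set \<Rightarrow> 'a set set" where
  "mid S = {T. S \<subset> T \<and> T \<subseteq> E \<and> card T + 2 \<le> k}"

lemma finite_mid: "finite (mid S)"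
  using finite_E by (auto simp: mid_def intro: finite_subset[of _ "Pow E"])

lemma above_small:
  assumes "S \<subseteq> E" "card S + 2 \<le> k"
  shows "above S = mid S \<union> {H \<in> HP. S \<subseteq> H} \<union> {E}"
    and "mid S \<inter> {H \<in> HP. S \<subseteq> H} = {}" "E \<notin> mid S \<union> {H \<in> HP. S \<subseteq> H}"
proof -
  have "S \<noteq> E" using assms card_E_ge by auto
  moreover have "S \<noteq> H" if "H \<in> HP" for H using assms(2) HP_D(5)[OF that] by auto
  ultimately have ne: "S \<noteq> E" "S \<notin> HP" by blast+
  show "above S = mid S \<union> {H \<in> HP. S \<subseteq> H} \<union> {E}"
  proof (intro equalityI subsetI)
    fix F assume "F \<in> above S"
    then have F: "flat E indep F" "S \<subset> F" by (auto simp: above_iff)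
    from F(1) show "F \<in> mid S \<union> {H \<in> HP. S \<subseteq> H} \<union> {E}"
      by (cases rule: flat_cases) (use F flat_sub_E[OF F(1)] in \<open>auto simp: mid_def\<close>)
  next
    fix F assume "F \<in> mid S \<union> {H \<in> HP. S \<subseteq> H} \<union> {E}"
    then consider "F \<in> mid S" | "F \<in> HP" "S \<subseteq> F" | "F = E" by blast
    then show "F \<in> above S"
      by cases (use ne assms(1) flat_small flat_E HP_D(1) in \<open>auto simp: above_iff mid_def\<close>)
  qed
  show "mid S \<inter> {H \<in> HP. S \<subseteq> H} = {}"
    using HP_D(5) by (fastforce simp: mid_def)
  show "E \<notin> mid S \<union> {H \<in> HP. S \<subseteq> H}"
    using card_E_ge HP_D(4) by (auto simp: mid_def)
qed

text \<open>Closed solution of the recursion required by \<open>red_H_eq\<close> and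
  \<open>aug_H_eq\<close>, meant for flats \<open>S\<close>. The value is 1 at hyperplanes and at
  \<open>E\<close>, where the contraction has rank at most one.\<close>

definition h :: "'a set \<Rightarrow> int fps" where
  "h S = (if S = E \<or> S \<in> HP then 1
     else low_gf (card E) k (card S) + (\<Sum>H\<in>{H \<in> HP. S \<subseteq> H}. hyp_gf k (card H) (card S)))"

text \<open>Double counting of pairs of a small flat \<open>T\<close> of size \<open>t\<close> and a
  hyperplane containing it: each hyperplane above \<open>S\<close> is met once for every
  \<open>T\<close> between \<open>S\<close> and it.\<close>

lemma sum_mid_card:
  assumes "S \<subseteq> E" and t: "card S < t" "t < k - 1"
  shows "(\<Sum>T\<in>{T \<in> mid S. card T = t}. h T)
    = of_nat ((card E - card S) choose (t - card S)) * low_gf (card E) k t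
      + (\<Sum>H\<in>{H \<in> HP. S \<subseteq> H}. of_nat ((card H - card S) choose (t - card S)) * hyp_gf k (card H) t)"
proof -
  let ?M = "{T \<in> mid S. card T = t}"
  have M_eq: "?M = {T. S \<subseteq> T \<and> T \<subseteq> E \<and> card T = t}" using t by (auto simp: mid_def)
  have card_M: "card ?M = (card E - card S) choose (t - card S)"
    unfolding M_eq using assms finite_E by (intro card_subsets_between) auto
  have "h T = low_gf (card E) k t + (\<Sum>H\<in>{H \<in> HP. T \<subseteq> H}. hyp_gf k (card H) t)" if "T \<in> ?M" for T
  proof -
    have "T \<noteq> E" "T \<notin> HP" using that t card_E_ge HP_D(5)[of T] by auto
    then show ?thesis using that by (simp add: h_def)
  qed
  then have "(\<Sum>T\<in>?M. h T) = of_nat (card ?M) * low_gf (card E) k t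
      + (\<Sum>T\<in>?M. \<Sum>H\<in>{H \<in> HP. T \<subseteq> H}. hyp_gf k (card H) t)"
    by (simp add: sum.distrib)
  also have "(\<Sum>T\<in>?M. \<Sum>H\<in>{H \<in> HP. T \<subseteq> H}. hyp_gf k (card H) t)
      = (\<Sum>H\<in>HP. \<Sum>T\<in>{T \<in> ?M. T \<subseteq> H}. hyp_gf k (card H) t)"
    using finite_mid finite_HP by (intro sum.swap_restrict) auto
  also have "\<dots> = (\<Sum>H\<in>HP. of_nat (card {T \<in> ?M. T \<subseteq> H}) * hyp_gf k (card H) t)"
    by simp
  also have "\<dots> = (\<Sum>H\<in>{H \<in> HP. S \<subseteq> H}. of_nat (card {T \<in> ?M. T \<subseteq> H}) * hyp_gf k (card H) t)"
  proof (rule sum.mono_neutral_right[OF finite_HP])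
    show "\<forall>H\<in>HP - {H \<in> HP. S \<subseteq> H}. of_nat (card {T \<in> ?M. T \<subseteq> H}) * hyp_gf k (card H) t = 0"
    proof
      fix H assume "H \<in> HP - {H \<in> HP. S \<subseteq> H}"
      then have "{T \<in> ?M. T \<subseteq> H} = {}" unfolding M_eq by blast
      then show "of_nat (card {T \<in> ?M. T \<subseteq> H}) * hyp_gf k (card H) t = 0" by (simp only: card.empty) simp
    qed
  qed auto
  also have "\<dots> = (\<Sum>H\<in>{H \<in> HP. S \<subseteq> H}. of_nat ((card H - card S) choose (t - card S)) * hyp_gf k (card H) t)"
  proof (intro sum.cong refl)
    fix H assume H: "H \<in> {H \<in> HP. S \<subseteq> H}"
    then have HE: "H \<subseteq> E" using HP_D(2) by blast
    then have "{T \<in> ?M. T \<subseteq> H} = {T. S \<subseteq> T \<and> T \<subseteq> H \<and> card T = t}" unfolding M_eq by blast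
    also have "card \<dots> = (card H - card S) choose (t - card S)"
      using H HE finite_E t by (intro card_subsets_between) (auto intro: finite_subset)
    finally show "of_nat (card {T \<in> ?M. T \<subseteq> H}) * hyp_gf k (card H) t
        = of_nat ((card H - card S) choose (t - card S)) * hyp_gf k (card H) t" by simp
  qed
  finally show ?thesis by (simp only: card_M)
qed

text \<open>The weight is arbitrary because two uses are intended:
  \<open>xsum (r - card S - 1)\<close> gives the recursion for \<open>h S\<close>, and
  \<open>S = {}\<close> gives the two series themselves.\<close>

lemma sum_above_small:
  assumes S: "S \<subseteq> E" "card S + 2 \<le> k"
  shows "(\<Sum>F\<in>above S. w (rk F) * h F)
    = w k + (\<Sum>t\<in>{card S<..<k - 1}. w t * (of_nat ((card E - card S) choose (t - card S)) * low_gf (card E) k t))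
      + (\<Sum>H\<in>{H \<in> HP. S \<subseteq> H}. w (k - 1)
          + (\<Sum>t\<in>{card S<..<k - 1}. w t * (of_nat ((card H - card S) choose (t - card S)) * hyp_gf k (card H) t)))"
proof -
  let ?H = "{H \<in> HP. S \<subseteq> H}" and ?R = "{card S<..<k - 1}"
  note ab = above_small[OF S]
  have "(\<Sum>F\<in>above S. w (rk F) * h F) = (\<Sum>F\<in>mid S. w (rk F) * h F) + (\<Sum>F\<in>?H. w (rk F) * h F) + w (rk E) * h E"
    unfolding ab(1) using ab(2,3) finite_mid finite_HP by (simp add: sum.union_disjoint add.commute)
  also have "w (rk E) * h E = w k" by (simp add: rank_E h_def)
  also have "(\<Sum>F\<in>?H. w (rk F) * h F) = (\<Sum>F\<in>?H. w (k - 1))"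
    by (intro sum.cong refl) (simp add: HP_D(3) h_def)
  also have "(\<Sum>F\<in>mid S. w (rk F) * h F) = (\<Sum>F\<in>mid S. w (card F) * h F)"
    by (intro sum.cong refl) (auto simp: mid_def rank_small)
  also have "\<dots> = (\<Sum>t\<in>?R. \<Sum>T\<in>{T \<in> mid S. card T = t}. w (card T) * h T)"
  proof (rule sum.group[symmetric])
    show "card ` mid S \<subseteq> ?R"
    proof
      fix t assume "t \<in> card ` mid S"
      then obtain T where T: "t = card T" "S \<subset> T" "T \<subseteq> E" "card T + 2 \<le> k" by (auto simp: mid_def)
      then have "card S < card T" using finite_E by (meson psubset_card_mono finite_subset)
      then show "t \<in> ?R" using T by simp
    qed
  qed (auto simp: finite_mid)
  also have "\<dots> = (\<Sum>t\<in>?R. w t * (\<Sum>T\<in>{T \<in> mid S. card T = t}. h T))"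
    unfolding sum_distrib_left by (intro sum.cong) auto
  also have "\<dots> = (\<Sum>t\<in>?R. w t * (of_nat ((card E - card S) choose (t - card S)) * low_gf (card E) k t))
      + (\<Sum>t\<in>?R. \<Sum>H\<in>?H. w t * (of_nat ((card H - card S) choose (t - card S)) * hyp_gf k (card H) t))"
    unfolding sum.distrib[symmetric] using S(1)
    by (intro sum.cong refl) (simp add: sum_mid_card distrib_left sum_distrib_left)
  also have "(\<Sum>t\<in>?R. \<Sum>H\<in>?H. w t * (of_nat ((card H - card S) choose (t - card S)) * hyp_gf k (card H) t))
      = (\<Sum>H\<in>?H. \<Sum>t\<in>?R. w t * (of_nat ((card H - card S) choose (t - card S)) * hyp_gf k (card H) t))"
    by (rule sum.swap)
  finally show ?thesis by (simp add: sum.distrib add_ac)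
qed

lemma above_E: "above E = {}"
  using flat_sub_E unfolding set_eq_iff above_iff by blast

lemma above_HP:
  assumes "H \<in> HP"
  shows "above H = {E}"
proof -
  have "F = E" if "F \<in> above H" for F
  proof (rule ccontr)
    assume "F \<noteq> E"
    then have "rk F < rk E" using that flat_sub_E by (intro flat_rank_strict flat_E) (auto simp: above_iff)
    moreover have "rk H < rk F" using that HP_D(1)[OF assms] by (intro flat_rank_strict) (auto simp: above_iff)
    ultimately show False using HP_D(3)[OF assms] rank_E by simp
  qed
  moreover have "E \<in> above H" using HP_D(2,4)[OF assms] flat_E by (auto simp: above_iff)
  ultimately show ?thesis by blast
qed

lemma h_rec:
  assumes "flat E indep F"
  shows "h F = 1 + (\<Sum>G\<in>above F. xsum (rk G - rk F - 1) * h G)"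
  using assms
proof (cases rule: flat_cases)
  case 1
  then show ?thesis by (simp add: above_E h_def)
next
  case 2
  \<comment> \<open>Only \<open>E\<close> lies above a hyperplane, and it enters with the weight
    \<open>xsum 0 = 0\<close>.\<close>
  then show ?thesis using k_pos by (simp add: above_HP h_def HP_D(3) rank_E xsum_def)
next
  case 3
  have F: "F \<subseteq> E" using assms by (rule flat_sub_E)
  have "F \<noteq> E" "F \<notin> HP" using 3 card_E_ge HP_D(5)[of F] by auto
  then show ?thesis
    using 3 F sum_above_small[OF F 3, of "\<lambda>r. xsum (r - card F - 1)"]
    by (simp add: h_def rank_small low_gf.simps[of _ _ "card F"] hyp_gf.simps[of _ _ "card F"] add_ac)
qed

lemma sum_above_empty:
  assumes "w 0 = 0"
  shows "1 + (\<Sum>F\<in>above {}. w (rk F) * h F) = low_total w (card E) k + (\<Sum>H\<in>HP. hyp_total w k (card H))"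
proof (cases "k = 1")
  \<comment> \<open>In rank one the empty set is itself the hyperplane. It is not among the flats
    above \<open>{}\<close>, and \<open>w 0 = 0\<close> makes its term on the right-hand side
    vanish.\<close>
  case True
  have "H = {}" if "H \<in> HP" for H
    using flat_rank_strict[OF flat_empty HP_D(1)[OF that]] HP_D(3)[OF that] True by auto
  then have "{} \<in> HP" using HP_I[OF flat_empty] True by (simp add: rank_empty)
  then have "above {} = {E}" by (rule above_HP)
  moreover have "h E = 1" by (simp add: h_def)
  ultimately have "(\<Sum>F\<in>above {}. w (rk F) * h F) = w k" by (simp add: rank_E)
  moreover have "low_total w (card E) k = 1 + w k" "hyp_total w k m = 0" for m
    using True assms by (simp_all add: low_total_def hyp_total_def)
  ultimately show ?thesis by simp
next
  case False
  then have "card {} + 2 \<le> k" using k_pos by simp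
  from sum_above_small[OF empty_subsetI this, of w] show ?thesis
    by (simp add: low_total_def hyp_total_def add_ac)
qed

lemma red_H_total:
  "red_H E indep = low_total (\<lambda>r. xsum (r - 1)) (card E) k
     + (\<Sum>H\<in>HP. hyp_total (\<lambda>r. xsum (r - 1)) k (card H))"
  using red_H_eq[OF h_rec] sum_above_empty[of "\<lambda>r. xsum (r - 1)"] by (simp add: xsum_def)

lemma aug_H_total:
  "aug_H E indep = low_total xsum (card E) k + (\<Sum>H\<in>HP. hyp_total xsum k (card H))"
  using aug_H_eq[OF h_rec] sum_above_empty[of xsum] by (simp add: xsum_def)

text \<open>A set of \<open>k - 1\<close> elements is independent by paving, so its closure is a
  hyperplane; by rank it equals every hyperplane that contains the set.\<close>

lemma sum_HP_choose: "(\<Sum>H\<in>HP. card H choose (k - 1)) = card E choose (k - 1)"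
proof -
  let ?S = "\<lambda>X. {T. T \<subseteq> X \<and> card T = k - 1}"
  have fin: "finite X" if "X \<subseteq> E" for X using that finite_E finite_subset by blast
  have "?S E = (\<Union>H\<in>HP. ?S H)"
  proof (intro equalityI subsetI)
    fix T assume "T \<in> ?S E"
    then have T: "T \<subseteq> E" "card T = k - 1" by auto
    then have "rk T = k - 1" using k_pos by (simp add: rank_small)
    then have "closure T \<in> HP" using flat_closure rank_closure T by (intro HP_I) auto
    then show "T \<in> (\<Union>H\<in>HP. ?S H)" using closure_superset T by blast
  qed (use HP_D(2) in blast)
  moreover have "?S H \<inter> ?S H' = {}" if H: "H \<in> HP" "H' \<in> HP" "H \<noteq> H'" for H H'
  proof -
    have False if T: "T \<subseteq> H" "T \<subseteq> H'" "card T = k - 1" for T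
    proof -
      have TE: "T \<subseteq> E" using T(1) HP_D(2)[OF H(1)] by blast
      have rT: "rk T = k - 1" using T(3) TE k_pos by (simp add: rank_small)
      have "closure T = G" if "G \<in> HP" "T \<subseteq> G" for G
        using flat_rank_strict[OF flat_closure[OF TE] HP_D(1)[OF that(1)]]
          closure_minimal[OF HP_D(1)[OF that(1)] that(2)] rank_closure[OF TE] rT HP_D(3)[OF that(1)]
        by auto
      then show False using H T by metis
    qed
    then show ?thesis by blast
  qed
  ultimately have "card (?S E) = (\<Sum>H\<in>HP. card (?S H))"
    using finite_HP HP_D(2) fin by (simp add: card_UN_disjoint)
  also have "\<dots> = (\<Sum>H\<in>HP. card H choose (k - 1))"
    using HP_D(2) fin by (intro sum.cong refl n_subsets) auto
  finally show ?thesis using finite_E by (simp add: n_subsets)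
qed

text \<open>The restriction is uniform because sets with fewer than \<open>k\<close> elements are
  independent, and the contraction because it has rank at most one and, \<open>H\<close> being a
  flat, no loops. Hence \<open>lam\<close> counts all hyperplanes of a given size.\<close>

lemma HP_stressed:
  assumes "H \<in> HP"
  shows "stressed_hyperplane E indep H"
  unfolding stressed_hyperplane_def stressed_def
proof (intro conjI)
  show "hyperplane E indep H" using assms by (simp add: HP_def)
  show "H \<subseteq> E" by (rule HP_D(2)[OF assms])
  have "rank (restr_indep indep H) H = rk H"
    unfolding rank_def restr_indep_def by (rule arg_cong[where f = Max]) auto
  then show "uniform H (restr_indep indep H)"
    using HP_D(2,3)[OF assms] k_pos by (auto simp: uniform_def restr_indep_def intro!: indep_small)
  let ?c = "contr_indep E indep H"
  have card_le: "card X \<le> 1" if "X \<subseteq> E - H" "?c X" for X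
  proof -
    have "X \<union> H \<subseteq> E" using that(1) HP_D(2)[OF assms] by blast
    then have "rk (X \<union> H) \<le> k" using rank_mono[of "X \<union> H" E] rank_E by simp
    then show ?thesis using that(2) HP_D(3)[OF assms] k_pos by (simp add: contr_indep_def)
  qed
  have c_empty: "?c {}" by (simp add: contr_indep_def)
  \<comment> \<open>The contraction has not been established as a matroid, so the maximum that
    defines its rank is handled directly.\<close>
  have "{card X |X. X \<subseteq> E - H \<and> ?c X} \<subseteq> {..1}" using card_le by auto
  then have "finite {card X |X. X \<subseteq> E - H \<and> ?c X}" by (rule finite_subset) simp
  moreover have "{card X |X. X \<subseteq> E - H \<and> ?c X} \<noteq> {}" using c_empty by blast
  ultimately have "rank ?c (E - H) \<in> {card X |X. X \<subseteq> E - H \<and> ?c X}"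
    unfolding rank_def by (rule Max_in)
  then have rank_c: "rank ?c (E - H) \<le> 1" using card_le by auto
  show "uniform (E - H) ?c"
    unfolding uniform_def
  proof (intro allI impI, elim conjE)
    fix X assume X: "X \<subseteq> E - H" "card X \<le> rank ?c (E - H)"
    have finX: "finite X" using X(1) finite_E by (meson Diff_subset finite_subset order_trans)
    show "?c X"
    proof (cases "X = {}")
      case False
      then have "card X = 1" using X(2) rank_c finX by (simp add: card_gt_0_iff le_antisym Suc_leI)
      then obtain x where x: "X = {x}" by (rule card_1_singletonE)
      then have "rk H < rk (insert x H)" using X(1) HP_D(1)[OF assms] by (auto simp: flat_def)
      then show ?thesis using x X(1) rank_insert_le[of x H] by (simp add: contr_indep_def)
    qed (simp add: c_empty)
  qed
qed

lemma stressed_hyperplane_iff: "stressed_hyperplane E indep H \<longleftrightarrow> H \<in> HP"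
  using HP_stressed by (auto simp: stressed_hyperplane_def HP_def)

text \<open>At size \<open>k - 1\<close> the binomial coefficient is 1 and the difference vanishes,
  so only larger hyperplanes leave a correction; \<open>sum_HP_choose\<close> collects the rest into
  one term.\<close>

lemma sum_HP_defect:
  fixes g :: "nat \<Rightarrow> int fps"
  shows "(\<Sum>H\<in>HP. g (card H)) = of_nat (card E choose (k - 1)) * g (k - 1)
    + (\<Sum>H\<in>{H \<in> HP. k \<le> card H}. g (card H) - of_nat (card H choose (k - 1)) * g (k - 1))"
proof -
  have "(\<Sum>H\<in>{H \<in> HP. k \<le> card H}. g (card H) - of_nat (card H choose (k - 1)) * g (k - 1))
      = (\<Sum>H\<in>HP. g (card H) - of_nat (card H choose (k - 1)) * g (k - 1))"
  proof (rule sum.mono_neutral_left[OF finite_HP])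
    show "\<forall>H\<in>HP - {H \<in> HP. k \<le> card H}. g (card H) - of_nat (card H choose (k - 1)) * g (k - 1) = 0"
    proof
      fix H assume "H \<in> HP - {H \<in> HP. k \<le> card H}"
      then have "card H = k - 1" using HP_D(5)[of H] by auto
      then show "g (card H) - of_nat (card H choose (k - 1)) * g (k - 1) = 0" by simp
    qed
  qed auto
  also have "\<dots> = (\<Sum>H\<in>HP. g (card H)) - of_nat (\<Sum>H\<in>HP. card H choose (k - 1)) * g (k - 1)"
    by (simp add: sum_subtractf sum_distrib_right)
  finally show ?thesis unfolding sum_HP_choose by simp
qed

end

text \<open>The value when all hyperplanes have \<open>k - 1\<close> elements: every subset of that
  size is then a hyperplane.\<close>

definition uniform_total :: "(nat \<Rightarrow> int fps) \<Rightarrow> nat \<Rightarrow> nat \<Rightarrow> int fps" where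
  "uniform_total w k n = low_total w n k + of_nat (n choose (k - 1)) * hyp_total w k (k - 1)"

text \<open>The contribution of one hyperplane of size \<open>m\<close>, relative to having its
  subsets of size \<open>k - 1\<close> as hyperplanes instead.\<close>

definition defect :: "(nat \<Rightarrow> int fps) \<Rightarrow> nat \<Rightarrow> nat \<Rightarrow> int fps" where
  "defect w k m = hyp_total w k m - of_nat (m choose (k - 1)) * hyp_total w k (k - 1)"

context paving_matroid
begin

lemma total_defect:
  "low_total w (card E) k + (\<Sum>H\<in>HP. hyp_total w k (card H))
    = uniform_total w k (card E) + (\<Sum>H\<in>{H \<in> HP. k \<le> card H}. defect w k (card H))"
  by (simp add: sum_HP_defect[of "hyp_total w k"] uniform_total_def defect_def)

lemmas red_H_defect = red_H_total[unfolded total_defect]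
lemmas aug_H_defect = aug_H_total[unfolded total_defect]

lemma sum_defect_by_card:
  "(\<Sum>H\<in>{H \<in> HP. k \<le> card H}. g (card H)) = (\<Sum>h\<in>{k..card E}. of_nat (card {H \<in> HP. card H = h}) * g h)"
  for g :: "nat \<Rightarrow> int fps"
proof -
  have "(\<Sum>H\<in>{H \<in> HP. k \<le> card H}. g (card H))
      = (\<Sum>h\<in>{k..card E}. \<Sum>H\<in>{H \<in> {H \<in> HP. k \<le> card H}. card H = h}. g (card H))"
    using finite_HP card_mono[OF finite_E HP_D(2)]
    by (intro sum.group[symmetric]) auto
  also have "\<dots> = (\<Sum>h\<in>{k..card E}. of_nat (card {H \<in> HP. card H = h}) * g h)"
  proof (intro sum.cong refl)
    fix h assume "h \<in> {k..card E}"
    then have "{H \<in> {H \<in> HP. k \<le> card H}. card H = h} = {H \<in> HP. card H = h}" by auto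
    then show "(\<Sum>H\<in>{H \<in> {H \<in> HP. k \<le> card H}. card H = h}. g (card H)) = of_nat (card {H \<in> HP. card H = h}) * g h"
      by simp
  qed
  finally show ?thesis .
qed

end

section \<open>The comparison matroids\<close>

lemma paving_matroid_uniform:
  assumes "1 \<le> k" "k \<le> n"
  shows "paving_matroid (U_ground n) (U_indep k n) k"
proof -
  have M: "matroid (U_ground n) (U_indep k n)"
    unfolding matroid_def
  proof (intro conjI allI impI, goal_cases)
    case (4 X Y)
    then have "finite Y" by (auto simp: U_indep_def intro: finite_subset)
    then show ?case using 4 card_mono[of Y X] by (auto simp: U_indep_def)
  next
    case (5 X Y)
    then have fin: "finite X" "finite Y" by (auto simp: U_indep_def intro: finite_subset)
    then have "\<not> Y \<subseteq> X" using 5 card_mono[of X Y] by auto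
    then obtain y where "y \<in> Y - X" by blast
    then show ?case using 5 fin by (intro bexI[of _ y]) (auto simp: U_indep_def)
  qed (auto simp: U_ground_def U_indep_def)
  have LM: "loopless_matroid (U_ground n) (U_indep k n)"
    by (rule loopless_matroid.intro[OF M])
      (use assms in \<open>auto simp: loopless_def U_indep_def U_ground_def\<close>)
  interpret loopless_matroid "U_ground n" "U_indep k n" by (rule LM)
  have rank: "rank (U_indep k n) (U_ground n) = k"
  proof (rule antisym)
    obtain X where "U_indep k n X" "card X = rank (U_indep k n) (U_ground n)"
      using rank_attained by metis
    then show "rank (U_indep k n) (U_ground n) \<le> k" by (simp add: U_indep_def)
    have "U_indep k n {0..<k}" "{0..<k} \<subseteq> U_ground n" using assms by (auto simp: U_indep_def U_ground_def)
    then show "k \<le> rank (U_indep k n) (U_ground n)" using card_le_rank[of "{0..<k}"] by simp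
  qed
  show ?thesis
  proof
    show "paving (U_ground n) (U_indep k n)"
      unfolding paving_def rank
    proof (intro allI impI)
      fix C assume "circuit (U_ground n) (U_indep k n) C"
      then have "C \<subseteq> {0..<n}" "\<not> U_indep k n C" by (simp_all add: circuit_def U_ground_def)
      then show "k \<le> card C" by (simp add: U_indep_def)
    qed
  qed (rule rank)
qed

text \<open>Any \<open>k\<close> elements are independent, so they do not fit into a hyperplane,
  whose rank is \<open>k - 1\<close>.\<close>

lemma uniform_no_large_hyperplane:
  assumes "1 \<le> k" "k \<le> n"
  shows "{H \<in> paving_matroid.HP (U_ground n) (U_indep k n). k \<le> card H} = {}"
proof -
  interpret paving_matroid "U_ground n" "U_indep k n" k by (rule paving_matroid_uniform[OF assms])
  have False if H: "H \<in> HP" "k \<le> card H" for H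
  proof -
    obtain T where T: "T \<subseteq> H" "card T = k" using H(2) by (metis obtain_subset_with_card_n)
    then have "U_indep k n T" using HP_D(2)[OF H(1)] by (auto simp: U_indep_def U_ground_def)
    then have "k \<le> rk H" using T card_le_rank by metis
    then show False using HP_D(3)[OF H(1)] k_pos by simp
  qed
  then show ?thesis by blast
qed

lemma H_uniform:
  assumes "1 \<le> k" "k \<le> n"
  shows "red_H (U_ground n) (U_indep k n) = uniform_total (\<lambda>r. xsum (r - 1)) k n"
    and "aug_H (U_ground n) (U_indep k n) = uniform_total xsum k n"
proof -
  interpret paving_matroid "U_ground n" "U_indep k n" k by (rule paving_matroid_uniform[OF assms])
  show "red_H (U_ground n) (U_indep k n) = uniform_total (\<lambda>r. xsum (r - 1)) k n"
    and "aug_H (U_ground n) (U_indep k n) = uniform_total xsum k n"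
    unfolding red_H_defect aug_H_defect uniform_no_large_hyperplane[OF assms]
    by (simp_all add: U_ground_def)
qed

text \<open>The bound \<open>2 \<le> k\<close> keeps the summand of rank \<open>k - 1\<close> free
  of loops; rank one is treated apart in the final proof.\<close>

lemma paving_matroid_Usum:
  assumes "2 \<le> k" "k \<le> m"
  shows "paving_matroid (Usum_ground m) (Usum_indep (k - 1) m) k"
proof -
  let ?I = "Usum_indep (k - 1) m"
  have M: "matroid (Usum_ground m) ?I"
    unfolding matroid_def
  proof (intro conjI allI impI, goal_cases)
    case (4 X Y)
    have "card (X \<inter> {0..<m}) \<le> card (Y \<inter> {0..<m})" using 4 by (intro card_mono) auto
    then show ?case using 4 by (auto simp: Usum_indep_def)
  next
    case (5 X Y)
    then have XY: "X \<subseteq> {0..<m + 1}" "Y \<subseteq> {0..<m + 1}" "card (X \<inter> {0..<m}) \<le> k - 1"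
      "card (Y \<inter> {0..<m}) \<le> k - 1" "card X < card Y" by (auto simp: Usum_indep_def)
    have split: "card Z = card (Z \<inter> {0..<m}) + (if m \<in> Z then 1 else 0)" if Z: "Z \<subseteq> {0..<m + 1}" for Z
    proof -
      have "Z = (Z \<inter> {0..<m}) \<union> (if m \<in> Z then {m} else {})" using Z by (auto simp: less_Suc_eq)
      then have "card Z = card ((Z \<inter> {0..<m}) \<union> (if m \<in> Z then {m} else {}))" by simp
      also have "\<dots> = card (Z \<inter> {0..<m}) + card (if m \<in> Z then {m} else {})"
        by (rule card_Un_disjoint) auto
      finally show ?thesis by simp
    qed
    show ?case
    proof (cases "m \<in> Y - X")
      case True
      have "insert m X \<inter> {0..<m} = X \<inter> {0..<m}" by auto
      then show ?thesis using True XY by (intro bexI[of _ m]) (auto simp: Usum_indep_def)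
    next
      case False
      then have lt: "card (X \<inter> {0..<m}) < card (Y \<inter> {0..<m})"
        using split[OF XY(1)] split[OF XY(2)] XY(5) by (auto split: if_splits)
      then have "\<not> Y \<inter> {0..<m} \<subseteq> X \<inter> {0..<m}"
        using card_mono[of "X \<inter> {0..<m}" "Y \<inter> {0..<m}"] by auto
      then obtain y where "y \<in> Y \<inter> {0..<m}" "y \<notin> X \<inter> {0..<m}" by blast
      then have y: "y \<in> Y - X" "y < m" by auto
      then have "insert y X \<inter> {0..<m} = insert y (X \<inter> {0..<m})" by auto
      then have "card (insert y X \<inter> {0..<m}) \<le> k - 1" using y XY lt by simp
      then show ?thesis using y XY by (intro bexI[of _ y]) (auto simp: Usum_indep_def)
    qed
  qed (auto simp: Usum_ground_def Usum_indep_def)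
  have single: "?I {x}" if "x \<in> Usum_ground m" for x
  proof -
    have "card ({x} \<inter> {0..<m}) \<le> card {x}" by (intro card_mono) auto
    then show ?thesis using that assms by (simp add: Usum_indep_def Usum_ground_def)
  qed
  have LM: "loopless_matroid (Usum_ground m) ?I"
    by (rule loopless_matroid.intro[OF M])
      (use single in \<open>auto simp: loopless_def Usum_ground_def\<close>)
  interpret loopless_matroid "Usum_ground m" ?I by (rule LM)
  have rank: "rank ?I (Usum_ground m) = k"
  proof (rule antisym)
    obtain X where X: "?I X" "card X = rank ?I (Usum_ground m)"
      using rank_attained by metis
    have "X \<subseteq> insert m (X \<inter> {0..<m})" using X(1) by (auto simp: Usum_indep_def less_Suc_eq)
    then have "card X \<le> card (insert m (X \<inter> {0..<m}))" by (intro card_mono) auto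
    also have "\<dots> \<le> Suc (card (X \<inter> {0..<m}))" by (simp add: card_insert_if)
    finally have "rank ?I (Usum_ground m) \<le> Suc (card (X \<inter> {0..<m}))" using X(2) by simp
    moreover have "card (X \<inter> {0..<m}) \<le> k - 1" using X(1) by (simp add: Usum_indep_def)
    ultimately show "rank ?I (Usum_ground m) \<le> k" using assms by linarith
    have "insert m {0..<k - 1} \<inter> {0..<m} = {0..<k - 1}" using assms by auto
    then have "?I (insert m {0..<k - 1})" "insert m {0..<k - 1} \<subseteq> Usum_ground m" "card (insert m {0..<k - 1}) = k"
      using assms by (auto simp: Usum_indep_def Usum_ground_def)
    then show "k \<le> rank ?I (Usum_ground m)" using card_le_rank by metis
  qed
  show ?thesis
  proof
    show "paving (Usum_ground m) ?I"
      unfolding paving_def rank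
    proof (intro allI impI)
      fix C assume "circuit (Usum_ground m) ?I C"
      then have "C \<subseteq> {0..<m + 1}" "\<not> ?I C" by (simp_all add: circuit_def Usum_ground_def)
      then have C: "C \<subseteq> {0..<m + 1}" "\<not> card (C \<inter> {0..<m}) \<le> k - 1"
        by (simp_all add: Usum_indep_def)
      have "card (C \<inter> {0..<m}) \<le> card C" using C(1) by (intro card_mono) (auto intro: finite_subset)
      then show "k \<le> card C" using C(2) by simp
    qed
  qed (rule rank)
qed

text \<open>A hyperplane with at least \<open>k\<close> elements that contained the coloop
  \<open>m\<close> would contain \<open>k - 1\<close> others, and together these are independent of
  size \<open>k\<close>. So it lies in \<open>{0..<m}\<close>, which has rank \<open>k - 1\<close>
  and therefore equals it.\<close>

lemma Usum_large_hyperplane: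
  assumes "2 \<le> k" "k \<le> m"
  shows "{H \<in> paving_matroid.HP (Usum_ground m) (Usum_indep (k - 1) m). k \<le> card H} = {{0..<m}}"
proof -
  let ?I = "Usum_indep (k - 1) m"
  interpret paving_matroid "Usum_ground m" ?I k by (rule paving_matroid_Usum[OF assms])
  have sub: "{0..<m} \<subseteq> Usum_ground m" by (auto simp: Usum_ground_def)
  have rank_m: "rk {0..<m} = k - 1"
  proof (rule antisym)
    obtain X where "X \<subseteq> {0..<m}" "?I X" "card X = rk {0..<m}" by (rule rank_attained)
    then show "rk {0..<m} \<le> k - 1" by (auto simp: Usum_indep_def Int_absorb2)
    show "k - 1 \<le> rk {0..<m}" using assms sub by (intro rank_large) auto
  qed
  have sub_m: "H \<subseteq> {0..<m}" if H: "H \<in> HP" "k \<le> card H" for H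
  proof (rule ccontr)
    assume "\<not> H \<subseteq> {0..<m}"
    then have "m \<in> H" using HP_D(2)[OF H(1)] by (auto simp: Usum_ground_def less_Suc_eq)
    have "H \<subseteq> insert m (H \<inter> {0..<m})" using HP_D(2)[OF H(1)] by (auto simp: Usum_ground_def less_Suc_eq)
    then have "card H \<le> card (insert m (H \<inter> {0..<m}))" by (intro card_mono) auto
    also have "\<dots> = Suc (card (H \<inter> {0..<m}))" by simp
    finally have "k - 1 \<le> card (H \<inter> {0..<m})" using H(2) by simp
    then obtain T where T: "T \<subseteq> H \<inter> {0..<m}" "card T = k - 1" by (metis obtain_subset_with_card_n)
    then have finT: "finite T" using finite_subset by blast
    have "insert m T \<inter> {0..<m} = T" using T by auto
    then have "?I (insert m T)" using T by (auto simp: Usum_indep_def)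
    then have "card (insert m T) \<le> rk H" using T \<open>m \<in> H\<close> by (intro card_le_rank) auto
    moreover have "card (insert m T) = k" using T finT assms by (subst card_insert_disjoint) auto
    ultimately show False using HP_D(3)[OF H(1)] k_pos by simp
  qed
  have cl: "closure {0..<m} \<in> HP"
    using flat_closure[OF sub] rank_closure[OF sub] rank_m by (intro HP_I) auto
  have "card {0..<m} \<le> card (closure {0..<m})"
    using closure_superset[OF sub] closure_sub_E finite_E by (intro card_mono) (auto intro: finite_subset)
  then have "closure {0..<m} \<subseteq> {0..<m}" using cl assms by (intro sub_m) auto
  then have "{0..<m} \<in> HP" using cl closure_superset[OF sub] by (metis subset_antisym)
  moreover have "H = {0..<m}" if H: "H \<in> HP" "k \<le> card H" for H
    using sub_m[OF H] flat_rank_strict[OF HP_D(1)[OF H(1)] HP_D(1)[OF \<open>{0..<m} \<in> HP\<close>]] HP_D(3)[OF H(1)] rank_m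
    by auto
  moreover have "k \<le> card {0..<m}" using assms by simp
  ultimately show ?thesis by blast
qed

lemma H_Usum:
  assumes "2 \<le> k" "k \<le> m"
  shows "red_H (Usum_ground m) (Usum_indep (k - 1) m)
      = uniform_total (\<lambda>r. xsum (r - 1)) k (m + 1) + defect (\<lambda>r. xsum (r - 1)) k m"
    and "aug_H (Usum_ground m) (Usum_indep (k - 1) m) = uniform_total xsum k (m + 1) + defect xsum k m"
proof -
  interpret paving_matroid "Usum_ground m" "Usum_indep (k - 1) m" k by (rule paving_matroid_Usum[OF assms])
  show "red_H (Usum_ground m) (Usum_indep (k - 1) m)
      = uniform_total (\<lambda>r. xsum (r - 1)) k (m + 1) + defect (\<lambda>r. xsum (r - 1)) k m"
    and "aug_H (Usum_ground m) (Usum_indep (k - 1) m) = uniform_total xsum k (m + 1) + defect xsum k m"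
    unfolding red_H_defect aug_H_defect Usum_large_hyperplane[OF assms]
    by (simp_all add: Usum_ground_def)
qed

theorem theorem1p12:
  fixes E :: "'a set" and indep :: "'a set \<Rightarrow> bool" and k n :: nat
    and lam :: "nat \<Rightarrow> nat"
  assumes "matroid E indep" and "loopless E indep" and "paving E indep"
    and "rank indep E = k" and "k \<ge> 1" and "card E = n"
    and "\<And>h. lam h = card {H. stressed_hyperplane E indep H \<and> card H = h}"
  shows "(red_H E indep =
           red_H (U_ground n) (U_indep k n)
           - (\<Sum>h\<in>{k..n}. of_nat (lam h) *
                (red_H (U_ground (h+1)) (U_indep k (h+1))
                 - red_H (Usum_ground h) (Usum_indep (k-1) h))))
         \<and> (aug_H E indep =
           aug_H (U_ground n) (U_indep k n)
           - (\<Sum>h\<in>{k..n}. of_nat (lam h) *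
                (aug_H (U_ground (h+1)) (U_indep k (h+1))
                 - aug_H (Usum_ground h) (Usum_indep (k-1) h))))"
proof -
  have "E \<noteq> {}"
  proof
    assume "E = {}"
    then have "{card X |X. X \<subseteq> E \<and> indep X} \<subseteq> {0}" by auto
    moreover have "indep {}" using assms(1) by (simp add: matroid_def)
    then have "0 \<in> {card X |X. X \<subseteq> E \<and> indep X}" by (intro CollectI exI[of _ "{}"]) simp
    ultimately have "{card X |X. X \<subseteq> E \<and> indep X} = {0}" by blast
    then show False using assms(4,5) by (simp add: rank_def)
  qed
  then interpret paving_matroid E indep k
    by unfold_locales (use assms in auto)
  have n: "1 \<le> k" "k \<le> n" using assms(5,6) card_E_ge by auto
  have lam: "lam h = card {H \<in> HP. card H = h}" for h
    by (simp add: assms(7) stressed_hyperplane_iff)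
  have lam_0: "lam h = 0" if "k = 1" "1 \<le> h" for h
  proof -
    have "card H = 0" if "H \<in> HP" for H
    proof -
      have "\<not> {} \<subset> H"
        using flat_rank_strict[OF flat_empty HP_D(1)[OF that]] HP_D(3)[OF that] \<open>k = 1\<close> by auto
      then show ?thesis by auto
    qed
    then have "{H \<in> HP. card H = h} = {}" using that(2) by auto
    then show ?thesis unfolding lam by (simp only: card.empty)
  qed
  \<comment> \<open>Both comparison matroids have rank \<open>k\<close> and \<open>h + 1\<close>
    elements, so their \<open>uniform_total\<close> parts cancel and minus the defect of one
    hyperplane of size \<open>h\<close> remains.\<close>
  have red: "of_nat (lam h) * (red_H (U_ground (h+1)) (U_indep k (h+1)) - red_H (Usum_ground h) (Usum_indep (k-1) h))
      = - (of_nat (lam h) * defect (\<lambda>r. xsum (r - 1)) k h)"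
    and aug: "of_nat (lam h) * (aug_H (U_ground (h+1)) (U_indep k (h+1)) - aug_H (Usum_ground h) (Usum_indep (k-1) h))
      = - (of_nat (lam h) * defect xsum k h)" if "h \<in> {k..n}" for h
  proof -
    consider "k = 1" | "2 \<le> k" using n by linarith
    then have "lam h = 0 \<or> 2 \<le> k" using lam_0[of h] that by cases auto
    then show "of_nat (lam h) * (red_H (U_ground (h+1)) (U_indep k (h+1)) - red_H (Usum_ground h) (Usum_indep (k-1) h))
      = - (of_nat (lam h) * defect (\<lambda>r. xsum (r - 1)) k h)"
      and "of_nat (lam h) * (aug_H (U_ground (h+1)) (U_indep k (h+1)) - aug_H (Usum_ground h) (Usum_indep (k-1) h))
      = - (of_nat (lam h) * defect xsum k h)"
      using that n H_uniform[of k "h + 1"] H_Usum[of k h] by auto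
  qed
  show ?thesis
    unfolding red_H_defect aug_H_defect sum_defect_by_card lam[symmetric] assms(6) H_uniform[OF n]
    by (simp only: sum.cong[OF refl red] sum.cong[OF refl aug] sum_negf diff_minus_eq_add simp_thms)
qed

end
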